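(* Let $\kappa\in\mathbb{C}$ and suppose that the function $E_\kappa:\mathbb{C}\to\mathbb{C}$, $E_\kappa(z):=\exp(z)+\kappa$, has an unbounded Siegel disk $U$ (of arbitrary period). Then there is $j\in\mathbb{N}$ such that $\kappa\in\partial E_\kappa^j(U)$.
   Context: $E_\kappa^j$ denotes the $j$-th iterate of $E_\kappa$, and boundaries are taken in $\mathbb{C}$. The Fatou set of an entire function $f$ is the set of points having a neighborhood on which the iterates $(f^n)_{n\in\mathbb{N}}$ form a normal family (in the sense of maps to the Riemann sphere). A Siegel disk of $f$ (of period $p\ge 1$) is a connected component $U$ of the Fatou set such that $f^p(U)\subset U$, with $p\geq 1$ minimal, and such that the restriction $f^p|_U$ is conjugate, via a conformal isomorphism from $U$ onto the unit disk, to a rotation $z\mapsto e^{2\pi i\alpha}z$ with $\alpha$ irrational. "Unbounded" means unbounded as a subset of $\mathbb{C}$. *)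

theory Defs
  imports "HOL-Complex_Analysis.Complex_Analysis"
begin

text \<open>
  The Riemann sphere is modelled as the unit sphere of \<open>complex \<times> real\<close> (with its Euclidean norm).
  The complex plane sits in it by inverse stereographic projection; the point at infinity is
  \<open>(0, 1)\<close>, and the restricted distance is the chordal metric.
\<close>

definition riemann_sphere :: "(complex \<times> real) set" where
  "riemann_sphere = sphere 0 1"

definition to_sphere :: "complex \<Rightarrow> complex \<times> real" where
  "to_sphere z = ((2 / (1 + (norm z)\<^sup>2)) *\<^sub>R z, ((norm z)\<^sup>2 - 1) / ((norm z)\<^sup>2 + 1))"

lemma to_sphere_in_riemann_sphere: "to_sphere z \<in> riemann_sphere"
proof -
  define r where "r = (norm z)\<^sup>2"
  have "r \<ge> 0" by (simp add: r_def)
  have "(2 / (1 + r) * norm z)\<^sup>2 + ((r - 1) / (r + 1))\<^sup>2 = (4 * r + (r - 1)\<^sup>2) / (1 + r)\<^sup>2"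
    by (simp add: r_def power_mult_distrib power_divide add_divide_distrib add.commute)
  also have "4 * r + (r - 1)\<^sup>2 = (1 + r)\<^sup>2" by (simp add: power2_eq_square algebra_simps)
  finally have "(2 / (1 + r) * norm z)\<^sup>2 + ((r - 1) / (r + 1))\<^sup>2 = 1" using \<open>r \<ge> 0\<close> by simp
  then show ?thesis
    using \<open>r \<ge> 0\<close>
    by (simp add: riemann_sphere_def to_sphere_def norm_Pair power_divide flip: r_def)
qed

text \<open>
  Normality in the sense of maps to the Riemann sphere. The limit function takes values in the
  sphere, so that locally uniform divergence to infinity counts as convergence.
\<close>

definition normal_family_on :: "complex set \<Rightarrow> (complex \<Rightarrow> complex) set \<Rightarrow> bool" where
  "normal_family_on V F \<longleftrightarrow>
     (\<forall>g :: nat \<Rightarrow> complex \<Rightarrow> complex. range g \<subseteq> F \<longrightarrow>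
        (\<exists>r h. strict_mono (r :: nat \<Rightarrow> nat) \<and> h ` V \<subseteq> riemann_sphere \<and>
           (\<forall>K. compact K \<and> K \<subseteq> V \<longrightarrow>
              uniform_limit K (\<lambda>n z. to_sphere (g (r n) z)) h sequentially)))"

definition fatou_set :: "(complex \<Rightarrow> complex) \<Rightarrow> complex set" where
  "fatou_set f = {z. \<exists>V. open V \<and> z \<in> V \<and> normal_family_on V (range (\<lambda>n. f ^^ n))}"

definition conformal_isomorphism :: "(complex \<Rightarrow> complex) \<Rightarrow> complex set \<Rightarrow> complex set \<Rightarrow> bool" where
  "conformal_isomorphism \<phi> U V \<longleftrightarrow>
     bij_betw \<phi> U V \<and> \<phi> holomorphic_on U \<and> inv_into U \<phi> holomorphic_on V"

definition siegel_disk :: "(complex \<Rightarrow> complex) \<Rightarrow> nat \<Rightarrow> complex set \<Rightarrow> bool" where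
  "siegel_disk f p U \<longleftrightarrow>
     U \<in> components (fatou_set f) \<and>
     1 \<le> p \<and> (f ^^ p) ` U \<subseteq> U \<and>
     (\<forall>q. 1 \<le> q \<and> q < p \<longrightarrow> \<not> (f ^^ q) ` U \<subseteq> U) \<and>
     (\<exists>\<phi> (\<alpha> :: real). \<alpha> \<notin> \<rat> \<and> conformal_isomorphism \<phi> U (ball 0 1) \<and>
        (\<forall>z\<in>U. \<phi> ((f ^^ p) z) = exp (2 * of_real pi * \<i> * of_real \<alpha>) * \<phi> z))"

definition exp_map :: "complex \<Rightarrow> complex \<Rightarrow> complex" where
  "exp_map \<kappa> z = exp z + \<kappa>"

end

theory Submission
  imports Defs
begin

text \<open>
  Suppose that \<open>\<kappa>\<close> is not on the boundary of any forward image of the Siegel disk \<open>U\<close>. As \<open>\<kappa>\<close> is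
  omitted by \<open>E = exp_map \<kappa>\<close>, some disc \<open>D\<close> around \<open>\<kappa>\<close> is disjoint from all these images, and no
  point whose orbit meets \<open>D\<close> lies in the cycle of \<open>U\<close>.

  If \<open>D\<close> returns to itself, then an iterated preimage of a horizontal ray joins \<open>D\<close> to infinity with
  bounded imaginary part outside the cycle. One more preimage, together with the half plane
  \<open>E\<inverse>(D)\<close>, gives curves running from \<open>-\<infinity>\<close> to \<open>+\<infinity>\<close> that confine each image of \<open>U\<close> to a horizontal strip.
  In such strips the real part of a point far to the right grows under \<open>E\<close>, contradicting
  recurrence on \<open>U\<close>; so \<open>U\<close> is bounded.

  If \<open>D\<close> never returns, then \<open>\<kappa>\<close> lies in the Fatou set. Every point of \<open>\<partial>U\<close> is a limit of the orbit of
  \<open>\<kappa>\<close>, hence \<open>D\<close> wanders, and this is excluded by an infinitesimal form of Sullivan's argument which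
  avoids quasiconformal maps. For \<open>d \<in> D\<close> the measure with mass \<open>\<tau>\<^sup>2\<close> at each point \<open>x\<close> of the grand
  orbit of \<open>d\<close>, \<open>\<tau>\<close> being the derivative at \<open>d\<close> of the branch carrying \<open>d\<close> to \<open>x\<close>, is invariant under
  \<open>E\<close>. Its Cauchy transform \<open>v\<close> is therefore an invariant vector field, \<open>v \<circ> E = E' \<cdot> v\<close>, up to two
  linear conditions; a combination over three points \<open>d\<close> satisfies both. It vanishes at a point of \<open>U\<close>,
  hence along its orbit, hence on \<open>U\<close> and on the closure of all preimages of \<open>U\<close>. By the maximum
  principle it vanishes on the complementary component containing \<open>D\<close>, where it has poles.
\<close>

section \<open>A criterion for normality\<close>

text \<open>Sullivan's argument deforms the map over the wandering domain with more parameters than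
  the family has. Infinitesimally, each \<open>d\<close> gives one vector field, and its failure to
  be invariant is measured by two numbers, its values at \<open>f \<kappa>\<close> and
  \<open>f b\<close>, which enter because the Cauchy kernel is normalised at \<open>\<kappa>\<close>
  and \<open>b\<close>; so three points suffice. The obstacle is convergence. Branches carrying a
  disc about \<open>d\<close> along its grand orbit cover disjoint discs with radii comparable to
  the derivatives, so the squared derivatives are dominated by areas. That the branches exist, are
  injective and have disjoint images all rests on one fact: distinct points of the complementary
  component \<open>V\<close> never share a grand orbit. This is why injectivity of the iterates on
  \<open>V\<close> is proved first. Working on \<open>V\<close> instead of \<open>D\<close> is
  forced by the maximum principle: the boundary has to lie where the field vanishes, in the closure
  of the preimages of \<open>U\<close>. Poles may accumulate there, and continuity of the field
  again comes from the area bound.\<close>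

lemma holomorphic_on_funpow:
  assumes "f holomorphic_on UNIV"
  shows "(f ^^ n) holomorphic_on S"
proof -
  have "(f ^^ n) holomorphic_on UNIV"
  proof (induction n)
    case 0
    then show ?case by (simp add: id_def)
  next
    case (Suc n)
    then show ?case
      using holomorphic_on_compose[of "f ^^ n" UNIV f] assms holomorphic_on_subset by (auto simp: o_def)
  qed
  then show ?thesis using holomorphic_on_subset by blast
qed

lemma continuous_on_funpow:
  assumes "(f :: complex \<Rightarrow> complex) holomorphic_on UNIV"
  shows "continuous_on S (f ^^ n)"
  using holomorphic_on_funpow[OF assms] holomorphic_on_imp_continuous_on by blast

lemma to_sphere_add_inverse:
  assumes "u \<noteq> 0"
  shows "to_sphere (a + 1 / u) =
    ((2 / ((norm u)\<^sup>2 + (norm (a * u + 1))\<^sup>2)) *\<^sub>R (cnj u * (a * u + 1)),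
     ((norm (a * u + 1))\<^sup>2 - (norm u)\<^sup>2) / ((norm u)\<^sup>2 + (norm (a * u + 1))\<^sup>2))"
proof -
  define A where "A = a * u + 1"
  have z: "a + 1 / u = A / u" using assms by (simp add: A_def field_simps)
  have u0: "(norm u)\<^sup>2 > 0" using assms by simp
  have pos: "(norm u)\<^sup>2 + (norm A)\<^sup>2 > 0" using u0 by (simp add: add_pos_nonneg)
  have cn: "cnj u * u = of_real ((norm u)\<^sup>2)"
    by (metis complex_norm_square mult.commute)
  have "A / u = (1 / (norm u)\<^sup>2) *\<^sub>R (cnj u * A)"
    using assms cn by (simp add: scaleR_conv_of_real field_simps)
  then have 1: "(2 / (1 + (norm (A / u))\<^sup>2)) *\<^sub>R (A / u)
      = (2 / ((norm u)\<^sup>2 + (norm A)\<^sup>2)) *\<^sub>R (cnj u * A)"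
  proof -
    assume e: "A / u = (1 / (norm u)\<^sup>2) *\<^sub>R (cnj u * A)"
    have "(2 / (1 + (norm (A / u))\<^sup>2)) * (1 / (norm u)\<^sup>2) = 2 / ((norm u)\<^sup>2 + (norm A)\<^sup>2)"
      using u0 pos by (simp add: norm_divide power_divide field_simps)
    then show ?thesis
      by (subst (2) e) (simp only: scaleR_scaleR)
  qed
  have 2: "((norm (A / u))\<^sup>2 - 1) / ((norm (A / u))\<^sup>2 + 1)
      = ((norm A)\<^sup>2 - (norm u)\<^sup>2) / ((norm u)\<^sup>2 + (norm A)\<^sup>2)"
  proof -
    have e1: "(norm (A / u))\<^sup>2 = (norm A)\<^sup>2 / (norm u)\<^sup>2" by (simp add: norm_divide power_divide)
    have "(norm A)\<^sup>2 / (norm u)\<^sup>2 - 1 = ((norm A)\<^sup>2 - (norm u)\<^sup>2) / (norm u)\<^sup>2"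
         "(norm A)\<^sup>2 / (norm u)\<^sup>2 + 1 = ((norm u)\<^sup>2 + (norm A)\<^sup>2) / (norm u)\<^sup>2"
      using u0 by (simp_all add: field_simps)
    then show ?thesis unfolding e1 using u0 by simp
  qed
  show ?thesis unfolding to_sphere_def z using 1 2 by (simp add: A_def)
qed

text \<open>
  The coordinate \<open>u = 1 / (z - a)\<close> turns a family avoiding a ball around \<open>a\<close> into a bounded one; the
  right-hand side of \<open>to_sphere_add_inverse\<close> extends continuously to \<open>u = 0\<close>, that is to \<open>z = \<infinity>\<close>.
\<close>

lemma normal_family_on_if_avoids_ball:
  assumes f: "f holomorphic_on UNIV" and V: "open V" and r: "r > 0"
    and avoid: "\<And>n z. z \<in> V \<Longrightarrow> (f ^^ n) z \<notin> ball a r"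
  shows "normal_family_on V (range (\<lambda>n. f ^^ n))"
  unfolding normal_family_on_def
proof (intro allI impI)
  fix g :: "nat \<Rightarrow> complex \<Rightarrow> complex"
  assume g: "range g \<subseteq> range (\<lambda>n. f ^^ n)"
  define M where "M u = ((2 / ((norm u)\<^sup>2 + (norm (a * u + 1))\<^sup>2)) *\<^sub>R (cnj u * (a * u + 1)),
     ((norm (a * u + 1))\<^sup>2 - (norm u)\<^sup>2) / ((norm u)\<^sup>2 + (norm (a * u + 1))\<^sup>2))" for u
  have den: "(norm u)\<^sup>2 + (norm (a * u + 1))\<^sup>2 \<noteq> 0" for u :: complex
  proof (cases "u = 0")
    case False
    then have "(norm u)\<^sup>2 > 0" by simp
    then show ?thesis using zero_le_power2[of "norm (a * u + 1)"] by linarith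
  qed simp
  have contM: "continuous_on S M" for S
    unfolding M_def using den by (intro continuous_intros) auto
  have gn: "\<exists>m. g n = f ^^ m" for n using g by blast
  define H where "H = (\<lambda>n z. 1 / (g n z - a))"
  have dist: "r \<le> norm (g n z - a)" if "z \<in> V" for n z
    using avoid[OF that] gn[of n] by (fastforce simp: dist_norm norm_minus_commute not_less)
  have ne: "g n z - a \<noteq> 0" if "z \<in> V" for n z
    using dist[OF that, of n] r by auto
  have bd: "norm (H n z) \<le> 1 / r" if "z \<in> V" for n z
    using dist[OF that, of n] r by (simp add: H_def norm_divide frac_le)
  have holH: "H n holomorphic_on V" for n
  proof -
    have "g n holomorphic_on V" using gn[of n] holomorphic_on_funpow[OF f] by auto
    then show ?thesis unfolding H_def using ne by (intro holomorphic_intros) auto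
  qed
  obtain h \<rho> where h: "h holomorphic_on V" "strict_mono (\<rho> :: nat \<Rightarrow> nat)"
    "\<And>x. x \<in> V \<Longrightarrow> ((\<lambda>n. H (\<rho> n) x) \<longlongrightarrow> h x) sequentially"
    "\<And>K. \<lbrakk>compact K; K \<subseteq> V\<rbrakk> \<Longrightarrow> uniform_limit K (H \<circ> \<rho>) h sequentially"
  proof (rule Montel[OF V, of "range H" H])
    show "\<And>K. \<lbrakk>compact K; K \<subseteq> V\<rbrakk> \<Longrightarrow> \<exists>B. \<forall>h\<in>range H. \<forall>z\<in>K. norm (h z) \<le> B"
      using bd by blast
  qed (use holH in auto)
  have MH: "M (H n z) = to_sphere (g n z)" if "z \<in> V" for n z
  proof -
    have "H n z \<noteq> 0" using ne[OF that] by (simp add: H_def)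
    moreover have "a + 1 / H n z = g n z" using ne[OF that] by (simp add: H_def)
    ultimately show ?thesis using to_sphere_add_inverse[of "H n z" a] by (simp add: M_def)
  qed
  show "\<exists>r h. strict_mono (r :: nat \<Rightarrow> nat) \<and> h ` V \<subseteq> riemann_sphere \<and>
           (\<forall>K. compact K \<and> K \<subseteq> V \<longrightarrow>
              uniform_limit K (\<lambda>n z. to_sphere (g (r n) z)) h sequentially)"
  proof (rule exI[of _ \<rho>], rule exI[of _ "\<lambda>z. M (h z)"], intro conjI allI impI)
    show "strict_mono \<rho>" by (rule h(2))
    have bdh: "norm (h z) \<le> 1 / r" if "z \<in> V" for z
      by (rule Lim_norm_ubound[OF _ h(3)[OF that]]) (auto intro!: always_eventually bd[OF that])
    show "(\<lambda>z. M (h z)) ` V \<subseteq> riemann_sphere"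
    proof (rule image_subsetI)
      fix z assume z: "z \<in> V"
      have lim: "(\<lambda>n. M (H (\<rho> n) z)) \<longlonglongrightarrow> M (h z)"
        by (rule continuous_on_tendsto_compose[OF contM[of UNIV] h(3)[OF z]]) auto
      have mem: "\<forall>n. M (H (\<rho> n) z) \<in> riemann_sphere"
        using MH[OF z] to_sphere_in_riemann_sphere by simp
      have cl: "closed riemann_sphere" by (simp add: riemann_sphere_def)
      show "M (h z) \<in> riemann_sphere"
        by (rule Lim_in_closed_set[OF cl _ _ lim]) (use mem in auto)
    qed
    fix K assume K: "compact K \<and> K \<subseteq> V"
    have "uniform_limit K (\<lambda>n z. M ((H \<circ> \<rho>) n z)) (\<lambda>z. M (h z)) sequentially"
    proof (rule uniform_limit_compose_uniformly_continuous_on[where B = "cball 0 (1 / r)" and f = M and g = "H \<circ> \<rho>"])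
      show "uniform_limit K (H \<circ> \<rho>) h sequentially" using h(4) K by blast
      show "uniformly_continuous_on (cball 0 (1 / r)) M"
        by (rule compact_uniformly_continuous[OF contM]) simp
      show "\<forall>\<^sub>F n in sequentially. \<forall>y\<in>K. (H \<circ> \<rho>) n y \<in> cball 0 (1 / r)"
        using bd K by (auto simp: dist_norm intro!: always_eventually)
    qed simp
    moreover have "M ((H \<circ> \<rho>) n z) = to_sphere (g (\<rho> n) z)" if "z \<in> K" for n z
      using MH[of z "\<rho> n"] K that by auto
    ultimately show "uniform_limit K (\<lambda>n z. to_sphere (g (\<rho> n) z)) (\<lambda>z. M (h z)) sequentially"
      using uniform_limit_cong'[of K "\<lambda>n z. M ((H \<circ> \<rho>) n z)" "\<lambda>n z. to_sphere (g (\<rho> n) z)"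
          "\<lambda>z. M (h z)" "\<lambda>z. M (h z)" sequentially] by blast
  qed
qed

text \<open>The first \<open>n0\<close> iterates may enter the ball, so a smaller one is used: its
  centre \<open>b\<close> is chosen off the finitely many points \<open>(f ^^ n) w\<close> with
  \<open>n < n0\<close>, and the neighbourhood of \<open>w\<close> is shrunk until these iterates
  stay away from it.\<close>

lemma fatou_set_if_eventually_avoids_ball:
  assumes f: "f holomorphic_on UNIV" and V: "open V" "w \<in> V" and r: "r > 0"
    and avoid: "\<And>n z. n0 \<le> n \<Longrightarrow> z \<in> V \<Longrightarrow> (f ^^ n) z \<notin> ball a r"
  shows "w \<in> fatou_set f"
proof -
  have "infinite (ball a r)" using r uncountable_ball[of r a] by (simp add: uncountable_infinite)
  then obtain b where b: "b \<in> ball a r" "b \<notin> (\<lambda>n. (f ^^ n) w) ` {..<n0}"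
    using finite_subset[of "ball a r" "(\<lambda>n. (f ^^ n) w) ` {..<n0}"] by blast
  have "finite ((\<lambda>n. (f ^^ n) w) ` {..<n0})" by simp
  then have "\<exists>s>0. \<forall>n<n0. dist b ((f ^^ n) w) \<ge> s"
    using finite_set_avoid[of "(\<lambda>n. (f ^^ n) w) ` {..<n0}" b] b(2) by fastforce
  then obtain s where s: "s > 0" "\<And>n. n < n0 \<Longrightarrow> dist b ((f ^^ n) w) \<ge> s" by blast
  obtain t where t: "t > 0" "ball b t \<subseteq> ball a r"
    using open_ball[of a r] b(1) unfolding open_contains_ball by blast
  define u where "u = min (s / 2) t"
  define W where "W = V \<inter> (\<Inter>n\<in>{..<n0}. (f ^^ n) -` (- cball b u))"
  have "open W"
    unfolding W_def using V(1)
    by (intro open_Int open_INT ballI open_vimage) (auto intro!: continuous_on_funpow[OF f])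
  moreover have "w \<in> W"
    using V(2) s by (force simp: W_def u_def)
  moreover have "normal_family_on W (range (\<lambda>n. f ^^ n))"
  proof (rule normal_family_on_if_avoids_ball[OF f \<open>open W\<close>, of u])
    show "u > 0" using s t by (simp add: u_def)
    fix n z assume z: "z \<in> W"
    have sub: "ball b u \<subseteq> ball a r" using t by (auto simp: u_def)
    show "(f ^^ n) z \<notin> ball b u"
    proof (cases "n < n0")
      case True
      then show ?thesis using z by (force simp: W_def less_imp_le)
    next
      case False
      then show ?thesis using avoid[of n z] z sub by (auto simp: W_def)
    qed
  qed
  ultimately show ?thesis unfolding fatou_set_def by blast
qed

lemma open_fatou_set: "open (fatou_set f)"
  unfolding fatou_set_def by (subst open_subopen) blast

section \<open>Iterates of the exponential map\<close>

lemma holomorphic_exp_map: "exp_map \<kappa> holomorphic_on S"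
  unfolding exp_map_def by (intro holomorphic_intros)

lemmas holomorphic_exp_map_funpow = holomorphic_on_funpow[OF holomorphic_exp_map]

lemma continuous_on_exp_map_funpow: "continuous_on S (exp_map \<kappa> ^^ n)"
  using continuous_on_funpow[OF holomorphic_exp_map] .

lemma exp_map_neq: "exp_map \<kappa> z \<noteq> \<kappa>"
  by (simp add: exp_map_def)

lemma exp_map_funpow_neq: "n \<ge> 1 \<Longrightarrow> (exp_map \<kappa> ^^ n) z \<noteq> \<kappa>"
  by (cases n) (auto simp: exp_map_neq)

lemma exp_map_eq_iff: "exp_map \<kappa> x = exp_map \<kappa> y \<longleftrightarrow> exp x = exp y"
  by (simp add: exp_map_def)

lemma deriv_exp_map: "deriv (exp_map \<kappa>) z = exp z"
  unfolding exp_map_def by (auto intro!: DERIV_imp_deriv derivative_eq_intros)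

lemma exp_map_funpow_differentiable: "(exp_map \<kappa> ^^ n) field_differentiable at z"
  using holomorphic_exp_map_funpow[of _ _ UNIV] holomorphic_on_imp_differentiable_at[of _ UNIV] by blast

lemma deriv_exp_map_funpow_add:
  "deriv (exp_map \<kappa> ^^ (m + n)) z = deriv (exp_map \<kappa> ^^ m) ((exp_map \<kappa> ^^ n) z) * deriv (exp_map \<kappa> ^^ n) z"
  unfolding funpow_add by (intro deriv_chain exp_map_funpow_differentiable)

lemma deriv_exp_map_funpow_nonzero: "deriv (exp_map \<kappa> ^^ n) z \<noteq> 0"
proof (induction n)
  case 0
  have "deriv (exp_map \<kappa> ^^ 0) z = 1" by (simp add: id_def)
  then show ?case by simp
next
  case (Suc n)
  have "deriv (exp_map \<kappa> ^^ Suc n) z = exp ((exp_map \<kappa> ^^ n) z) * deriv (exp_map \<kappa> ^^ n) z"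
    using deriv_exp_map_funpow_add[of 1 n \<kappa> z] by (simp add: deriv_exp_map)
  then show ?case using Suc by (simp del: funpow.simps)
qed

lemma open_exp_map_funpow_image:
  assumes "open S"
  shows "open ((exp_map \<kappa> ^^ n) ` S)"
proof (rule open_mapping_thm2[of _ S])
  fix X assume X: "open X" "X \<subseteq> S" "X \<noteq> ({} :: complex set)"
  show "\<not> (exp_map \<kappa> ^^ n) constant_on X"
  proof
    assume "(exp_map \<kappa> ^^ n) constant_on X"
    then obtain c where c: "\<And>z. z \<in> X \<Longrightarrow> (exp_map \<kappa> ^^ n) z = c" by (auto simp: constant_on_def)
    obtain z where z: "z \<in> X" using X by blast
    have "\<forall>\<^sub>F x in nhds z. x \<in> X" using X z by (simp add: eventually_nhds_in_open)
    then have "\<forall>\<^sub>F x in nhds z. (exp_map \<kappa> ^^ n) x = c"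
      by eventually_elim (rule c)
    then have "deriv (exp_map \<kappa> ^^ n) z = deriv (\<lambda>_. c) z"
      by (rule deriv_cong_ev) simp
    then show False using deriv_exp_map_funpow_nonzero[where z = z] by simp
  qed
qed (use assms holomorphic_exp_map_funpow in auto)

text \<open>Two logarithms differ by a continuous function with values in the integer multiples of
  \<open>2 * pi * \<i>\<close>, hence by a constant.\<close>

lemma exp_eq_exp_on_connected:
  fixes a b :: "'a::topological_space \<Rightarrow> complex"
  assumes S: "connected S" and a: "continuous_on S a" and b: "continuous_on S b"
    and e: "\<And>z. z \<in> S \<Longrightarrow> exp (a z) = exp (b z)" and z0: "z0 \<in> S" "a z0 = b z0"
    and z: "z \<in> S"
  shows "a z = b z"
proof -
  define d where "d z = (a z - b z) / (2 * of_real pi * \<i>)" for z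
  have cd: "continuous_on S d" unfolding d_def by (intro continuous_intros a b) auto
  have "d constant_on S"
  proof (rule continuous_discrete_range_constant[OF S cd])
    fix x assume x: "x \<in> S"
    show "\<exists>e>0. \<forall>y. y \<in> S \<and> d y \<noteq> d x \<longrightarrow> e \<le> norm (d y - d x)"
    proof (intro exI[of _ 1] conjI allI impI)
      fix y assume y: "y \<in> S \<and> d y \<noteq> d x"
      have int: "d y \<in> \<int>" if yS: "y \<in> S" for y
      proof -
        obtain n where n: "a y = b y + of_int (2 * n) * of_real pi * \<i>"
          using e[OF yS] by (auto simp: exp_eq)
        have "d y = of_int n" unfolding d_def n by (simp add: field_simps)
        then show ?thesis by simp
      qed
      have "d y - d x \<in> \<int>" using int x y by auto
      then obtain k where k: "d y - d x = of_int k" by (auto elim: Ints_cases)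
      then have "k \<noteq> 0" using y by auto
      then show "1 \<le> norm (d y - d x)" unfolding k by simp
    qed simp
  qed
  then have "d z = d z0" using z z0(1) by (auto simp: constant_on_def)
  then show ?thesis using z0(2) by (simp add: d_def)
qed

text \<open>Uniqueness of lifts. The outermost exponential is peeled off first, so agreement after
  \<open>Suc m\<close> iterates becomes agreement after \<open>m\<close>.\<close>

lemma exp_map_funpow_section_unique:
  fixes a b :: "'a::topological_space \<Rightarrow> complex"
  assumes S: "connected S" and a: "continuous_on S a" and b: "continuous_on S b"
    and e: "\<And>z. z \<in> S \<Longrightarrow> (exp_map \<kappa> ^^ m) (a z) = (exp_map \<kappa> ^^ m) (b z)"
    and z0: "z0 \<in> S" "a z0 = b z0" and z: "z \<in> S"
  shows "a z = b z"
  using e z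
proof (induction m arbitrary: z)
  case 0
  then show ?case by simp
next
  case (Suc m)
  have c: "continuous_on S (\<lambda>z. (exp_map \<kappa> ^^ m) (g z))" if "continuous_on S g" for g
    using continuous_on_compose2[OF continuous_on_exp_map_funpow that] by auto
  have "(exp_map \<kappa> ^^ m) (a z) = (exp_map \<kappa> ^^ m) (b z)" if "z \<in> S" for z
  proof (rule exp_eq_exp_on_connected[OF S c[OF a] c[OF b]])
    fix y assume "y \<in> S"
    then show "exp ((exp_map \<kappa> ^^ m) (a y)) = exp ((exp_map \<kappa> ^^ m) (b y))"
      using Suc.prems(1)[of y] by (simp add: exp_map_eq_iff)
  qed (use z0 that in auto)
  then show ?case using Suc by blast
qed

lemma exp_map_lift:
  assumes B: "convex B" "open B" and h: "h holomorphic_on B" and ne: "\<And>z. z \<in> B \<Longrightarrow> h z \<noteq> \<kappa>"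
    and z0: "z0 \<in> B" "exp_map \<kappa> y = h z0"
  obtains g where "g holomorphic_on B" "\<And>z. z \<in> B \<Longrightarrow> exp_map \<kappa> (g z) = h z" "g z0 = y"
proof -
  have hh: "(\<lambda>z. h z - \<kappa>) holomorphic_on B" by (intro holomorphic_intros h)
  obtain g where g: "g holomorphic_on B" "\<And>z. z \<in> B \<Longrightarrow> exp (g z) = h z - \<kappa>"
    by (rule holomorphic_logarithm_exists[OF B hh _ z0(1)]) (use ne in auto)
  have "exp (g z0) = exp y" using g(2)[OF z0(1)] z0(2) by (metis add_diff_cancel exp_map_def)
  then have c: "exp (y - g z0) = 1" by (simp add: exp_diff)
  show ?thesis
  proof (rule that[of "\<lambda>z. g z + (y - g z0)"])
    fix z assume z: "z \<in> B"
    have "exp (g z + (y - g z0)) = exp (g z)"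
      using c by (simp only: exp_add mult_1_right)
    then show "exp_map \<kappa> (g z + (y - g z0)) = h z"
      using g(2)[OF z] by (simp add: exp_map_def)
  qed (use g in \<open>auto intro!: holomorphic_intros\<close>)
qed

text \<open>The first \<open>m\<close> points of the orbit of \<open>\<kappa>\<close> are the only
  obstructions: a lift through \<open>m\<close> factors can be lifted once more if it misses
  \<open>\<kappa>\<close>, which holds if \<open>h\<close> misses
  \<open>(exp_map \<kappa> ^^ m) \<kappa>\<close>.\<close>

lemma exp_map_funpow_lift:
  assumes B: "convex B" "open B" and h: "h holomorphic_on B"
    and ne: "\<And>z i. z \<in> B \<Longrightarrow> i < m \<Longrightarrow> h z \<noteq> (exp_map \<kappa> ^^ i) \<kappa>"
    and z0: "z0 \<in> B" "(exp_map \<kappa> ^^ m) y = h z0"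
  obtains g where "g holomorphic_on B" "\<And>z. z \<in> B \<Longrightarrow> (exp_map \<kappa> ^^ m) (g z) = h z" "g z0 = y"
proof -
  have "\<exists>g. g holomorphic_on B \<and> (\<forall>z\<in>B. (exp_map \<kappa> ^^ m) (g z) = h z) \<and> g z0 = y"
    using ne z0(2)
  proof (induction m arbitrary: y)
    case 0
    then show ?case using h by auto
  next
    case (Suc m)
    have "(exp_map \<kappa> ^^ m) (exp_map \<kappa> y) = h z0"
      using Suc.prems(2) by (simp add: funpow_swap1)
    then obtain g where g: "g holomorphic_on B" "\<forall>z\<in>B. (exp_map \<kappa> ^^ m) (g z) = h z"
      "g z0 = exp_map \<kappa> y"
      using Suc.IH[of "exp_map \<kappa> y"] Suc.prems(1) by (metis less_SucI)
    have "g z \<noteq> \<kappa>" if "z \<in> B" for z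
      using g(2) Suc.prems(1)[OF that, of m] that by auto
    then obtain k where k: "k holomorphic_on B" "\<And>z. z \<in> B \<Longrightarrow> exp_map \<kappa> (k z) = g z" "k z0 = y"
      using exp_map_lift[OF B g(1) _ z0(1)] g(3) by metis
    have "\<forall>z\<in>B. (exp_map \<kappa> ^^ Suc m) (k z) = h z"
      using k(2) g(2) by (simp add: funpow_swap1)
    then show ?case using k by blast
  qed
  then show ?thesis using that by blast
qed

section \<open>Curves separating a horizontal strip\<close>

text \<open>Consecutive zeros of the cosine are \<open>pi\<close> apart, and the connected image of
  \<open>\<mu>\<close> cannot pass over one.\<close>

lemma cos_pos_imp_oscillation_less_pi:
  fixes \<mu> :: "'a::topological_space \<Rightarrow> real"
  assumes S: "connected S" and c: "continuous_on S \<mu>" and pos: "\<And>x. x \<in> S \<Longrightarrow> 0 < cos (\<mu> x)"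
    and xy: "x \<in> S" "y \<in> S"
  shows "\<bar>\<mu> x - \<mu> y\<bar> < pi"
proof -
  have *: "\<mu> b - \<mu> a < pi" if ab: "a \<in> S" "b \<in> S" for a b
  proof (rule ccontr)
    assume "\<not> \<mu> b - \<mu> a < pi"
    then have len: "\<mu> a + pi \<le> \<mu> b" by simp
    \<comment> \<open>Selects the first zero \<open>pi / 2 + m * pi\<close> of the cosine at or
      above \<open>\<mu> a\<close>.\<close>
    define m where "m = \<lceil>(\<mu> a - pi / 2) / pi\<rceil>"
    define q where "q = pi / 2 + of_int m * pi"
    have "(\<mu> a - pi / 2) / pi \<le> of_int m" unfolding m_def by linarith
    then have 1: "\<mu> a \<le> q" by (simp add: q_def field_simps)
    have "of_int m \<le> (\<mu> a - pi / 2) / pi + 1" unfolding m_def by linarith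
    then have "of_int m * pi \<le> \<mu> a - pi / 2 + pi" by (simp add: field_simps)
    then have 2: "q \<le> \<mu> b" using len by (simp add: q_def)
    have "connected (\<mu> ` S)" by (rule connected_continuous_image[OF c S])
    then have "q \<in> \<mu> ` S" using connectedD_interval[of "\<mu> ` S" "\<mu> a" "\<mu> b" q] ab 1 2 by auto
    then obtain z where "z \<in> S" "\<mu> z = q" by auto
    moreover have "cos q = 0" unfolding q_def by (simp add: cos_add sin_times_pi_eq_0 mult.commute)
    ultimately show False using pos[of z] by simp
  qed
  show ?thesis using *[OF xy] *[OF xy(2) xy(1)] by linarith
qed

text \<open>
  Otherwise \<open>l t - g s\<close> has a continuous logarithm on a large rectangle, and its imaginary part
  would increase by one full turn along the boundary.
\<close>

lemma horizontal_curve_meets_path: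
  fixes l g :: "real \<Rightarrow> complex"
  assumes l: "continuous_on UNIV l" and C: "\<And>t. \<bar>Im (l t)\<bar> \<le> C"
    and top: "filterlim (\<lambda>t. Re (l t)) at_top at_top"
    and bot: "filterlim (\<lambda>t. Re (l t)) at_bot at_bot"
    and g: "path g" and g0: "Im (g 0) < - C" and g1: "C < Im (g 1)"
  shows "\<exists>t. \<exists>s\<in>{0..1}. l t = g s"
proof (rule ccontr)
  assume "\<not> ?thesis"
  then have ne: "l t \<noteq> g s" if "s \<in> {0..1}" for s t using that by blast
  have contg: "continuous_on {0..1} g" using g by (simp add: path_def)
  have "bounded (g ` {0..1})" by (intro compact_imp_bounded compact_continuous_image contg) auto
  then obtain M where M: "\<And>s. s \<in> {0..1} \<Longrightarrow> norm (g s) \<le> M"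
    unfolding bounded_iff by blast
  obtain T1 where T1: "\<And>t. t \<ge> T1 \<Longrightarrow> Re (l t) \<ge> M + 1"
    using top unfolding filterlim_at_top eventually_at_top_linorder by blast
  obtain T2 where T2: "\<And>t. t \<le> T2 \<Longrightarrow> Re (l t) \<le> - M - 1"
    using bot unfolding filterlim_at_bot eventually_at_bot_linorder by blast
  define T where "T = max 1 (max T1 (- T2))"
  have T': "T > 0" "T \<ge> T1" "- T \<le> T2" by (auto simp: T_def)
  then have T: "T > 0" "Re (l T) > M" "Re (l (-T)) < - M"
    using T1[of T] T2[of "-T"] by auto
  define S where "S = {-T..T} \<times> {0..1::real}"
  have "continuous_on S (\<lambda>x. l (fst x) - g (snd x))"
    unfolding S_def
    by (intro continuous_intros continuous_on_compose2[OF l] continuous_on_compose2[OF contg]) auto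
  moreover have "contractible S" unfolding S_def by (intro convex_imp_contractible convex_Times) auto
  ultimately obtain h where h: "continuous_on S h"
    "\<And>x. x \<in> S \<Longrightarrow> l (fst x) - g (snd x) = exp (h x)"
    using continuous_logarithm_on_contractible[of S "\<lambda>x. l (fst x) - g (snd x)"] ne
    by (metis (no_types, lifting) S_def mem_Sigma_iff prod.collapse right_minus_eq)
  have ex: "Re (l t) - Re (g s) = exp (Re (h (t, s))) * cos (Im (h (t, s)))"
       "Im (l t) - Im (g s) = exp (Re (h (t, s))) * sin (Im (h (t, s)))" if "(t, s) \<in> S" for t s
    using h(2)[OF that] by (metis Re_exp minus_complex.sel(1) fst_conv snd_conv,
      metis Im_exp minus_complex.sel(2) fst_conv snd_conv)
  have gM: "\<bar>Re (g s)\<bar> \<le> M" if "s \<in> {0..1}" for s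
    using M[OF that] abs_Re_le_cmod[of "g s"] by linarith
  have cR: "cos (Im (h (T, s))) > 0" if "s \<in> {0..1}" for s
  proof -
    have "exp (Re (h (T, s))) * cos (Im (h (T, s))) > 0"
      using ex(1)[of T s] T gM[OF that] that by (auto simp: S_def)
    then show ?thesis by (simp add: zero_less_mult_iff)
  qed
  have cL: "cos (Im (h (-T, s))) < 0" if "s \<in> {0..1}" for s
  proof -
    have "exp (Re (h (-T, s))) * cos (Im (h (-T, s))) < 0"
      using ex(1)[of "-T" s] T gM[OF that] that by (auto simp: S_def)
    then show ?thesis by (simp add: mult_less_0_iff)
  qed
  have sB: "sin (Im (h (t, 0))) > 0" if "t \<in> {-T..T}" for t
  proof -
    have "exp (Re (h (t, 0))) * sin (Im (h (t, 0))) > 0"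
      using ex(2)[of t 0] C[of t] g0 that by (auto simp: S_def)
    then show ?thesis by (simp add: zero_less_mult_iff)
  qed
  have sT: "sin (Im (h (t, 1))) < 0" if "t \<in> {-T..T}" for t
  proof -
    have "exp (Re (h (t, 1))) * sin (Im (h (t, 1))) < 0"
      using ex(2)[of t 1] C[of t] g1 that by (auto simp: S_def)
    then show ?thesis by (simp add: mult_less_0_iff)
  qed
  have ch: "continuous_on A (\<lambda>x. h (k x))" if "continuous_on A k" "k ` A \<subseteq> S"
    for A :: "real set" and k
    by (rule continuous_on_compose2[OF h(1) that])
  define a a' b b' where "a = Im (h (T, 0))" and "a' = Im (h (T, 1))"
    and "b = Im (h (-T, 0))" and "b' = Im (h (-T, 1))"
  have d1: "\<bar>a - a'\<bar> < pi" unfolding a_def a'_def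
    by (rule cos_pos_imp_oscillation_less_pi[of "{0..1}" "\<lambda>s. Im (h (T, s))"])
       (use cR T in \<open>auto intro!: ch continuous_intros simp: S_def\<close>)
  have d2: "\<bar>(b + pi) - (b' + pi)\<bar> < pi" unfolding b_def b'_def
    by (rule cos_pos_imp_oscillation_less_pi[of "{0..1}" "\<lambda>s. Im (h (-T, s)) + pi"])
       (use cL T in \<open>auto intro!: ch continuous_intros simp: S_def\<close>)
  \<comment> \<open>A shift by a quarter turn makes the sign condition on the sine one on the
    cosine.\<close>
  have d3: "\<bar>(a - pi / 2) - (b - pi / 2)\<bar> < pi" unfolding a_def b_def
    by (rule cos_pos_imp_oscillation_less_pi[of "{-T..T}" "\<lambda>t. Im (h (t, 0)) - pi / 2"])
       (use sB T in \<open>auto intro!: ch continuous_intros simp: S_def cos_diff\<close>)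
  have d4: "\<bar>(a' + pi / 2) - (b' + pi / 2)\<bar> < pi" unfolding a'_def b'_def
    by (rule cos_pos_imp_oscillation_less_pi[of "{-T..T}" "\<lambda>t. Im (h (t, 1)) + pi / 2"])
       (use sT T in \<open>auto intro!: ch continuous_intros simp: S_def cos_add\<close>)
  have s: "cos a > 0" "cos a' > 0" "cos b < 0" "cos b' < 0"
    "sin a > 0" "sin b > 0" "sin a' < 0" "sin b' < 0"
    using cR[of 0] cR[of 1] cL[of 0] cL[of 1] sB[of T] sB[of "-T"] sT[of T] sT[of "-T"] T
    by (auto simp: a_def b_def a'_def b'_def)
  \<comment> \<open>Each side turns by less than \<open>pi\<close>, so the sign of the sine of a
    difference is the sign of the difference; the corner signs then give
    \<open>a < b < b' < a' < a\<close>.\<close>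
  have pos: "x > 0" if "\<bar>x\<bar> < pi" "sin x > 0" for x :: real
  proof (rule ccontr)
    assume "\<not> x > 0"
    then have "sin (- x) \<ge> 0" using that(1) by (intro sin_ge_zero) auto
    then show False using that(2) by simp
  qed
  have "sin (b - a) > 0" unfolding sin_diff
    using s mult_pos_pos[of "sin b" "cos a"] mult_neg_pos[of "cos b" "sin a"] by linarith
  then have "b > a" using pos[of "b - a"] d3 by linarith
  moreover have "sin (b' - b) > 0" unfolding sin_diff
    using s mult_neg_neg[of "sin b'" "cos b"] mult_neg_pos[of "cos b'" "sin b"] by linarith
  then have "b' > b" using pos[of "b' - b"] d2 by linarith
  moreover have "sin (a' - b') > 0" unfolding sin_diff
    using s mult_neg_neg[of "sin a'" "cos b'"] mult_pos_neg[of "cos a'" "sin b'"] by linarith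
  then have "a' > b'" using pos[of "a' - b'"] d4 by linarith
  moreover have "sin (a - a') > 0" unfolding sin_diff
    using s mult_pos_pos[of "sin a" "cos a'"] mult_pos_neg[of "cos a" "sin a'"] by linarith
  then have "a > a'" using pos[of "a - a'"] d1 by linarith
  ultimately show False by linarith
qed

text \<open>Once \<open>Re (\<gamma> t)\<close> exceeds \<open>Re \<kappa>\<close>, the imaginary
  part of the lift has positive cosine and so varies by less than \<open>pi\<close>; the real part
  is \<open>ln (norm (\<gamma> t - \<kappa>))\<close>.\<close>

lemma exp_map_lift_curve:
  assumes c: "continuous_on {0..} \<gamma>" and ne: "\<And>t. t \<ge> 0 \<Longrightarrow> \<gamma> t \<noteq> \<kappa>"
    and top: "filterlim (\<lambda>t::real. Re (\<gamma> t)) at_top at_top" and y: "exp_map \<kappa> y = \<gamma> 0"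
  obtains \<eta> C where "continuous_on {0..} \<eta>" "\<And>t. t \<ge> 0 \<Longrightarrow> exp_map \<kappa> (\<eta> t) = \<gamma> t" "\<eta> 0 = y"
    "filterlim (\<lambda>t. Re (\<eta> t)) at_top at_top" "\<And>t. t \<ge> 0 \<Longrightarrow> \<bar>Im (\<eta> t)\<bar> \<le> C"
proof -
  have "continuous_on {0..} (\<lambda>t. \<gamma> t - \<kappa>)" by (intro continuous_intros c)
  then obtain g where g: "continuous_on {0..} g" "\<And>t. t \<in> {0..} \<Longrightarrow> \<gamma> t - \<kappa> = exp (g t)"
    by (rule continuous_logarithm_on_contractible)
       (use ne in \<open>auto intro!: convex_imp_contractible\<close>)
  define \<eta> where "\<eta> t = g t + (y - g 0)" for t
  have "exp (y - g 0) = 1"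
    using g(2)[of 0] y by (simp add: exp_diff exp_map_def) (metis add_diff_cancel divide_self exp_not_eq_zero)
  then have ee: "exp (\<eta> t) = \<gamma> t - \<kappa>" if "t \<ge> 0" for t
    using g(2)[of t] that by (simp add: \<eta>_def exp_add)
  have c\<eta>: "continuous_on A \<eta>" if "A \<subseteq> {0..}" for A
    unfolding \<eta>_def using continuous_on_subset[OF g(1) that] by (intro continuous_intros)
  obtain T0 where T0: "\<And>t. t \<ge> T0 \<Longrightarrow> Re (\<gamma> t) \<ge> Re \<kappa> + 1"
    using top unfolding filterlim_at_top eventually_at_top_linorder by blast
  define T where "T = max T0 0"
  have pc: "0 < cos (Im (\<eta> t))" if "t \<ge> T" for t
  proof -
    have "Re (exp (\<eta> t)) > 0" using ee[of t] T0[of t] that by (auto simp: T_def)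
    then show ?thesis by (simp add: Re_exp zero_less_mult_iff)
  qed
  have far: "\<bar>Im (\<eta> t) - Im (\<eta> T)\<bar> < pi" if "t \<ge> T" for t
    by (rule cos_pos_imp_oscillation_less_pi[of "{T..}" "\<lambda>t. Im (\<eta> t)"])
       (use that pc in \<open>auto intro!: continuous_intros c\<eta> simp: T_def\<close>)
  have "bounded (\<eta> ` {0..T})"
    by (intro compact_imp_bounded compact_continuous_image c\<eta>) auto
  then obtain M where M: "\<And>t. t \<in> {0..T} \<Longrightarrow> norm (\<eta> t) \<le> M" unfolding bounded_iff by blast
  show ?thesis
  proof (rule that[of \<eta> "M + pi"])
    show "continuous_on {0..} \<eta>" by (rule c\<eta>) simp
    show "exp_map \<kappa> (\<eta> t) = \<gamma> t" if "t \<ge> 0" for t using ee[OF that] by (simp add: exp_map_def)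
    show "\<eta> 0 = y" by (simp add: \<eta>_def)
    show "\<bar>Im (\<eta> t)\<bar> \<le> M + pi" if "t \<ge> 0" for t
    proof (cases "t \<le> T")
      case True
      then have "\<bar>Im (\<eta> t)\<bar> \<le> M" using M[of t] that abs_Im_le_cmod[of "\<eta> t"] by auto
      then show ?thesis using pi_gt_zero by linarith
    next
      case False
      have "0 \<le> T" by (simp add: T_def)
      then have "norm (\<eta> T) \<le> M" "\<bar>Im (\<eta> t) - Im (\<eta> T)\<bar> < pi" using M[of T] far[of t] False by auto
      then show ?thesis using abs_Im_le_cmod[of "\<eta> T"] by linarith
    qed
    have re: "Re (\<eta> t) = ln (norm (\<gamma> t - \<kappa>))" if "t \<ge> 0" for t
      using ee[OF that] by (metis ln_exp norm_exp_eq_Re)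
    have "filterlim (\<lambda>t. - Re \<kappa> + Re (\<gamma> t)) at_top at_top"
      by (intro filterlim_tendsto_add_at_top[OF tendsto_const] top)
    then have "filterlim (\<lambda>t. norm (\<gamma> t - \<kappa>)) at_top at_top"
    proof (rule filterlim_at_top_mono)
      show "\<forall>\<^sub>F t in at_top. - Re \<kappa> + Re (\<gamma> t) \<le> norm (\<gamma> t - \<kappa>)"
        using complex_Re_le_cmod[of "\<gamma> _ - \<kappa>"] by (intro always_eventually) auto
    qed
    then have "filterlim (\<lambda>t. ln (norm (\<gamma> t - \<kappa>))) at_top at_top"
      by (rule filterlim_compose[OF ln_at_top])
    then show "filterlim (\<lambda>t. Re (\<eta> t)) at_top at_top"
      by (rule filterlim_mono_eventually) (auto simp: re eventually_at_top_linorder intro!: exI[of _ 0])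
  qed
qed

text \<open>\<open>C0\<close> serves the case \<open>m = 0\<close>; every further lift obtains its
  own bound on the imaginary part from \<open>exp_map_lift_curve\<close>.\<close>

lemma exp_map_funpow_lift_curve:
  assumes c: "continuous_on {0..} \<gamma>" and ne: "\<And>t i. t \<ge> 0 \<Longrightarrow> i < m \<Longrightarrow> \<gamma> t \<noteq> (exp_map \<kappa> ^^ i) \<kappa>"
    and top: "filterlim (\<lambda>t::real. Re (\<gamma> t)) at_top at_top" and y: "(exp_map \<kappa> ^^ m) y = \<gamma> 0"
    and C0: "\<And>t. t \<ge> 0 \<Longrightarrow> \<bar>Im (\<gamma> t)\<bar> \<le> C0"
  shows "\<exists>\<eta> C. continuous_on {0..} \<eta> \<and> (\<forall>t\<ge>0. (exp_map \<kappa> ^^ m) (\<eta> t) = \<gamma> t) \<and> \<eta> 0 = y \<and>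
    filterlim (\<lambda>t. Re (\<eta> t)) at_top at_top \<and> (\<forall>t\<ge>0. \<bar>Im (\<eta> t)\<bar> \<le> C)"
  using ne y
proof (induction m arbitrary: y)
  case 0
  show ?case
    by (rule exI[of _ \<gamma>], rule exI[of _ C0]) (use 0 c top C0 in auto)
next
  case (Suc m)
  have "(exp_map \<kappa> ^^ m) (exp_map \<kappa> y) = \<gamma> 0" using Suc.prems(2) by (simp add: funpow_swap1)
  then obtain \<eta> C where \<eta>: "continuous_on {0..} \<eta>" "\<forall>t\<ge>0. (exp_map \<kappa> ^^ m) (\<eta> t) = \<gamma> t"
    "\<eta> 0 = exp_map \<kappa> y" "filterlim (\<lambda>t. Re (\<eta> t)) at_top at_top"
    using Suc.IH[of "exp_map \<kappa> y"] Suc.prems(1) by (metis less_SucI)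
  have "\<eta> t \<noteq> \<kappa>" if "t \<ge> 0" for t
    using \<eta>(2) Suc.prems(1)[OF that, of m] that by auto
  then obtain \<zeta> C' where \<zeta>: "continuous_on {0..} \<zeta>" "\<And>t. t \<ge> 0 \<Longrightarrow> exp_map \<kappa> (\<zeta> t) = \<eta> t" "\<zeta> 0 = y"
    "filterlim (\<lambda>t. Re (\<zeta> t)) at_top at_top" "\<And>t. t \<ge> 0 \<Longrightarrow> \<bar>Im (\<zeta> t)\<bar> \<le> C'"
    using exp_map_lift_curve[OF \<eta>(1) _ \<eta>(4)] \<eta>(3) by metis
  have "\<forall>t\<ge>0. (exp_map \<kappa> ^^ Suc m) (\<zeta> t) = \<gamma> t"
    using \<zeta>(2) \<eta>(2) by (simp add: funpow_swap1)
  then show ?case using \<zeta> by blast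
qed

section \<open>Siegel disks of the exponential map\<close>

text \<open>
  The condition relating \<open>ln \<delta>\<close> and \<open>Re \<kappa>\<close> says that the disc is disjoint from its preimage, the half
  plane \<open>Re z < ln \<delta>\<close>; so it cannot return at the first iterate.
\<close>

locale siegel_exp =
  fixes \<kappa> :: complex and U :: "complex set" and p :: nat and \<phi> :: "complex \<Rightarrow> complex"
    and \<alpha> \<delta> :: real
  assumes U_comp: "U \<in> components (fatou_set (exp_map \<kappa>))"
    and p_pos: "1 \<le> p" and fp_U: "(exp_map \<kappa> ^^ p) ` U \<subseteq> U"
    and irrational: "\<alpha> \<notin> \<rat>" and iso: "conformal_isomorphism \<phi> U (ball 0 1)"
    and conj: "\<And>z. z \<in> U \<Longrightarrow> \<phi> ((exp_map \<kappa> ^^ p) z) = exp (2 * of_real pi * \<i> * of_real \<alpha>) * \<phi> z"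
    and \<delta>_pos: "0 < \<delta>" and \<delta>_small: "ln \<delta> < Re \<kappa> - \<delta>"
    and U_avoids: "\<And>j. (exp_map \<kappa> ^^ j) ` U \<inter> ball \<kappa> \<delta> = {}"
begin

abbreviation f :: "complex \<Rightarrow> complex" where "f \<equiv> exp_map \<kappa>"
abbreviation D :: "complex set" where "D \<equiv> ball \<kappa> \<delta>"
abbreviation rot :: complex where "rot \<equiv> exp (2 * of_real pi * \<i> * of_real \<alpha>)"

section \<open>Rotation coordinate, recurrence, and the boundary of \<open>U\<close>\<close>

lemma f_eq: "f z = exp z + \<kappa>" by (simp add: exp_map_def)

lemma open_U: "open U"
  using open_components[OF open_fatou_set U_comp] .

lemma connected_U: "connected U"
  using in_components_connected[OF U_comp] .

lemma U_nonempty: "U \<noteq> {}"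
  using in_components_nonempty[OF U_comp] .

lemma U_avoids': "z \<in> U \<Longrightarrow> (f ^^ j) z \<notin> D"
  using U_avoids[of j] by blast

lemma norm_rot [simp]: "norm rot = 1"
  by (simp add: norm_exp_eq_Re)

lemma bij_\<phi>: "bij_betw \<phi> U (ball 0 1)"
  using iso by (simp add: conformal_isomorphism_def)

definition \<psi> where "\<psi> = inv_into U \<phi>"

lemma \<psi>_\<phi>: "z \<in> U \<Longrightarrow> \<psi> (\<phi> z) = z"
  using bij_\<phi> by (simp add: \<psi>_def bij_betw_def)

lemma \<phi>_\<psi>: "z \<in> ball 0 1 \<Longrightarrow> \<phi> (\<psi> z) = z"
  using bij_\<phi> by (simp add: \<psi>_def bij_betw_inv_into_right)

lemma \<psi>_in_U: "z \<in> ball 0 1 \<Longrightarrow> \<psi> z \<in> U"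
  using bij_\<phi> unfolding \<psi>_def by (metis bij_betw_imp_surj_on inv_into_into)

lemma \<phi>_in: "z \<in> U \<Longrightarrow> \<phi> z \<in> ball 0 1"
  using bij_\<phi> by (auto simp: bij_betw_def)

lemma holomorphic_\<psi>: "\<psi> holomorphic_on ball 0 1"
  using iso by (simp add: conformal_isomorphism_def \<psi>_def)

lemma continuous_on_\<psi>: "continuous_on (ball 0 1) \<psi>"
  using holomorphic_\<psi> holomorphic_on_imp_continuous_on by blast

lemma f_pn_in_U: "z \<in> U \<Longrightarrow> (f ^^ (p * n)) z \<in> U \<and> \<phi> ((f ^^ (p * n)) z) = rot ^ n * \<phi> z"
proof (induction n)
  case (Suc n)
  have "(f ^^ (p * Suc n)) z = (f ^^ p) ((f ^^ (p * n)) z)"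
    by (simp add: funpow_add)
  then show ?case using Suc fp_U conj[of "(f ^^ (p * n)) z"] by auto
qed simp

lemma norm_rot_power [simp]: "norm (rot ^ n * z) = norm z"
  by (simp add: norm_mult norm_power)

lemma f_pn_eq: "z \<in> U \<Longrightarrow> (f ^^ (p * n)) z = \<psi> (rot ^ n * \<phi> z)"
  using f_pn_in_U[of z n] \<psi>_\<phi>[of "(f ^^ (p * n)) z"] by simp

text \<open>Rotations are invertible, so \<open>f ^^ (p * n)\<close> maps \<open>U\<close> onto
  itself; the preimage inside \<open>U\<close> selects the inverse branches that are followed near
  the boundary.\<close>

lemma f_pn_inverse:
  assumes "z \<in> U"
  shows "\<psi> (\<phi> z / rot ^ n) \<in> U" "(f ^^ (p * n)) (\<psi> (\<phi> z / rot ^ n)) = z"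
proof -
  have b: "\<phi> z / rot ^ n \<in> ball 0 1"
    using \<phi>_in[OF assms] by (simp add: norm_divide norm_power)
  show in_U: "\<psi> (\<phi> z / rot ^ n) \<in> U" by (rule \<psi>_in_U[OF b])
  have "rot ^ n \<noteq> 0" by simp
  then show "(f ^^ (p * n)) (\<psi> (\<phi> z / rot ^ n)) = z"
    using f_pn_eq[OF in_U, of n] \<phi>_\<psi>[OF b] \<psi>_\<phi>[OF assms] by simp
qed

text \<open>Powers in a compact set come arbitrarily close together, and the quotient of two close
  powers on the unit circle is a power close to 1.\<close>

lemma rot_recurrent:
  assumes "\<epsilon> > 0"
  obtains n where "n \<ge> N" "norm (rot ^ n - 1) < \<epsilon>"
proof -
  have "\<forall>n. rot ^ n \<in> cball 0 1" by (simp add: norm_power)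
  then obtain l r where r: "strict_mono (r :: nat \<Rightarrow> nat)" "((\<lambda>n. rot ^ n) \<circ> r) \<longlonglongrightarrow> l"
    using compact_cball[of "0::complex" 1] unfolding compact_def by metis
  then have "Cauchy ((\<lambda>n. rot ^ n) \<circ> r)" using LIMSEQ_imp_Cauchy by blast
  then obtain M where M: "\<And>m n. m \<ge> M \<Longrightarrow> n \<ge> M \<Longrightarrow> norm (rot ^ r m - rot ^ r n) < \<epsilon>"
    using assms unfolding Cauchy_def dist_norm o_def by blast
  \<comment> \<open>\<open>r\<close> grows by at least one per step, so the exponent difference
    \<open>n\<close> is at least \<open>N\<close>.\<close>
  have gr: "r M + N \<le> r (M + N)"
    by (induction N) (use r(1) in \<open>auto simp: strict_mono_Suc_iff Suc_le_eq intro: order_le_less_trans\<close>)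
  define n where "n = r (M + N) - r M"
  have e: "rot ^ r (M + N) = rot ^ n * rot ^ r M"
    using gr by (simp add: n_def power_add[symmetric])
  have "rot ^ r (M + N) - rot ^ r M = (rot ^ n - 1) * rot ^ r M" unfolding e by (simp add: algebra_simps)
  then have "norm (rot ^ r (M + N) - rot ^ r M) = norm (rot ^ n - 1)"
    by (simp add: norm_mult norm_power)
  then have "norm (rot ^ n - 1) < \<epsilon>" using M[of "M + N" M] by simp
  then show ?thesis using that[of n] gr by (simp add: n_def)
qed

lemma rot_recurrent_seq:
  obtains r :: "nat \<Rightarrow> nat" where "\<And>k. k \<le> r k" "(\<lambda>k. rot ^ r k) \<longlonglongrightarrow> 1"
proof -
  have "\<exists>n. n \<ge> k \<and> norm (rot ^ n - 1) < inverse (real (Suc k))" for k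
    using rot_recurrent[of "inverse (real (Suc k))" k] by (metis of_nat_0_less_iff positive_imp_inverse_positive zero_less_Suc)
  then obtain r where r: "\<And>k. r k \<ge> k \<and> norm (rot ^ r k - 1) < inverse (real (Suc k))" by metis
  have "(\<lambda>k. rot ^ r k - 1) \<longlonglongrightarrow> 0"
    by (rule Lim_null_comparison[OF _ LIMSEQ_inverse_real_of_nat])
       (use r in \<open>auto intro!: always_eventually less_imp_le\<close>)
  then have "(\<lambda>k. rot ^ r k) \<longlonglongrightarrow> 1" by (simp add: LIM_zero_iff)
  then show ?thesis using that r by blast
qed

text \<open>Under \<open>f ^^ p\<close> the modulus of \<open>\<phi>\<close> is constant along the
  orbit, which therefore stays in a compact part of \<open>U\<close>; the other iterates lie in its
  first \<open>p\<close> images.\<close>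

lemma orbit_in_compact:
  assumes x: "x \<in> U"
  obtains K where "compact K" "K \<subseteq> (\<Union>j. (f ^^ j) ` U)" "\<And>n. (f ^^ n) x \<in> K"
proof -
  define C where "C = \<psi> ` cball 0 (norm (\<phi> x))"
  have sub: "cball 0 (norm (\<phi> x)) \<subseteq> ball 0 1" using \<phi>_in[OF x] by auto
  have C: "compact C" "C \<subseteq> U"
    unfolding C_def using \<psi>_in_U sub
    by (auto intro!: compact_continuous_image continuous_on_subset[OF continuous_on_\<psi>])
  show ?thesis
  proof (rule that[of "\<Union>j<p. (f ^^ j) ` C"])
    show "compact (\<Union>j<p. (f ^^ j) ` C)"
      by (intro compact_UN compact_continuous_image continuous_on_exp_map_funpow C) auto
    show "(\<Union>j<p. (f ^^ j) ` C) \<subseteq> (\<Union>j. (f ^^ j) ` U)" using C by blast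
    fix n
    have "(f ^^ n) x = (f ^^ (n mod p)) ((f ^^ (p * (n div p))) x)"
      by (metis comp_apply funpow_add mod_mult_div_eq)
    moreover have "(f ^^ (p * (n div p))) x \<in> C"
      unfolding f_pn_eq[OF x] C_def by (intro imageI) auto
    ultimately show "(f ^^ n) x \<in> (\<Union>j<p. (f ^^ j) ` C)" using p_pos by auto
  qed
qed

lemma orbit_recurrent:
  assumes x: "x \<in> U"
  obtains r :: "nat \<Rightarrow> nat" where "\<And>k. k \<le> r k" "(\<lambda>k. (f ^^ (p * r k)) x) \<longlonglongrightarrow> x"
proof -
  obtain r where r: "\<And>k. k \<le> r k" "(\<lambda>k. rot ^ r k) \<longlonglongrightarrow> 1" using rot_recurrent_seq by blast
  have "(\<lambda>k. rot ^ r k * \<phi> x) \<longlonglongrightarrow> 1 * \<phi> x" by (intro tendsto_intros r)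
  then have "(\<lambda>k. \<psi> (rot ^ r k * \<phi> x)) \<longlonglongrightarrow> \<psi> (\<phi> x)"
    using \<phi>_in[OF x] by (intro continuous_on_tendsto_compose[OF continuous_on_\<psi>]) (auto simp: norm_mult norm_power)
  then show ?thesis using that[OF r(1)] by (simp add: f_pn_eq[OF x] \<psi>_\<phi>[OF x])
qed

lemma frontier_U_not_fatou:
  assumes "w \<in> frontier U"
  shows "w \<notin> fatou_set f"
proof
  assume w: "w \<in> fatou_set f"
  have "closedin (top_of_set (fatou_set f)) U" using closedin_component[OF U_comp] .
  then obtain T where T: "closed T" "U = fatou_set f \<inter> T" by (auto simp: closedin_closed)
  then have "closure U \<subseteq> T" by (simp add: closure_minimal)
  then have "w \<in> U" using assms w T by (auto simp: frontier_def)
  then show False using assms open_U by (simp add: frontier_def interior_open)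
qed

text \<open>The limit stays in the compact set carrying the orbit of \<open>x\<close>, hence in the
  open cycle of \<open>U\<close>, which avoids \<open>D\<close>. Pulling back by
  \<open>f ^^ i\<close> gives a neighbourhood of \<open>w\<close> whose late iterates avoid
  \<open>D\<close>, so \<open>w\<close> would be a Fatou point.\<close>

lemma orbit_limit_not_boundary:
  assumes x: "x \<in> U" and w: "w \<in> frontier U"
    and lim: "(\<lambda>k. (f ^^ s k) x) \<longlonglongrightarrow> (f ^^ i) w"
  shows False
proof -
  obtain K where K: "compact K" "K \<subseteq> (\<Union>j. (f ^^ j) ` U)" "\<And>n. (f ^^ n) x \<in> K"
    using orbit_in_compact[OF x] by metis
  have "(f ^^ i) w \<in> K"
    by (rule closed_sequentially[OF compact_imp_closed[OF K(1)] _ lim]) (rule K(3))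
  then obtain j where j: "(f ^^ i) w \<in> (f ^^ j) ` U" using K(2) by blast
  define V where "V = (f ^^ i) -` ((f ^^ j) ` U)"
  have "w \<in> fatou_set f"
  proof (rule fatou_set_if_eventually_avoids_ball[OF holomorphic_exp_map _ _ \<delta>_pos, of V _ i])
    show "open V" unfolding V_def
      by (intro open_vimage open_exp_map_funpow_image open_U continuous_on_exp_map_funpow)
    show "w \<in> V" using j by (simp add: V_def)
    fix n z assume n: "i \<le> n" and z: "z \<in> V"
    then obtain u where u: "u \<in> U" "(f ^^ i) z = (f ^^ j) u" by (auto simp: V_def)
    have "(f ^^ n) z = (f ^^ (n - i)) ((f ^^ i) z)"
      using n by (metis comp_apply funpow_add le_add_diff_inverse2)
    also have "\<dots> = (f ^^ (n - i + j)) u" by (simp add: u funpow_add)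
    finally show "(f ^^ n) z \<notin> D" using U_avoids'[OF u(1)] by simp
  qed
  then show False using frontier_U_not_fatou[OF w] by blast
qed

section \<open>Horizontal strips when \<open>D\<close> returns to itself\<close>

text \<open>The target is the condition \<open>Re (f z) < ln \<delta>\<close>. At \<open>w\<close>,
  \<open>\<delta>_small\<close> turns it into \<open>Re (exp w) < 0\<close>, and moving right by
  \<open>t\<close> multiplies this negative number by \<open>exp t\<close>, so
  \<open>Re (f z)\<close> does not increase.\<close>

lemma horizontal_ray_in_f2_preimage:
  assumes w: "(f ^^ 2) w \<in> D" and t: "0 \<le> t"
  shows "(f ^^ 2) (w + of_real t) \<in> D"
proof -
  have in_D: "(f ^^ 2) z \<in> D \<longleftrightarrow> Re (f z) < ln \<delta>" for z
  proof -
    have "(f ^^ 2) z \<in> D \<longleftrightarrow> exp (Re (f z)) < \<delta>"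
      by (simp add: numeral_2_eq_2 f_eq dist_norm norm_exp_eq_Re del: exp_le_cancel_iff)
    also have "\<dots> \<longleftrightarrow> Re (f z) < ln \<delta>" using \<delta>_pos by (metis exp_less_cancel_iff exp_ln)
    finally show ?thesis .
  qed
  have "Re (exp (w + of_real t)) = exp t * Re (exp w)"
    by (simp add: exp_add Re_exp Im_exp exp_of_real)
  moreover have "Re (exp w) < 0"
    using w in_D[of w] \<delta>_small \<delta>_pos by (simp add: f_eq)
  moreover have "exp t \<ge> 1" using t by simp
  ultimately have "Re (exp (w + of_real t)) \<le> Re (exp w)"
    using mult_right_mono_neg[of 1 "exp t" "Re (exp w)"] by simp
  then show ?thesis using w unfolding in_D by (simp add: f_eq)
qed

text \<open>Across a larger gap, some translate of the curve by a multiple of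
  \<open>2 * pi * \<i>\<close> would meet a path from \<open>u\<close> to \<open>v\<close> inside
  the image of \<open>U\<close>. The translation is invisible after one step of \<open>f\<close>, so
  the meeting point would reach \<open>D\<close>.\<close>

lemma Im_bounded_if_curve:
  fixes l :: "real \<Rightarrow> complex"
  assumes l: "continuous_on UNIV l" and C: "\<And>t. \<bar>Im (l t)\<bar> \<le> C"
    and top: "filterlim (\<lambda>t. Re (l t)) at_top at_top"
    and bot: "filterlim (\<lambda>t. Re (l t)) at_bot at_bot"
    and hit: "\<And>t. \<exists>n\<ge>1. (f ^^ n) (l t) \<in> D"
    and uv: "u \<in> (f ^^ j) ` U" "v \<in> (f ^^ j) ` U"
  shows "Im v - Im u \<le> 2 * C + 4 * pi"
proof (rule ccontr)
  assume "\<not> ?thesis"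
  then have far: "Im u + C + 4 * pi < Im v - C" by simp
  \<comment> \<open>The strip of half width \<open>C\<close> about the height
    \<open>2 * pi * k\<close> lies strictly between \<open>Im u\<close> and
    \<open>Im v\<close>.\<close>
  define k where "k = \<lfloor>(Im u + C) / (2 * pi)\<rfloor> + 1"
  have "(Im u + C) / (2 * pi) < of_int k" "of_int k \<le> (Im u + C) / (2 * pi) + 1"
    unfolding k_def by linarith+
  then have k: "Im u + C < 2 * pi * of_int k" "2 * pi * of_int k \<le> Im u + C + 2 * pi"
    by (simp_all add: field_simps)
  have "open ((f ^^ j) ` U)" "connected ((f ^^ j) ` U)"
    by (auto intro!: open_exp_map_funpow_image open_U connected_continuous_image
        continuous_on_exp_map_funpow connected_U)
  then have "path_connected ((f ^^ j) ` U)" by (simp add: connected_open_path_connected)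
  then obtain g where g: "path g" "path_image g \<subseteq> (f ^^ j) ` U" "pathstart g = u" "pathfinish g = v"
    using uv unfolding path_connected_def by metis
  define c where "c = of_real (2 * pi * of_int k) * \<i>"
  have "path (\<lambda>s. g s - c)" using g(1) unfolding path_def by (intro continuous_intros)
  moreover have "g 0 = u" "g 1 = v" using g by (simp_all add: pathstart_def pathfinish_def)
  ultimately obtain t s where ts: "s \<in> {0..1}" "l t = g s - c"
    using horizontal_curve_meets_path[OF l C top bot, of "\<lambda>s. g s - c"] far k pi_gt_zero
    by (auto simp: c_def)
  obtain n where n: "n \<ge> 1" "(f ^^ n) (l t) \<in> D" using hit by blast
  obtain m where m: "n = Suc m" using n(1) by (cases n) auto
  have "f (g s) = f (l t)"
    unfolding exp_map_eq_iff ts(2) exp_eq c_def by (intro exI[of _ k]) (simp add: algebra_simps)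
  then have "(f ^^ n) (g s) \<in> D" using n(2) by (simp add: m funpow_Suc_right del: funpow.simps)
  moreover obtain x where "x \<in> U" "g s = (f ^^ j) x" using g(2) ts(1) unfolding path_image_def by blast
  ultimately show False using U_avoids'[of x "n + j"] by (simp add: funpow_add)
qed

lemma curve_if_D_returns:
  assumes z: "z \<in> D" "(f ^^ n) z \<in> D" and n: "n \<ge> 1"
  obtains l C where "continuous_on UNIV l" "\<And>t::real. \<bar>Im (l t)\<bar> \<le> C"
    "filterlim (\<lambda>t. Re (l t)) at_top at_top" "filterlim (\<lambda>t. Re (l t)) at_bot at_bot"
    "\<And>t. \<exists>n\<ge>1. (f ^^ n) (l t) \<in> D"
proof -
  have reD: "f z \<in> D \<longleftrightarrow> Re z < ln \<delta>" for z
  proof -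
    have "f z \<in> D \<longleftrightarrow> exp (Re z) < \<delta>" by (simp add: f_eq dist_norm norm_exp_eq_Re)
    also have "\<dots> \<longleftrightarrow> Re z < ln \<delta>" using \<delta>_pos by (metis exp_less_cancel_iff exp_ln)
    finally show ?thesis .
  qed
  have "n \<noteq> 1"
  proof
    assume "n = 1"
    then have "Re z < ln \<delta>" using z(2) reD by simp
    moreover have "\<bar>Re (\<kappa> - z)\<bar> < \<delta>"
      using z(1) abs_Re_le_cmod[of "\<kappa> - z"] by (auto simp: dist_norm)
    ultimately show False using \<delta>_small by simp
  qed
  define m where "m = n - 2"
  have n2: "n = 2 + m" using n \<open>n \<noteq> 1\<close> by (simp add: m_def)
  define Q where "Q = D \<inter> (f ^^ n) -` D"
  have "open Q" unfolding Q_def by (intro open_Int open_vimage continuous_on_exp_map_funpow) auto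
  then have "open ((f ^^ m) ` Q)" by (rule open_exp_map_funpow_image)
  moreover have "(f ^^ m) z \<in> (f ^^ m) ` Q" using z by (auto simp: Q_def)
  ultimately obtain e where e: "e > 0" "ball ((f ^^ m) z) e \<subseteq> (f ^^ m) ` Q"
    using open_contains_ball by blast
  \<comment> \<open>The open image leaves room to move the height of the ray off the finitely many
    heights of the points \<open>(f ^^ i) \<kappa>\<close>, so that the ray misses everything that
    obstructs the lift.\<close>
  define F where "F = (\<lambda>i. Im ((f ^^ i) \<kappa>)) ` {..m}"
  have "infinite ({Im ((f ^^ m) z)<..<Im ((f ^^ m) z) + e} - F)"
    using e(1) by (intro Diff_infinite_finite) (auto simp: F_def infinite_Ioo)
  then obtain y0 where y0: "Im ((f ^^ m) z) < y0" "y0 < Im ((f ^^ m) z) + e" "y0 \<notin> F"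
    by (metis Diff_iff finite.emptyI greaterThanLessThan_iff equals0I)
  define w where "w = Complex (Re ((f ^^ m) z)) y0"
  have "w \<in> ball ((f ^^ m) z) e"
    using y0 by (simp add: w_def dist_norm norm_complex_def)
  then obtain z1 where z1: "z1 \<in> Q" "(f ^^ m) z1 = w" using e(2) by blast
  have wD: "(f ^^ 2) w \<in> D" using z1 unfolding Q_def n2 funpow_add by auto
  have Imc: "w + of_real t \<noteq> (f ^^ i) \<kappa>" if "i < Suc m" for t i
  proof
    assume "w + of_real t = (f ^^ i) \<kappa>"
    then have "y0 = Im ((f ^^ i) \<kappa>)" by (simp add: w_def complex_eq_iff)
    then show False using y0(3) that by (auto simp: F_def)
  qed
  have "z1 \<noteq> \<kappa>" using Imc[of m 0] z1(2) by auto
  \<comment> \<open>The lift goes one step beyond \<open>m\<close>, so that it starts in the half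
    plane \<open>Re y < ln \<delta>\<close>, where a horizontal ray continues it to minus
    infinity.\<close>
  define y where "y = Ln (z1 - \<kappa>)"
  have fy: "f y = z1" using \<open>z1 \<noteq> \<kappa>\<close> by (simp add: f_eq y_def)
  have yD: "Re y < ln \<delta>" using reD[of y] fy z1(1) by (simp add: Q_def)
  have "filterlim (\<lambda>t. Re w + t) at_top at_top"
    by (intro filterlim_tendsto_add_at_top[OF tendsto_const] filterlim_ident)
  then have ex: "\<exists>\<eta> C. continuous_on {0..} \<eta> \<and> (\<forall>t\<ge>0. (f ^^ Suc m) (\<eta> t) = w + of_real t) \<and> \<eta> 0 = y \<and>
    filterlim (\<lambda>t. Re (\<eta> t)) at_top at_top \<and> (\<forall>t\<ge>0. \<bar>Im (\<eta> t)\<bar> \<le> C)"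
    by (intro exp_map_funpow_lift_curve[where ?C0.0 = "\<bar>Im w\<bar>"])
       (use Imc fy z1 in \<open>auto intro!: continuous_intros simp: funpow_Suc_right simp del: funpow.simps\<close>)
  then obtain \<eta> C where \<eta>: "continuous_on {0..} \<eta>" "\<forall>t\<ge>0. (f ^^ Suc m) (\<eta> t) = w + of_real t" "\<eta> 0 = y"
    "filterlim (\<lambda>t. Re (\<eta> t)) at_top at_top" "\<forall>t\<ge>0. \<bar>Im (\<eta> t)\<bar> \<le> C" by blast
  define l where "l t = (if t \<le> 0 then y + of_real t else \<eta> t)" for t
  show ?thesis
  proof (rule that[of l C])
    have "continuous_on ({..0} \<union> {0..}) l" unfolding l_def
      by (rule continuous_on_cases) (use \<eta> in \<open>auto intro!: continuous_intros\<close>)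
    moreover have "{..0} \<union> {0..} = (UNIV :: real set)" by auto
    ultimately show "continuous_on UNIV l" by simp
    show "\<bar>Im (l t)\<bar> \<le> C" for t
      using \<eta>(3) \<eta>(5)[rule_format, of "max t 0"] by (auto simp: l_def max_def split: if_splits)
    show "filterlim (\<lambda>t. Re (l t)) at_top at_top"
      by (rule filterlim_mono_eventually[OF \<eta>(4)])
         (auto simp: l_def eventually_at_top_linorder intro!: exI[of _ 1])
    have "filterlim (\<lambda>t. Re y + t) at_bot at_bot"
      unfolding filterlim_at_bot eventually_at_bot_linorder
      by (metis add.commute le_diff_eq)
    then show "filterlim (\<lambda>t. Re (l t)) at_bot at_bot"
      by (rule filterlim_mono_eventually)
         (auto simp: l_def eventually_at_bot_linorder intro!: exI[of _ 0])
    show "\<exists>n\<ge>1. (f ^^ n) (l t) \<in> D" for t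
    proof (cases "t \<le> 0")
      case True
      then have "f (l t) \<in> D" unfolding reD using yD by (simp add: l_def)
      then show ?thesis by (intro exI[of _ 1]) simp
    next
      case False
      then have "(f ^^ 2) ((f ^^ Suc m) (l t)) \<in> D"
        using horizontal_ray_in_f2_preimage[OF wD, of t] \<eta>(2) by (simp add: l_def del: funpow.simps)
      then have "(f ^^ (2 + Suc m)) (l t) \<in> D" by (simp only: funpow_add comp_apply)
      then show ?thesis by (intro exI[of _ "2 + Suc m"]) auto
    qed
  qed
qed

lemma bounded_U_if_D_returns:
  assumes z: "z \<in> D" "(f ^^ n) z \<in> D" and n: "n \<ge> 1"
  shows "bounded U"
proof (rule ccontr)
  assume unb: "\<not> bounded U"
  obtain l C where l: "continuous_on UNIV l" "\<And>t::real. \<bar>Im (l t)\<bar> \<le> C"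
    "filterlim (\<lambda>t. Re (l t)) at_top at_top" "filterlim (\<lambda>t. Re (l t)) at_bot at_bot"
    "\<And>t. \<exists>n\<ge>1. (f ^^ n) (l t) \<in> D"
    using curve_if_D_returns[OF z n] by blast
  obtain x0 where x0: "x0 \<in> U" using U_nonempty by blast
  \<comment> \<open>The gap bound for one image plus the height of one of its points; the sum covers
    all \<open>p\<close> images at once.\<close>
  define Y where "Y = 2 * C + 4 * pi + (\<Sum>j<p. \<bar>Im ((f ^^ j) x0)\<bar>)"
  have ImY: "\<bar>Im ((f ^^ j) x)\<bar> \<le> Y" if x: "x \<in> U" for x j
  proof -
    define i where "i = j mod p"
    have i: "i < p" using p_pos by (simp add: i_def)
    have "(f ^^ j) x = (f ^^ i) ((f ^^ (p * (j div p))) x)"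
      unfolding i_def by (metis comp_apply funpow_add mod_mult_div_eq)
    then have 1: "(f ^^ j) x \<in> (f ^^ i) ` U" using f_pn_in_U[OF x] by blast
    have 2: "(f ^^ i) x0 \<in> (f ^^ i) ` U" using x0 by blast
    have "\<bar>Im ((f ^^ i) x0)\<bar> \<le> (\<Sum>j<p. \<bar>Im ((f ^^ j) x0)\<bar>)"
      using i by (intro member_le_sum) auto
    then show ?thesis
      using Im_bounded_if_curve[OF l 1 2] Im_bounded_if_curve[OF l 2 1] unfolding Y_def by linarith
  qed
  have Reln: "Re ((f ^^ j) x) \<ge> ln \<delta>" if x: "x \<in> U" for x j
  proof -
    have "f ((f ^^ j) x) \<notin> D" using U_avoids'[OF x, of "Suc j"] by simp
    then have "exp (Re ((f ^^ j) x)) \<ge> \<delta>" by (simp add: f_eq dist_norm norm_exp_eq_Re)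
    then show ?thesis using \<delta>_pos by (metis exp_le_cancel_iff exp_ln)
  qed
  \<comment> \<open>\<open>t \<ge> R\<close> yields
    \<open>exp t \<ge> t + 1 + norm \<kappa> + Y\<close>, and \<open>R \<ge> - ln \<delta>\<close>
    excludes that the next real part is large and negative.\<close>
  define R where "R = max (max 2 (- ln \<delta>)) (norm \<kappa> + Y)"
  have step: "Re ((f ^^ Suc j) x) \<ge> Re ((f ^^ j) x) + 1" if x: "x \<in> U" and ge: "Re ((f ^^ j) x) \<ge> R" for x j
  proof -
    define t where "t = Re ((f ^^ j) x)"
    have t: "t \<ge> 2" "t \<ge> - ln \<delta>" "t \<ge> norm \<kappa> + Y" using ge by (auto simp: t_def R_def)
    have "1 + t + t\<^sup>2 / 2 \<le> exp t" using exp_lower_Taylor_quadratic[of t] t(1) by simp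
    moreover have "t\<^sup>2 / 2 \<ge> t" using t(1) by (simp add: power2_eq_square)
    ultimately have 1: "exp t \<ge> t + 1 + norm \<kappa> + Y" using t(3) by linarith
    have "exp t = norm (f ((f ^^ j) x) - \<kappa>)" by (simp add: f_eq norm_exp_eq_Re t_def)
    also have "\<dots> \<le> norm (f ((f ^^ j) x)) + norm \<kappa>" by (rule norm_triangle_ineq4)
    finally have 2: "exp t \<le> norm ((f ^^ Suc j) x) + norm \<kappa>" by simp
    have "norm ((f ^^ Suc j) x) \<le> \<bar>Re ((f ^^ Suc j) x)\<bar> + Y"
      using cmod_le[of "(f ^^ Suc j) x"] ImY[OF x, of "Suc j"] by linarith
    then have "\<bar>Re ((f ^^ Suc j) x)\<bar> \<ge> t + 1" using 1 2 by linarith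
    then show ?thesis using Reln[OF x, of "Suc j"] t(1,2) unfolding t_def by linarith
  qed
  \<comment> \<open>The excess over \<open>R\<close> rules out a negative \<open>Re x\<close>, since
    \<open>Re x \<ge> ln \<delta>\<close>.\<close>
  obtain x where x: "x \<in> U" "norm x > R + Y + \<bar>ln \<delta>\<bar> + Y"
    using unb unfolding bounded_iff by (metis linorder_not_less)
  have "\<bar>Re x\<bar> \<ge> R + \<bar>ln \<delta>\<bar> + Y"
    using cmod_le[of x] ImY[OF x(1), of 0] x(2) by simp
  then have Rx: "Re x \<ge> R"
    using Reln[OF x(1), of 0] ImY[OF x(1), of 0] by (simp add: R_def) linarith
  have grow: "Re ((f ^^ n) x) \<ge> Re x + real n" for n
  proof (induction n)
    case (Suc n)
    then show ?case using step[OF x(1), of n] Rx by (simp del: funpow.simps)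
  qed simp
  obtain r where r: "\<And>k. k \<le> r k" "(\<lambda>k. (f ^^ (p * r k)) x) \<longlonglongrightarrow> x"
    using orbit_recurrent[OF x(1)] by blast
  have "(\<lambda>k. Re ((f ^^ (p * r k)) x)) \<longlonglongrightarrow> Re x" by (intro tendsto_intros r)
  moreover have "\<forall>\<^sub>F k in sequentially. Re ((f ^^ (p * r k)) x) \<ge> Re x + 1"
    unfolding eventually_sequentially
  proof (intro exI[of _ 1] allI impI)
    fix k :: nat assume "1 \<le> k"
    then have "1 \<le> p * r k" using r(1)[of k] p_pos by (simp add: Suc_le_eq)
    then have "1 \<le> real (p * r k)" by linarith
    then show "Re ((f ^^ (p * r k)) x) \<ge> Re x + 1" using grow[of "p * r k"] by linarith
  qed
  ultimately have "Re x + 1 \<le> Re x" by (intro tendsto_lowerbound) auto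
  then show False by simp
qed

end

section \<open>A wandering neighbourhood of the singular value\<close>

lemma holomorphic_bounded_imp_lipschitz:
  assumes g: "g holomorphic_on ball a r" and r: "r > 0"
    and B: "\<And>z. z \<in> ball a r \<Longrightarrow> norm (g z) \<le> B" and z: "z \<in> ball a (r / 2)"
  shows "norm (g z - g a) \<le> 4 * B / r * norm (z - a)"
proof (rule field_differentiable_bound[of "ball a (r / 2)" g "deriv g"])
  fix z assume z: "z \<in> ball a (r / 2)"
  have sub: "cball z (r / 4) \<subseteq> ball a r"
  proof
    fix y assume "y \<in> cball z (r / 4)"
    then show "y \<in> ball a r" using z r dist_triangle[of a y z] by (auto simp: dist_norm)
  qed
  have "(g has_field_derivative deriv g z) (at z)"
    using holomorphic_derivI[OF g] sub r by (auto simp: subset_iff)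
  then show "(g has_field_derivative deriv g z) (at z within ball a (r / 2))"
    using has_field_derivative_at_within by blast
  have "norm ((deriv ^^ 1) g z) \<le> fact 1 * B / (r / 4) ^ 1"
  proof (rule Cauchy_inequality)
    show "g holomorphic_on ball z (r / 4)" using g sub by (meson ball_subset_cball holomorphic_on_subset order_trans)
    show "continuous_on (cball z (r / 4)) g"
      using holomorphic_on_imp_continuous_on[OF g] continuous_on_subset sub by blast
    show "norm (g x) \<le> B" if "norm (z - x) = r / 4" for x
      by (rule B) (use sub that in \<open>auto simp: dist_norm subset_iff\<close>)
  qed (use r in auto)
  then show "norm (deriv g z) \<le> 4 * B / r" by (simp add: mult.commute)
qed (use r z in auto)

text \<open>The plane minus a countable set is connected, so a countable frontier could not separate
  \<open>S\<close> from its exterior.\<close>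

lemma uncountable_frontier:
  fixes S :: "complex set"
  assumes "open S" "S \<noteq> {}" "closure S \<noteq> UNIV"
  shows "uncountable (frontier S)"
proof
  assume "countable (frontier S)"
  then have "connected (UNIV - frontier S)"
    by (intro connected_open_diff_countable) auto
  moreover have "(UNIV - frontier S) \<inter> S \<noteq> {}"
    using assms(1,2) by (auto simp: frontier_def interior_open)
  moreover have "(UNIV - frontier S) - S \<noteq> {}"
    using assms(3) closure_subset[of S] by (auto simp: frontier_def)
  ultimately show False using connected_Int_frontier by blast
qed

text \<open>With \<open>s = norm (A - A0)\<close> the difference has norm at least
  \<open>s / (M * (M + s))\<close>, and this is increasing in \<open>s\<close>.\<close>

lemma inverse_diff_lower_bound:
  fixes A A0 :: complex
  assumes "A \<noteq> 0" "A0 \<noteq> 0" "norm A \<le> M" "0 < t" "t \<le> norm (A - A0)"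
  shows "t / (M * (M + t)) \<le> norm (1 / A - 1 / A0)"
proof -
  define s where "s = norm (A - A0)"
  have M: "M > 0" using assms(1,3) by (meson less_le_trans zero_less_norm_iff)
  have A0: "norm A0 \<le> M + s"
    using norm_triangle_sub[of A0 A] assms(3) by (simp add: s_def norm_minus_commute)
  have "t * (M + s) \<le> s * (M + t)" using assms(5) M by (simp add: s_def algebra_simps)
  then have "t / (M * (M + t)) \<le> s / (M * (M + s))"
    using M assms(4,5) by (simp add: s_def divide_simps mult_pos_pos add_pos_pos)
  also have "\<dots> \<le> s / (norm A * norm A0)"
    using assms M A0 by (intro divide_left_mono mult_mono) (auto simp: s_def)
  also have "\<dots> = norm (1 / A - 1 / A0)"
    using assms(1,2) by (simp add: s_def diff_frac_eq norm_divide norm_mult norm_minus_commute)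
  finally show ?thesis .
qed

text \<open>Hurwitz's theorem for the tail \<open>h (n + N)\<close>: a tail omitting the value
  \<open>g z0\<close> would force the limit to omit it too.\<close>

lemma Hurwitz_attains:
  assumes S: "open S" "connected S" and hol: "\<And>n::nat. h n holomorphic_on S" and g: "g holomorphic_on S"
    and ul: "\<And>K. \<lbrakk>compact K; K \<subseteq> S\<rbrakk> \<Longrightarrow> uniform_limit K h g sequentially"
    and nc: "\<not> g constant_on S" and z0: "z0 \<in> S"
  obtains n z where "n \<ge> N" "z \<in> S" "h n z = g z0"
proof -
  have "\<exists>n z. z \<in> S \<and> h (n + N) z = g z0"
  proof (rule ccontr)
    assume *: "\<not> ?thesis"
    have "g z0 - g z0 \<noteq> 0"
    proof (rule Hurwitz_no_zeros[OF S, of "\<lambda>n z. h (n + N) z - g z0" "\<lambda>z. g z - g z0"])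
      show "(\<lambda>z. h (n + N) z - g z0) holomorphic_on S" for n by (intro holomorphic_intros hol)
      show "(\<lambda>z. g z - g z0) holomorphic_on S" by (intro holomorphic_intros g)
      show "uniform_limit K (\<lambda>n z. h (n + N) z - g z0) (\<lambda>z. g z - g z0) sequentially"
        if K: "compact K" "K \<subseteq> S" for K
      proof -
        have "uniform_limit K (\<lambda>n. h (n + N)) g sequentially"
          using ul[OF K] unfolding uniform_limit_iff eventually_sequentially
          by (metis le_add1 le_trans)
        then show ?thesis by (intro uniform_limit_intros)
      qed
      show "\<not> (\<lambda>z. g z - g z0) constant_on S"
        using nc unfolding constant_on_def by (metis diff_add_cancel)
      show "h (n + N) z - g z0 \<noteq> 0" if "z \<in> S" for n z using * that by auto
    qed (rule z0)
    then show False by simp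
  qed
  then show ?thesis using that by (metis le_add2)
qed

locale wandering_exp = siegel_exp +
  assumes wander: "\<And>n z. 1 \<le> n \<Longrightarrow> z \<in> D \<Longrightarrow> (f ^^ n) z \<notin> D"
begin

section \<open>The boundary of \<open>U\<close> consists of limit points of the orbit of
  \<open>\<kappa>\<close>\<close>

lemma f_in_fatou_if_avoids:
  assumes V: "open V" and z: "z \<in> V" and r: "r > 0"
    and avoid: "\<And>n z. n0 \<le> n \<Longrightarrow> z \<in> V \<Longrightarrow> (f ^^ n) z \<notin> ball a r"
  shows "(f ^^ m) z \<in> fatou_set f"
proof (rule fatou_set_if_eventually_avoids_ball[OF holomorphic_exp_map _ _ r, of "(f ^^ m) ` V" _ n0])
  show "open ((f ^^ m) ` V)" by (rule open_exp_map_funpow_image[OF V])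
  show "(f ^^ m) z \<in> (f ^^ m) ` V" using z by blast
  fix n y assume "n0 \<le> n" "y \<in> (f ^^ m) ` V"
  then obtain x where x: "x \<in> V" "y = (f ^^ m) x" by blast
  have "(f ^^ n) y = (f ^^ (n + m)) x" by (simp add: x funpow_add)
  then show "(f ^^ n) y \<notin> ball a r" using avoid[of "n + m" x] x \<open>n0 \<le> n\<close> by simp
qed

lemma D_orbit_fatou: "z \<in> D \<Longrightarrow> (f ^^ m) z \<in> fatou_set f"
  by (rule f_in_fatou_if_avoids[of D _ \<delta> 1 \<kappa>]) (use wander \<delta>_pos in auto)

lemma \<kappa>_in_D: "\<kappa> \<in> D" using \<delta>_pos by simp

lemma closure_U_avoids_D: "w \<in> closure U \<Longrightarrow> w \<notin> D"
  using U_avoids[of 0] open_Int_closure_eq_empty[of D U] by auto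

text \<open>As \<open>D\<close> wanders, the functions \<open>1 / ((f ^^ n) z - \<kappa>)\<close>
  with \<open>n \<ge> 1\<close> are bounded by \<open>1 / \<delta>\<close> on \<open>D\<close>,
  hence Lipschitz near \<open>\<kappa>\<close> uniformly in \<open>n\<close>. If
  \<open>(f ^^ n) z\<close> were near \<open>w\<close> while \<open>(f ^^ n) \<kappa>\<close> is
  not, they would vary too much.\<close>

lemma frontier_avoids_near_orbit:
  assumes w: "w \<in> frontier U" and e: "e > 0" and far: "\<And>n. dist ((f ^^ n) \<kappa>) w \<ge> e"
  obtains d where "0 < d" "d \<le> \<delta>" "d \<le> e"
    "\<And>n z. z \<in> ball \<kappa> d \<Longrightarrow> (f ^^ n) z \<notin> ball w d"
proof -
  define M where "M = norm (w - \<kappa>) + e"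
  define t where "t = e / 2"
  have M: "M > 0" unfolding M_def using e by (simp add: add_nonneg_pos)
  have t: "t > 0" using e by (simp add: t_def)
  \<comment> \<open>A lower bound for the change of the inverted iterate when
    \<open>(f ^^ n) z\<close> is near \<open>w\<close>; the last term in \<open>d\<close> makes the
    Lipschitz bound \<open>q / 2\<close>.\<close>
  define q where "q = t / (M * (M + t))"
  have q: "q > 0" unfolding q_def using M t by simp
  define d where "d = min (min (\<delta> / 2) (e / 2)) (q * \<delta>\<^sup>2 / 8)"
  have d: "d > 0" "d \<le> \<delta> / 2" "d \<le> e / 2" "d \<le> q * \<delta>\<^sup>2 / 8"
    using \<delta>_pos e q by (auto simp: d_def)
  show ?thesis
  proof (rule that[of d])
    fix n z assume z: "z \<in> ball \<kappa> d"
    show "(f ^^ n) z \<notin> ball w d"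
    proof
      assume zw: "(f ^^ n) z \<in> ball w d"
      have "\<delta> \<le> dist \<kappa> w" using closure_U_avoids_D[of w] w by (auto simp: frontier_def)
      moreover have "dist \<kappa> w \<le> dist \<kappa> z + dist z w" by (rule dist_triangle)
      moreover have "dist \<kappa> z < d" "dist w ((f ^^ n) z) < d" using z zw by auto
      ultimately have "n \<noteq> 0" using d by (cases "n = 0") (auto simp: dist_commute)
      then have n: "n \<ge> 1" by simp
      define g where "g z = 1 / ((f ^^ n) z - \<kappa>)" for z
      have ge: "\<delta> \<le> norm ((f ^^ n) y - \<kappa>)" if "y \<in> D" for y
        using wander[OF n that] by (auto simp: dist_norm norm_minus_commute not_less)
      have hol: "g holomorphic_on D" unfolding g_def
        by (intro holomorphic_intros holomorphic_exp_map_funpow) (use ge \<delta>_pos in force)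
      have bd: "norm (g y) \<le> 1 / \<delta>" if "y \<in> D" for y
        using ge[OF that] \<delta>_pos by (simp add: g_def norm_divide frac_le)
      have "norm (g z - g \<kappa>) \<le> 4 * (1 / \<delta>) / \<delta> * norm (z - \<kappa>)"
        by (rule holomorphic_bounded_imp_lipschitz[OF hol \<delta>_pos bd]) (use z d in auto)
      also have "\<dots> < 4 * (1 / \<delta>) / \<delta> * d"
        using z \<delta>_pos by (intro mult_strict_left_mono) (auto simp: dist_norm norm_minus_commute)
      also have "\<dots> \<le> 4 * (1 / \<delta>) / \<delta> * (q * \<delta>\<^sup>2 / 8)"
        using d \<delta>_pos by (intro mult_left_mono) auto
      also have "\<dots> = q / 2" using \<delta>_pos by (simp add: power2_eq_square field_simps)
      also have "\<dots> < q" using q by simp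
      finally have lt: "norm (g z - g \<kappa>) < q" .
      have "q \<le> norm (g z - g \<kappa>)"
        unfolding q_def g_def
      proof (rule inverse_diff_lower_bound)
        show "(f ^^ n) z - \<kappa> \<noteq> 0" "(f ^^ n) \<kappa> - \<kappa> \<noteq> 0"
          using exp_map_funpow_neq[OF n] by auto
        have "norm ((f ^^ n) z - \<kappa>) \<le> norm ((f ^^ n) z - w) + norm (w - \<kappa>)"
          using norm_triangle_ineq[of "(f ^^ n) z - w" "w - \<kappa>"] by simp
        then show "norm ((f ^^ n) z - \<kappa>) \<le> M"
          using zw d e by (simp add: M_def dist_norm norm_minus_commute)
        have "e \<le> dist ((f ^^ n) \<kappa>) ((f ^^ n) z) + dist ((f ^^ n) z) w"
          using far[of n] dist_triangle[of "(f ^^ n) \<kappa>" w "(f ^^ n) z"] by linarith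
        then show "t \<le> norm ((f ^^ n) z - \<kappa> - ((f ^^ n) \<kappa> - \<kappa>))"
          using zw d by (simp add: t_def dist_norm norm_minus_commute)
      qed (rule t)
      then show False using lt by simp
    qed
  qed (use d \<delta>_pos e in auto)
qed

text \<open>
  Near \<open>w\<close> the inverse branches of \<open>f ^^ (p * r k)\<close> that preserve \<open>U\<close> exist and form a normal family; along
  times at which the rotation tends to the identity they tend to the identity.
\<close>

lemma frontier_fatou_if_orbit_avoids:
  assumes w: "w \<in> frontier U" and e: "e > 0" and far: "\<And>n. dist ((f ^^ n) \<kappa>) w \<ge> e"
  shows "w \<in> fatou_set f"
proof -
  obtain d where d: "0 < d" "d \<le> \<delta>" "d \<le> e"
    and apart: "\<And>n z. z \<in> ball \<kappa> d \<Longrightarrow> (f ^^ n) z \<notin> ball w d"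
    using frontier_avoids_near_orbit[OF assms] by metis
  define B where "B = ball w d"
  have "w \<in> closure U" using w by (simp add: frontier_def)
  then obtain u0 where u0: "u0 \<in> U" "u0 \<in> B"
    unfolding B_def closure_approachable using d(1) by (metis dist_commute mem_ball)
  obtain r where r: "\<And>k. k \<le> r k" "(\<lambda>k. rot ^ r k) \<longlonglongrightarrow> 1" using rot_recurrent_seq by blast
  have cB: "(f ^^ i) \<kappa> \<notin> B" for i
    using far[of i] d by (auto simp: B_def dist_commute)
  have "\<exists>c. c holomorphic_on B \<and> (\<forall>z\<in>B. (f ^^ (p * r k)) (c z) = z) \<and> c u0 = \<psi> (\<phi> u0 / rot ^ r k)" for k
  proof -
    have "(f ^^ (p * r k)) (\<psi> (\<phi> u0 / rot ^ r k)) = u0" by (rule f_pn_inverse(2)[OF u0(1)])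
    then obtain c where "c holomorphic_on B" "\<And>z. z \<in> B \<Longrightarrow> (f ^^ (p * r k)) (c z) = z"
        "c u0 = \<psi> (\<phi> u0 / rot ^ r k)"
      using exp_map_funpow_lift[of B "\<lambda>z. z" "p * r k" \<kappa> u0] cB u0(2)
      by (metis B_def convex_ball open_ball holomorphic_on_ident)
    then show ?thesis by blast
  qed
  then obtain c where c: "\<And>k. c k holomorphic_on B" "\<And>k z. z \<in> B \<Longrightarrow> (f ^^ (p * r k)) (c k z) = z"
    "\<And>k. c k u0 = \<psi> (\<phi> u0 / rot ^ r k)" by metis
  have cav: "d \<le> norm (c k z - \<kappa>)" if "z \<in> B" for k z
  proof -
    have "c k z \<notin> ball \<kappa> d" using apart[of "c k z" "p * r k"] c(2)[OF that] that by (auto simp: B_def)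
    then show ?thesis by (simp add: dist_norm norm_minus_commute)
  qed
  \<comment> \<open>The branches avoid a ball around \<open>\<kappa>\<close>, so inversion at
    \<open>\<kappa>\<close> makes them a bounded family.\<close>
  define h where "h k z = 1 / (c k z - \<kappa>)" for k z
  have holh: "h k holomorphic_on B" for k unfolding h_def
    by (intro holomorphic_intros c(1)) (metis cav d(1) norm_zero not_less)
  have bdh: "norm (h k z) \<le> 1 / d" if "z \<in> B" for k z
    using cav[OF that, of k] d(1) by (simp add: h_def norm_divide frac_le)
  have oB: "open B" "connected B" by (simp_all add: B_def)
  obtain g \<rho> where g: "g holomorphic_on B" "strict_mono (\<rho> :: nat \<Rightarrow> nat)"
    "\<And>x. x \<in> B \<Longrightarrow> ((\<lambda>n. h (\<rho> n) x) \<longlongrightarrow> g x) sequentially"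
    "\<And>K. \<lbrakk>compact K; K \<subseteq> B\<rbrakk> \<Longrightarrow> uniform_limit K (h \<circ> \<rho>) g sequentially"
  proof (rule Montel[OF oB(1), of "range h" h])
    show "\<And>K. \<lbrakk>compact K; K \<subseteq> B\<rbrakk> \<Longrightarrow> \<exists>C. \<forall>h\<in>range h. \<forall>z\<in>K. norm (h z) \<le> C"
      using bdh by blast
  qed (use holh in auto)
  have "open (U \<inter> B)" "u0 \<in> U \<inter> B" using open_U oB u0 by auto
  then obtain s where s: "s > 0" "ball u0 s \<subseteq> U \<inter> B" by (meson open_contains_ball)
  have cont\<phi>: "continuous_on U \<phi>"
    using iso holomorphic_on_imp_continuous_on by (auto simp: conformal_isomorphism_def)
  \<comment> \<open>On a disc inside \<open>U\<close> the branch is the inverse of the rotation by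
    uniqueness of lifts; this identifies the limit.\<close>
  have ceq: "c k z = \<psi> (\<phi> z / rot ^ r k)" if z: "z \<in> ball u0 s" for k z
  proof (rule exp_map_funpow_section_unique[of "ball u0 s" "c k" "\<lambda>z. \<psi> (\<phi> z / rot ^ r k)" "p * r k" \<kappa> u0])
    show "continuous_on (ball u0 s) (c k)"
      using holomorphic_on_imp_continuous_on[OF c(1)] continuous_on_subset s by blast
    show "continuous_on (ball u0 s) (\<lambda>z. \<psi> (\<phi> z / rot ^ r k))"
      by (rule continuous_on_compose2[OF continuous_on_\<psi>])
         (use s \<phi>_in in \<open>auto intro!: continuous_intros continuous_on_subset[OF cont\<phi>] simp: norm_divide norm_power\<close>)
    show "(f ^^ (p * r k)) (c k z) = (f ^^ (p * r k)) (\<psi> (\<phi> z / rot ^ r k))" if "z \<in> ball u0 s" for z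
    proof -
      have "z \<in> U" "z \<in> B" using s(2) that by blast+
      then show ?thesis using f_pn_inverse(2)[of z "r k"] c(2)[of z k] by simp
    qed
  qed (use c(3) z s in auto)
  have wB: "w \<noteq> \<kappa>" "z \<in> B \<Longrightarrow> z \<noteq> \<kappa>" for z
    using cB[of 0] d(1) by (auto simp: B_def)
  have geq: "g z = 1 / (z - \<kappa>)" if z: "z \<in> B" for z
  proof (rule analytic_continuation_open[of "ball u0 s" B g "\<lambda>z. 1 / (z - \<kappa>)"])
    show "(\<lambda>z. 1 / (z - \<kappa>)) holomorphic_on B" using wB by (intro holomorphic_intros) auto
    fix z assume z: "z \<in> ball u0 s"
    then have zU: "z \<in> U" and zB: "z \<in> B" using s by auto
    have "(\<lambda>k. \<phi> z / rot ^ r (\<rho> k)) \<longlonglongrightarrow> \<phi> z / 1"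
      using LIMSEQ_subseq_LIMSEQ[OF r(2) g(2)] by (intro tendsto_intros) (auto simp: o_def)
    then have "(\<lambda>k. \<psi> (\<phi> z / rot ^ r (\<rho> k))) \<longlonglongrightarrow> \<psi> (\<phi> z)"
      using \<phi>_in[OF zU]
      by (intro continuous_on_tendsto_compose[OF continuous_on_\<psi>]) (auto simp: norm_divide norm_power)
    then have "(\<lambda>k. c (\<rho> k) z) \<longlonglongrightarrow> z" by (simp add: ceq[OF z] \<psi>_\<phi>[OF zU])
    then have "(\<lambda>k. h (\<rho> k) z) \<longlonglongrightarrow> 1 / (z - \<kappa>)"
      unfolding h_def using wB(2)[OF zB] by (intro tendsto_intros) auto
    then show "g z = 1 / (z - \<kappa>)" using g(3)[OF zB] LIMSEQ_unique by blast
  qed (use s oB g z in auto)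
  have nc: "\<not> g constant_on B"
  proof
    assume "g constant_on B"
    then obtain a where a: "\<And>z. z \<in> B \<Longrightarrow> g z = a" by (auto simp: constant_on_def)
    have m: "w \<in> B" "w + of_real (d / 2) \<in> B" using d(1) by (auto simp: B_def dist_norm)
    have "1 / (w - \<kappa>) = 1 / (w + of_real (d / 2) - \<kappa>)"
      using a[OF m(1)] a[OF m(2)] geq[OF m(1)] geq[OF m(2)] by simp
    then have "w = w + of_real (d / 2)" using wB(2)[OF m(1)] wB(2)[OF m(2)] by simp
    then show False using d(1) by simp
  qed
  show ?thesis
  proof (rule fatou_set_if_eventually_avoids_ball[OF holomorphic_exp_map oB(1) _ d(1), of _ 0])
    show "w \<in> B" using d by (simp add: B_def)
    fix m z assume z: "z \<in> B"
    show "(f ^^ m) z \<notin> ball \<kappa> d"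
    proof
      assume fz: "(f ^^ m) z \<in> ball \<kappa> d"
      \<comment> \<open>By Hurwitz \<open>z\<close> is a value \<open>c (\<rho> k) y\<close> of a
        late branch. Hence the orbit of \<open>z\<close> comes back to \<open>y\<close> in
        \<open>B\<close> after having been near \<open>\<kappa>\<close>, which \<open>apart\<close>
        forbids.\<close>
      obtain k y where ky: "k \<ge> m" "y \<in> B" "(h \<circ> \<rho>) k y = g z"
        by (rule Hurwitz_attains[OF oB, of "h \<circ> \<rho>" g z m]) (use holh g nc z in auto)
      then have "c (\<rho> k) y = z"
        using geq[OF z] wB(2)[OF z] by (simp add: h_def)
      then have "(f ^^ (p * r (\<rho> k))) z = y" using c(2)[OF ky(2), of "\<rho> k"] by simp
      moreover have "m \<le> p * r (\<rho> k)"
      proof -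
        have "m \<le> \<rho> k" using ky(1) seq_suble[OF g(2), of k] by linarith
        also have "\<dots> \<le> r (\<rho> k)" by (rule r(1))
        also have "\<dots> \<le> p * r (\<rho> k)" using p_pos by simp
        finally show ?thesis .
      qed
      ultimately have "(f ^^ (p * r (\<rho> k) - m)) ((f ^^ m) z) = y"
        by (metis comp_apply funpow_add le_add_diff_inverse2)
      then show False using apart[OF fz, of "p * r (\<rho> k) - m"] ky(2) by (simp add: B_def)
    qed
  qed
qed

text \<open>Otherwise the late iterates of \<open>\<kappa>\<close> keep a distance from
  \<open>w\<close>, and so do the finitely many early ones, which as Fatou points differ from
  \<open>w\<close>; then \<open>w\<close> would be a Fatou point.\<close>

lemma frontier_in_limit_set:
  assumes w: "w \<in> frontier U"
  obtains s :: "nat \<Rightarrow> nat" where "strict_mono s" "\<And>k. 1 \<le> s k" "(\<lambda>k. (f ^^ s k) \<kappa>) \<longlonglongrightarrow> w"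
proof -
  have near: "\<exists>n\<ge>N. dist ((f ^^ n) \<kappa>) w < e" if e: "e > 0" for e N
  proof (rule ccontr)
    assume "\<not> ?thesis"
    then have 1: "\<And>n. n \<ge> N \<Longrightarrow> e \<le> dist ((f ^^ n) \<kappa>) w" by auto
    have ne: "(f ^^ n) \<kappa> \<noteq> w" for n
      using D_orbit_fatou[OF \<kappa>_in_D, of n] frontier_U_not_fatou[OF w] by auto
    define F where "F = (\<lambda>n. (f ^^ n) \<kappa>) ` {..<N}"
    have "finite F" by (simp add: F_def)
    then obtain e' where e': "e' > 0" "\<And>x. x \<in> F \<Longrightarrow> x \<noteq> w \<Longrightarrow> e' \<le> dist w x"
      using finite_set_avoid[of F w] by metis
    have "w \<in> fatou_set f"
    proof (rule frontier_fatou_if_orbit_avoids[OF w, of "min e e'"])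
      show "min e e' > 0" using e e' by simp
      fix n
      show "min e e' \<le> dist ((f ^^ n) \<kappa>) w"
      proof (cases "n \<ge> N")
        case True
        then show ?thesis using 1[of n] by simp
      next
        case False
        then have "e' \<le> dist w ((f ^^ n) \<kappa>)" using ne by (intro e'(2)) (auto simp: F_def)
        then show ?thesis by (simp add: dist_commute)
      qed
    qed
    then show False using frontier_U_not_fatou[OF w] by blast
  qed
  have "\<exists>s. \<forall>k. (1 \<le> s k \<and> dist ((f ^^ s k) \<kappa>) w < inverse (real (Suc k))) \<and> s k < s (Suc k)"
  proof (rule dependent_nat_choice)
    show "\<exists>x. 1 \<le> x \<and> dist ((f ^^ x) \<kappa>) w < inverse (real (Suc 0))" using near[of 1 1] by auto
    show "\<exists>y. (1 \<le> y \<and> dist ((f ^^ y) \<kappa>) w < inverse (real (Suc (Suc n)))) \<and> x < y" for x n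
      using near[of "inverse (real (Suc (Suc n)))" "Suc x"]
      by (metis Suc_le_eq inverse_positive_iff_positive le_add1 le_trans of_nat_0_less_iff plus_1_eq_Suc zero_less_Suc)
  qed
  then obtain s where s: "\<And>k. 1 \<le> s k" "\<And>k. dist ((f ^^ s k) \<kappa>) w < inverse (real (Suc k))" "\<And>k. s k < s (Suc k)"
    by blast
  have "(\<lambda>k. (f ^^ s k) \<kappa> - w) \<longlonglongrightarrow> 0"
    by (rule Lim_null_comparison[OF _ LIMSEQ_inverse_real_of_nat])
       (use s(2) in \<open>auto intro!: always_eventually less_imp_le simp: dist_norm\<close>)
  then have "(\<lambda>k. (f ^^ s k) \<kappa>) \<longlonglongrightarrow> w" by (simp add: LIM_zero_iff)
  moreover have "strict_mono s" using s(3) by (simp add: strict_mono_Suc_iff)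
  ultimately show ?thesis using that s(1) by blast
qed

text \<open>If the limit were not constant, Hurwitz's theorem would make some iterate of a point of
  \<open>V\<close> equal to \<open>w\<close>; but such iterates are Fatou points.\<close>

lemma iterates_tend_to_boundary_point:
  assumes V: "open V" "connected V" "\<kappa> \<in> V" and r: "r > 0"
    and avoid: "\<And>n z. 1 \<le> n \<Longrightarrow> z \<in> V \<Longrightarrow> (f ^^ n) z \<notin> ball a r" and w: "w \<in> frontier U"
  obtains s :: "nat \<Rightarrow> nat" where
    "\<And>K. compact K \<Longrightarrow> K \<subseteq> V \<Longrightarrow> uniform_limit K (\<lambda>k. f ^^ s k) (\<lambda>_. w) sequentially"
proof -
  obtain s where s: "strict_mono (s :: nat \<Rightarrow> nat)" "\<And>k. 1 \<le> s k" "(\<lambda>k. (f ^^ s k) \<kappa>) \<longlonglongrightarrow> w"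
    using frontier_in_limit_set[OF w] by blast
  have far: "r \<le> norm ((f ^^ s k) z - a)" if "z \<in> V" for k z
    using avoid[OF s(2) that] by (auto simp: dist_norm norm_minus_commute not_less)
  define h where "h k z = 1 / ((f ^^ s k) z - a)" for k z
  have holh: "h k holomorphic_on V" for k unfolding h_def
    by (intro holomorphic_intros holomorphic_exp_map_funpow) (metis far r norm_zero not_less)
  have bdh: "norm (h k z) \<le> 1 / r" if "z \<in> V" for k z
    using far[OF that, of k] r by (simp add: h_def norm_divide frac_le)
  obtain g \<rho> where g: "g holomorphic_on V" "strict_mono (\<rho> :: nat \<Rightarrow> nat)"
    "\<And>x. x \<in> V \<Longrightarrow> ((\<lambda>n. h (\<rho> n) x) \<longlongrightarrow> g x) sequentially"
    "\<And>K. \<lbrakk>compact K; K \<subseteq> V\<rbrakk> \<Longrightarrow> uniform_limit K (h \<circ> \<rho>) g sequentially"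
  proof (rule Montel[OF V(1), of "range h" h])
    show "\<And>K. \<lbrakk>compact K; K \<subseteq> V\<rbrakk> \<Longrightarrow> \<exists>C. \<forall>h\<in>range h. \<forall>z\<in>K. norm (h z) \<le> C"
      using bdh by blast
  qed (use holh in auto)
  have lim: "(\<lambda>k. (f ^^ s (\<rho> k)) \<kappa>) \<longlonglongrightarrow> w"
    using LIMSEQ_subseq_LIMSEQ[OF s(3) g(2)] by (simp add: o_def)
  have "r \<le> norm (w - a)"
  proof (rule tendsto_lowerbound)
    show "(\<lambda>k. norm ((f ^^ s (\<rho> k)) \<kappa> - a)) \<longlonglongrightarrow> norm (w - a)" by (intro tendsto_intros lim)
  qed (use far[OF V(3)] in auto)
  then have wa: "w \<noteq> a" using r by auto
  have "(\<lambda>k. h (\<rho> k) \<kappa>) \<longlonglongrightarrow> 1 / (w - a)"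
    unfolding h_def by (intro tendsto_intros lim) (use wa in auto)
  then have g\<kappa>: "g \<kappa> = 1 / (w - a)" using g(3)[OF V(3)] LIMSEQ_unique by blast
  have "g constant_on V"
  proof (rule ccontr)
    assume nc: "\<not> g constant_on V"
    obtain k z where kz: "z \<in> V" "(h \<circ> \<rho>) k z = g \<kappa>"
      by (rule Hurwitz_attains[OF V(1,2), of "h \<circ> \<rho>" g \<kappa> 0]) (use holh g nc V in auto)
    then have "(f ^^ s (\<rho> k)) z = w" using g\<kappa> wa by (simp add: h_def)
    moreover have "(f ^^ s (\<rho> k)) z \<in> fatou_set f"
      by (rule f_in_fatou_if_avoids[OF V(1) kz(1) r avoid])
    ultimately show False using frontier_U_not_fatou[OF w] by simp
  qed
  then have gc: "g z = 1 / (w - a)" if "z \<in> V" for z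
    using g\<kappa> V(3) that unfolding constant_on_def by metis
  show ?thesis
  proof (rule that[of "\<lambda>k. s (\<rho> k)"])
    fix K assume K: "compact K" "K \<subseteq> V"
    define c where "c = 1 / (w - a)"
    have c: "c \<noteq> 0" using wa by (simp add: c_def)
    show "uniform_limit K (\<lambda>k. f ^^ s (\<rho> k)) (\<lambda>_. w) sequentially"
    proof (rule uniform_limitI)
      fix e :: real assume e: "e > 0"
      \<comment> \<open>The first bound keeps \<open>H\<close> away from 0, the second turns
        closeness of the inverted iterates into closeness \<open>e\<close> of the iterates.\<close>
      define q where "q = min (norm c / 2) (e * (norm c)\<^sup>2 / 2)"
      have q: "q > 0" using c e by (simp add: q_def)
      have "\<forall>\<^sub>F k in sequentially. \<forall>z\<in>K. dist ((h \<circ> \<rho>) k z) (g z) < q"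
        using uniform_limitD[OF g(4)[OF K] q] .
      then show "\<forall>\<^sub>F k in sequentially. \<forall>z\<in>K. dist ((f ^^ s (\<rho> k)) z) w < e"
      proof eventually_elim
        case (elim k)
        show ?case
        proof
          fix z assume z: "z \<in> K"
          define H where "H = h (\<rho> k) z"
          have zV: "z \<in> V" using z K by blast
          have lt: "norm (H - c) < q" using elim z gc[OF zV] by (auto simp: dist_norm H_def c_def)
          then have Hc: "norm H > norm c / 2"
            using norm_triangle_ineq2[of c H] by (auto simp: q_def norm_minus_commute)
          have H0: "H \<noteq> 0" using Hc by auto
          have "(f ^^ s (\<rho> k)) z - a \<noteq> 0" using H0 by (auto simp: H_def h_def)
          then have "(f ^^ s (\<rho> k)) z - w = 1 / H - 1 / c"
            by (simp add: H_def h_def c_def)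
          also have "\<dots> = (c - H) / (H * c)" using H0 c by (simp add: field_simps)
          finally have "norm ((f ^^ s (\<rho> k)) z - w) = norm (H - c) / (norm H * norm c)"
            by (simp add: norm_divide norm_mult norm_minus_commute)
          also have "\<dots> < (e * (norm c)\<^sup>2 / 2) / (norm c / 2 * norm c)"
            using lt Hc c e by (intro frac_less mult_right_mono) (auto simp: q_def)
          also have "\<dots> = e" using c by (simp add: power2_eq_square field_simps)
          finally show "dist ((f ^^ s (\<rho> k)) z) w < e" by (simp add: dist_norm)
        qed
      qed
    qed
  qed
qed

section \<open>Preimages of \<open>U\<close> and the complementary component \<open>V\<close> around
  \<open>\<kappa>\<close>\<close>

definition Ut :: "complex set" where "Ut = {z. \<exists>n. (f ^^ n) z \<in> U}"
definition V :: "complex set" where "V = connected_component_set (- closure Ut) \<kappa>"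

lemma U_subset_Ut: "U \<subseteq> Ut"
  unfolding Ut_def by (auto intro: exI[of _ 0])

lemma f_in_Ut_iff: "f z \<in> Ut \<longleftrightarrow> z \<in> Ut"
proof
  assume "f z \<in> Ut"
  then obtain n where "(f ^^ n) (f z) \<in> U" by (auto simp: Ut_def)
  then have "(f ^^ Suc n) z \<in> U" by (simp add: funpow_swap1)
  then show "z \<in> Ut" unfolding Ut_def by blast
next
  assume "z \<in> Ut"
  then obtain n where n: "(f ^^ n) z \<in> U" by (auto simp: Ut_def)
  have "(f ^^ (p + n)) z \<in> U" using n fp_U by (auto simp: funpow_add)
  moreover have "p + n = Suc (p + n - 1)" using p_pos by simp
  ultimately have "(f ^^ (p + n - 1)) (f z) \<in> U" by (metis comp_apply funpow_Suc_right)
  then show "f z \<in> Ut" unfolding Ut_def by blast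
qed

lemma f_funpow_in_Ut_iff: "(f ^^ n) z \<in> Ut \<longleftrightarrow> z \<in> Ut"
  by (induction n) (auto simp: f_in_Ut_iff)

text \<open>\<open>f\<close> is open: if \<open>f z\<close> were in the closure, images of points
  near \<open>z\<close> would lie in \<open>Ut\<close>, and by total invariance so would these
  points.\<close>

lemma f_notin_closure_Ut: "z \<notin> closure Ut \<Longrightarrow> f z \<notin> closure Ut"
proof
  assume z: "z \<notin> closure Ut" and fz: "f z \<in> closure Ut"
  have "open (f ` (- closure Ut))" using open_exp_map_funpow_image[OF open_Compl[OF closed_closure], of 1 \<kappa>] by simp
  then have "f ` (- closure Ut) \<inter> Ut \<noteq> {}"
    using z fz open_Int_closure_eq_empty by blast
  then show False using f_in_Ut_iff closure_subset[of Ut] by auto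
qed

lemma f_funpow_notin_closure_Ut: "z \<notin> closure Ut \<Longrightarrow> (f ^^ n) z \<notin> closure Ut"
  by (induction n) (auto simp: f_notin_closure_Ut)

lemma limit_not_in_Ut:
  assumes w: "w \<in> frontier U" and z: "z \<in> Ut" and lim: "(\<lambda>k. (f ^^ s k) z) \<longlonglongrightarrow> (f ^^ i) w"
  shows False
proof -
  obtain j where j: "(f ^^ j) z \<in> U" using z by (auto simp: Ut_def)
  have "(\<lambda>k. (f ^^ j) ((f ^^ s k) z)) \<longlonglongrightarrow> (f ^^ j) ((f ^^ i) w)"
    by (rule continuous_on_tendsto_compose[OF continuous_on_exp_map_funpow[of UNIV] lim]) auto
  then have "(\<lambda>k. (f ^^ s k) ((f ^^ j) z)) \<longlonglongrightarrow> (f ^^ (j + i)) w"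
    by (simp add: funpow_add[THEN fun_cong, unfolded comp_apply, symmetric] add.commute)
  then show False using orbit_limit_not_boundary[OF j w] by blast
qed

lemma uncountable_frontier_U: "uncountable (frontier U)"
proof (rule uncountable_frontier[OF open_U U_nonempty])
  show "closure U \<noteq> UNIV" using closure_U_avoids_D \<kappa>_in_D by blast
qed

text \<open>Along some sequence the iterates on \<open>D\<close> tend to a boundary point of
  \<open>U\<close>, which they do at no point of \<open>Ut\<close>.\<close>

lemma D_Int_closure_Ut: "D \<inter> closure Ut = {}"
proof -
  have "D \<inter> Ut = {}"
  proof (rule ccontr)
    assume "D \<inter> Ut \<noteq> {}"
    then obtain z where z: "z \<in> D" "z \<in> Ut" by blast
    obtain w where w: "w \<in> frontier U"
      using uncountable_frontier_U by (metis countable_empty equals0I)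
    obtain s where s: "\<And>K. compact K \<Longrightarrow> K \<subseteq> D \<Longrightarrow> uniform_limit K (\<lambda>k. f ^^ s k) (\<lambda>_. w) sequentially"
      by (rule iterates_tend_to_boundary_point[of D \<delta> \<kappa> w]) (use wander \<kappa>_in_D \<delta>_pos w in auto)
    have "(\<lambda>k. (f ^^ s k) z) \<longlonglongrightarrow> (f ^^ 0) w"
      using tendsto_uniform_limitI[OF s[of "{z}"]] z by simp
    then show False using limit_not_in_Ut[OF w z(2)] by blast
  qed
  then show ?thesis by (simp add: open_Int_closure_eq_empty)
qed

lemma open_V: "open V" unfolding V_def by (intro open_connected_component) auto
lemma connected_V: "connected V" unfolding V_def by simp
lemma V_Int_closure_Ut: "V \<inter> closure Ut = {}"
  using connected_component_subset unfolding V_def by blast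
lemma D_subset_V: "D \<subseteq> V"
  unfolding V_def using D_Int_closure_Ut \<kappa>_in_D by (intro connected_component_maximal) auto
lemma frontier_V: "frontier V \<subseteq> closure Ut"
proof -
  have "frontier V \<subseteq> frontier (- closure Ut)"
    unfolding V_def by (rule frontier_of_connected_component_subset)
  also have "\<dots> \<subseteq> closure Ut" by (simp add: frontier_subset_closed)
  finally show ?thesis .
qed

lemma V_iterates_tend_to_boundary_point:
  assumes w: "w \<in> frontier U"
  obtains s :: "nat \<Rightarrow> nat" where
    "\<And>K. compact K \<Longrightarrow> K \<subseteq> V \<Longrightarrow> uniform_limit K (\<lambda>k. f ^^ s k) (\<lambda>_. w) sequentially"
proof -
  obtain b where "b \<in> U" using U_nonempty by blast
  then obtain r where r: "r > 0" "ball b r \<subseteq> U" using open_U open_contains_ball by blast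
  show ?thesis
  proof (rule iterates_tend_to_boundary_point[OF open_V connected_V _ r(1) _ w])
    show "\<kappa> \<in> V" using D_subset_V \<kappa>_in_D by blast
    show "(f ^^ n) z \<notin> ball b r" if "z \<in> V" for n z
      using f_funpow_in_Ut_iff[of n z] V_Int_closure_Ut closure_subset[of Ut] U_subset_Ut r(2) that by blast
  qed (rule that)
qed

section \<open>At most one point of \<open>V\<close> in each grand orbit\<close>

text \<open>Equal iterates would make the orbit of \<open>\<kappa>\<close> finite, but its closure
  contains the uncountable set \<open>frontier U\<close>.\<close>

lemma iterates_distinct:
  assumes mn: "m < n"
  shows "\<exists>z. (f ^^ m) z \<noteq> (f ^^ n) z"
proof (rule ccontr)
  assume "\<not> ?thesis"
  then have e: "(f ^^ m) z = (f ^^ n) z" for z by blast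
  define F where "F = (\<lambda>k. (f ^^ k) \<kappa>) ` {..<n}"
  have orb: "(f ^^ k) \<kappa> \<in> F" for k
  proof (induction k rule: less_induct)
    case (less k)
    show ?case
    proof (cases "k < n")
      case True
      then show ?thesis by (auto simp: F_def)
    next
      case False
      then have "(f ^^ k) \<kappa> = (f ^^ (k - n)) ((f ^^ n) \<kappa>)"
        by (metis comp_apply funpow_add le_add_diff_inverse2 not_less)
      also have "\<dots> = (f ^^ (k - n + m)) \<kappa>" by (simp add: e[symmetric] funpow_add)
      also have "\<dots> \<in> F" using False mn by (intro less.IH) auto
      finally show ?thesis .
    qed
  qed
  have "frontier U \<subseteq> F"
  proof
    fix w assume w: "w \<in> frontier U"
    obtain s where s: "strict_mono (s :: nat \<Rightarrow> nat)" "\<And>k. 1 \<le> s k" "(\<lambda>k. (f ^^ s k) \<kappa>) \<longlonglongrightarrow> w"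
      using frontier_in_limit_set[OF w] by blast
    have "closed F" unfolding F_def by (intro finite_imp_closed finite_imageI) simp
    then show "w \<in> F" by (rule closed_sequentially[OF _ orb s(3)])
  qed
  then have "countable (frontier U)"
    by (rule countable_subset) (simp add: F_def countable_finite)
  then show False using uncountable_frontier_U by blast
qed

text \<open>Along times at which the iterates on \<open>V\<close> tend to \<open>w\<close>, the
  relation passes to the limit and gives \<open>(f ^^ m) w = (f ^^ n) w\<close> on all of
  \<open>frontier U\<close>, hence everywhere by the identity theorem.\<close>

lemma V_grand_orbit_level_less:
  assumes x: "x \<in> V" and y: "y \<in> V" and e: "(f ^^ m) x = (f ^^ n) y" and mn: "m < n"
  shows False
proof -
  have fr: "(f ^^ m) w - (f ^^ n) w = 0" if w: "w \<in> frontier U" for w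
  proof -
    obtain s where s: "\<And>K. compact K \<Longrightarrow> K \<subseteq> V \<Longrightarrow> uniform_limit K (\<lambda>k. f ^^ s k) (\<lambda>_. w) sequentially"
      using V_iterates_tend_to_boundary_point[OF w] by blast
    have lim: "(\<lambda>k. (f ^^ s k) z) \<longlonglongrightarrow> w" if "z \<in> V" for z
      using tendsto_uniform_limitI[OF s[of "{z}"], of z] that by simp
    have lim2: "(\<lambda>k. (f ^^ j) ((f ^^ s k) z)) \<longlonglongrightarrow> (f ^^ j) w" if "z \<in> V" for j z
      by (rule continuous_on_tendsto_compose[OF continuous_on_exp_map_funpow[of UNIV] lim[OF that]]) auto
    have comm: "(f ^^ j) ((f ^^ i) z) = (f ^^ i) ((f ^^ j) z)" for i j z
      by (metis add.commute comp_apply funpow_add)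
    have "(f ^^ m) ((f ^^ s k) x) = (f ^^ n) ((f ^^ s k) y)" for k
      unfolding comm[of m] comm[of n] e ..
    then have "(f ^^ m) w = (f ^^ n) w"
      using lim2[OF x, of m] lim2[OF y, of n] LIMSEQ_unique by simp
    then show ?thesis by simp
  qed
  have "\<exists>\<xi>. \<xi> islimpt frontier U"
  proof (rule ccontr)
    assume "\<nexists>\<xi>. \<xi> islimpt frontier U"
    then have "frontier U sparse_in UNIV" unfolding sparse_in_def by blast
    then have "countable (UNIV \<inter> frontier U)" by (intro sparse_imp_countable) auto
    then show False using uncountable_frontier_U by simp
  qed
  then obtain \<xi> where \<xi>: "\<xi> islimpt frontier U" by blast
  obtain z where "(f ^^ m) z \<noteq> (f ^^ n) z" using iterates_distinct[OF mn] by blast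
  moreover have "(f ^^ m) z - (f ^^ n) z = 0"
    by (rule analytic_continuation[of "\<lambda>z. (f ^^ m) z - (f ^^ n) z" UNIV "frontier U" \<xi>])
       (use \<xi> fr in \<open>auto intro!: holomorphic_intros holomorphic_exp_map_funpow\<close>)
  ultimately show False by simp
qed

lemma V_grand_orbit_level:
  assumes "x \<in> V" "y \<in> V" "(f ^^ m) x = (f ^^ n) y"
  shows "m = n"
  using V_grand_orbit_level_less[OF assms] V_grand_orbit_level_less[OF assms(2,1) assms(3)[symmetric]]
  by (meson linorder_neqE_nat)

text \<open>With winding number 0 the loop \<open>f \<circ> g\<close> has a logarithm about
  \<open>\<kappa>\<close> that closes up; \<open>g\<close> differs from it by a constant and would
  close up as well.\<close>

lemma winding_number_exp_map_nonzero:
  assumes g: "path g" and e: "exp (pathstart g) = exp (pathfinish g)" and ne: "pathstart g \<noteq> pathfinish g"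
  shows "winding_number (f \<circ> g) \<kappa> \<noteq> 0"
proof
  assume w0: "winding_number (f \<circ> g) \<kappa> = 0"
  have p: "path (f \<circ> g)"
    using g continuous_on_exp_map_funpow[of _ 1] by (intro path_continuous_image) auto
  have "\<kappa> \<notin> path_image (f \<circ> g)"
    by (auto simp: path_image_def) (metis exp_map_neq)
  then obtain q where q: "path q" "pathfinish q - pathstart q = 2 * of_real pi * \<i> * winding_number (f \<circ> g) \<kappa>"
      "\<And>t. t \<in> {0..1} \<Longrightarrow> (f \<circ> g) t = \<kappa> + exp (q t)"
    using winding_number_as_continuous_log[OF p] by blast
  define c where "c = g 0 - q 0"
  have exq: "exp (g t) = exp (q t)" if "t \<in> {0..1}" for t
    using q(3)[OF that] by (simp add: f_eq)
  have "exp c = 1" using exq[of 0] by (simp add: c_def exp_diff)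
  then have eq: "exp (g t) = exp (q t + c)" if "t \<in> {0..1}" for t
    using exq[OF that] by (simp add: exp_add)
  have cg: "continuous_on {0..1} g" and cq: "continuous_on {0..1} (\<lambda>t. q t + c)"
    using g q(1) by (auto simp: path_def intro!: continuous_on_add continuous_on_const)
  have "g 1 = q 1 + c"
    by (rule exp_eq_exp_on_connected[OF _ cg cq eq, of 0]) (auto simp: c_def)
  moreover have "q 1 = q 0" using q(2) w0 by (simp add: pathstart_def pathfinish_def)
  ultimately show False using ne by (simp add: c_def pathstart_def pathfinish_def)
qed

text \<open>
  If \<open>f ^^ m\<close> separates two points of \<open>V\<close> that \<open>f ^^ Suc m\<close> identifies, then a path joining them is mapped to a
  loop around \<open>\<kappa>\<close>. By the maximum principle the iterates still converge inside the loop, so its inside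
  avoids \<open>Ut\<close>, and \<open>V\<close> contains \<open>\<kappa>\<close> as well as points of the loop, contradicting \<open>V_grand_orbit_level\<close>.
\<close>

lemma f_funpow_inj_on_V: "inj_on (f ^^ m) V"
proof (induction m)
  case (Suc m)
  show ?case
  proof (rule inj_onI, rule ccontr)
    fix x y assume xy: "x \<in> V" "y \<in> V" and e: "(f ^^ Suc m) x = (f ^^ Suc m) y" and ne: "x \<noteq> y"
    have ne': "(f ^^ m) x \<noteq> (f ^^ m) y" using Suc.IH xy ne by (auto dest: inj_onD)
    have "path_connected V" using open_V connected_V by (simp add: connected_open_path_connected)
    then obtain h where h: "path h" "path_image h \<subseteq> V" "pathstart h = x" "pathfinish h = y"
      using xy unfolding path_connected_def by metis
    define g where "g = (f ^^ m) \<circ> h"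
    have g: "path g" unfolding g_def by (intro path_continuous_image h continuous_on_exp_map_funpow)
    have ends: "pathstart g = (f ^^ m) x" "pathfinish g = (f ^^ m) y"
      using h by (simp_all add: g_def pathstart_compose pathfinish_compose)
    define T where "T = path_image (f \<circ> g)"
    have fg: "f \<circ> g = (f ^^ Suc m) \<circ> h" by (simp add: g_def o_assoc)
    have T: "T = (f ^^ Suc m) ` path_image h" unfolding T_def fg by (rule path_image_compose)
    have pfg: "path (f \<circ> g)" unfolding fg by (intro path_continuous_image h continuous_on_exp_map_funpow)
    have eexp: "exp ((f ^^ m) x) = exp ((f ^^ m) y)" using e by (simp add: f_eq)
    have loop: "pathfinish (f \<circ> g) = pathstart (f \<circ> g)"
      using e ends by (simp add: pathstart_compose pathfinish_compose)
    have "winding_number (f \<circ> g) \<kappa> \<noteq> 0"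
      by (rule winding_number_exp_map_nonzero[OF g]) (use ends eexp ne' in auto)
    then have "\<kappa> \<notin> outside T" using winding_number_zero_in_outside[OF pfg loop] by (auto simp: T_def)
    moreover have "\<kappa> \<notin> T" by (auto simp: T_def path_image_def) (metis exp_map_neq)
    ultimately have "\<kappa> \<in> inside T" using inside_Un_outside[of T] by blast
    define Q where "Q = connected_component_set (- T) \<kappa>"
    have bQ: "bounded Q" and \<kappa>Q: "\<kappa> \<in> Q"
      using \<open>\<kappa> \<in> inside T\<close> by (auto simp: inside_def Q_def)
    have cT: "compact T" unfolding T_def using pfg by (rule compact_path_image)
    have oQ: "open Q" unfolding Q_def using cT by (intro open_connected_component) (simp add: compact_imp_closed open_Compl)
    have "frontier Q \<subseteq> frontier (- T)" unfolding Q_def by (rule frontier_of_connected_component_subset)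
    then have frQ: "frontier Q \<subseteq> T"
      using cT by (metis compact_imp_closed frontier_complement frontier_subset_closed subset_trans)
    have Tav: "T \<inter> closure Ut = {}"
      unfolding T using f_funpow_notin_closure_Ut h(2) V_Int_closure_Ut by blast
    have "Q \<inter> Ut = {}"
    proof (rule ccontr)
      assume "Q \<inter> Ut \<noteq> {}"
      then obtain z where z: "z \<in> Q" "z \<in> Ut" by blast
      obtain w where w: "w \<in> frontier U"
        using uncountable_frontier_U by (metis countable_empty equals0I)
      obtain s where s: "\<And>K. compact K \<Longrightarrow> K \<subseteq> V \<Longrightarrow> uniform_limit K (\<lambda>k. f ^^ s k) (\<lambda>_. w) sequentially"
        using V_iterates_tend_to_boundary_point[OF w] by blast
      define w' where "w' = (f ^^ Suc m) w"
      have "(\<lambda>k. (f ^^ s k) z) \<longlonglongrightarrow> w'"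
      proof (rule tendstoI)
        fix e :: real assume e: "e > 0"
        have "isCont (f ^^ Suc m) w"
          using continuous_on_exp_map_funpow[of UNIV] by (simp add: continuous_on_eq_continuous_at del: funpow.simps)
        then obtain d where d: "d > 0" "\<And>x. dist x w < d \<Longrightarrow> dist ((f ^^ Suc m) x) w' < e / 2"
          using e unfolding continuous_at_eps_delta w'_def by (metis half_gt_zero)
        have "compact (path_image h)" using h(1) by (rule compact_path_image)
        from uniform_limitD[OF s[OF this h(2)] d(1)]
        show "\<forall>\<^sub>F k in sequentially. dist ((f ^^ s k) z) w' < e"
        proof eventually_elim
          case (elim k)
          have onT: "norm ((f ^^ s k) \<zeta> - w') \<le> e / 2" if \<zeta>: "\<zeta> \<in> T" for \<zeta>
          proof -
            obtain \<xi> where \<xi>: "\<xi> \<in> path_image h" "\<zeta> = (f ^^ Suc m) \<xi>" using \<zeta> T by blast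
            have "(f ^^ s k) \<zeta> = (f ^^ Suc m) ((f ^^ s k) \<xi>)"
              unfolding \<xi>(2) by (metis add.commute comp_apply funpow_add)
            then show ?thesis using d(2)[of "(f ^^ s k) \<xi>"] elim \<xi>(1) by (simp add: dist_norm less_imp_le del: funpow.simps)
          qed
          have "norm ((f ^^ s k) z - w') \<le> e / 2"
          proof (rule maximum_modulus_frontier[of "\<lambda>z. (f ^^ s k) z - w'" Q])
            show "(\<lambda>z. (f ^^ s k) z - w') holomorphic_on interior Q"
              by (intro holomorphic_intros holomorphic_exp_map_funpow)
            show "continuous_on (closure Q) (\<lambda>z. (f ^^ s k) z - w')"
              by (intro continuous_intros continuous_on_exp_map_funpow)
          qed (use bQ onT frQ z in auto)
          then show ?case using e by (simp add: dist_norm)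
        qed
      qed
      then show False using limit_not_in_Ut[OF w z(2)] unfolding w'_def by blast
    qed
    then have "Q \<inter> closure Ut = {}" using oQ by (simp add: open_Int_closure_eq_empty)
    moreover have "closure Q = Q \<union> frontier Q" by (rule closure_Un_frontier)
    ultimately have "closure Q \<subseteq> - closure Ut" using frQ Tav by blast
    moreover have "connected (closure Q)" unfolding Q_def by (intro connected_imp_connected_closure) simp
    ultimately have clV: "closure Q \<subseteq> V"
      unfolding V_def using \<kappa>Q closure_subset[of Q] by (intro connected_component_maximal) auto
    \<comment> \<open>A boundary point of \<open>Q\<close> lies in \<open>V\<close> and is also the
      image under \<open>f ^^ Suc m\<close> of a point of \<open>V\<close>.\<close>
    have "frontier Q \<noteq> {}" using bQ \<kappa>Q by (intro frontier_not_empty) auto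
    then obtain \<zeta> where \<zeta>: "\<zeta> \<in> frontier Q" by blast
    then have "\<zeta> \<in> V" using clV by (auto simp: frontier_def)
    moreover obtain \<xi> where "\<xi> \<in> path_image h" "\<zeta> = (f ^^ Suc m) \<xi>" using \<zeta> frQ T by blast
    ultimately have "0 = Suc m"
      using V_grand_orbit_level[of \<zeta> \<xi> 0 "Suc m"] h(2) by (simp del: funpow.simps(2)) blast
    then show False by simp
  qed
qed (simp add: id_def)

lemma V_grand_orbit_unique:
  assumes "x \<in> V" "y \<in> V" "(f ^^ m) x = (f ^^ n) y"
  shows "m = n \<and> x = y"
  using V_grand_orbit_level[OF assms] f_funpow_inj_on_V[of m] assms by (auto dest: inj_onD)

end

section \<open>A weak form of the Koebe quarter theorem\<close>

text \<open>
  The square root \<open>g\<close> of \<open>1 - h\<close> with \<open>g 0 = 1\<close> omits \<open>0\<close> and \<open>-1\<close>, so Schottky's theorem applies to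
  \<open>g / (g + 1)\<close>.
\<close>

lemma deriv_zero_le_if_omits_one:
  assumes h: "h holomorphic_on ball 0 1" and h0: "\<And>z. z \<in> ball 0 1 \<Longrightarrow> h z = 0 \<longleftrightarrow> z = 0"
    and h1: "\<And>z. z \<in> ball 0 1 \<Longrightarrow> h z \<noteq> 1"
  shows "norm (deriv h 0) \<le> 32 * exp (pi * exp (pi * 15))"
proof -
  obtain l where l: "l holomorphic_on ball 0 1" "\<And>z. z \<in> ball 0 1 \<Longrightarrow> exp (l z) = 1 - h z"
    by (rule holomorphic_logarithm_exists[of "ball 0 1" "\<lambda>z. 1 - h z" 0])
       (use h1 in \<open>auto intro!: holomorphic_intros h\<close>)
  \<comment> \<open>A sign, making \<open>g 0 = 1\<close>.\<close>
  define c where "c = exp (l 0 / 2)"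
  have csq: "c * c = 1"
    using l(2)[of 0] h0[of 0] by (simp add: c_def exp_add[symmetric])
  define g where "g z = c * exp (l z / 2)" for z
  have gsq: "g z * g z = 1 - h z" if "z \<in> ball 0 1" for z
  proof -
    have "g z * g z = (c * c) * exp (l z / 2 + l z / 2)" unfolding g_def exp_add by (simp add: algebra_simps)
    then show ?thesis using csq l(2)[OF that] by simp
  qed
  have g0: "g 0 = 1" using csq by (simp add: g_def c_def)
  have gm: "g z + 1 \<noteq> 0" if z: "z \<in> ball 0 1" for z
  proof
    assume "g z + 1 = 0"
    then have "g z = - 1" by (simp add: eq_neg_iff_add_eq_0)
    then have "h z = 0" using gsq[OF z] by simp
    then have "z = 0" using h0[OF z] by simp
    then show False using \<open>g z = - 1\<close> g0 by simp
  qed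
  have gn0: "g z \<noteq> 0" for z using csq by (auto simp: g_def)
  \<comment> \<open>Rescaling by 2 makes \<open>F\<close> holomorphic on the closed unit disc;
    \<open>F 0 = 1 / 2\<close>.\<close>
  define F where "F z = g (z / 2) / (g (z / 2) + 1)" for z
  have half: "z / 2 \<in> ball 0 1" if "z \<in> cball 0 1" for z :: complex using that by (simp add: norm_divide)
  have holg: "g holomorphic_on ball 0 1" unfolding g_def by (intro holomorphic_intros l) simp
  have "(g \<circ> (\<lambda>z. z / 2)) holomorphic_on cball 0 1"
  proof (rule holomorphic_on_compose_gen[OF _ holg])
    show "(\<lambda>z. z / 2 :: complex) holomorphic_on cball 0 1" by (intro holomorphic_intros) simp
    show "(\<lambda>z. z / 2 :: complex) ` cball 0 1 \<subseteq> ball 0 1" using half by blast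
  qed
  then have holF: "F holomorphic_on cball 0 1" unfolding F_def
    using gm half by (intro holomorphic_intros) (auto simp: o_def)
  have F01: "\<not> (F z = 0 \<or> F z = 1)" if "z \<in> cball 0 1" for z
    using gn0 gm[OF half[OF that]] by (auto simp: F_def)
  \<comment> \<open>The 15 is \<open>2 + 2 * (1 / 2) + 12 * (1 / 2) / (1 - 1 / 2)\<close>,
    Schottky's exponent with both parameters equal to \<open>1 / 2\<close>.\<close>
  define S where "S = exp (pi * exp (pi * 15))"
  have bd: "norm (F z) \<le> S" if "norm z \<le> 1 / 2" for z
  proof -
    have "norm (F z) \<le> exp (pi * exp (pi * (2 + 2 * (1 / 2) + 12 * (1 / 2) / (1 - 1 / 2))))"
      by (rule Schottky[OF holF _ F01]) (use that in \<open>auto simp: F_def g0\<close>)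
    then show ?thesis by (simp add: S_def)
  qed
  have "norm ((deriv ^^ 1) F 0) \<le> fact 1 * S / (1 / 2) ^ 1"
  proof (rule Cauchy_inequality)
    show "F holomorphic_on ball 0 (1 / 2)" by (rule holomorphic_on_subset[OF holF]) auto
    show "continuous_on (cball 0 (1 / 2)) F"
      by (rule continuous_on_subset[OF holomorphic_on_imp_continuous_on[OF holF]]) auto
  qed (use bd in auto)
  then have dF: "norm (deriv F 0) \<le> 2 * S" by simp
  define l' where "l' = deriv l 0"
  have dl: "(l has_field_derivative l') (at 0)"
    unfolding l'_def by (rule holomorphic_derivI[OF l(1)]) auto
  have dg: "(g has_field_derivative l' / 2) (at 0)"
    unfolding g_def using csq
    by (auto intro!: derivative_eq_intros dl simp: c_def[symmetric] algebra_simps)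
  have half': "((\<lambda>z::complex. z / 2) has_field_derivative 1 / 2) (at 0)"
    by (rule DERIV_cdivide[OF DERIV_ident])
  have "(g has_field_derivative l' / 2) (at (0 / 2))" using dg by simp
  from DERIV_chain2[of g _ "\<lambda>z. z / 2", OF this half']
  have dg2: "((\<lambda>z. g (z / 2)) has_field_derivative l' / 4) (at 0)" by simp
  have "((\<lambda>z. g (z / 2) / (g (z / 2) + 1)) has_field_derivative
      ((l' / 4) * (g (0 / 2) + 1) - g (0 / 2) * (l' / 4 + 0)) / ((g (0 / 2) + 1) * (g (0 / 2) + 1))) (at 0)"
    by (rule DERIV_divide[OF dg2 DERIV_add[OF dg2 DERIV_const]]) (simp add: g0)
  then have "(F has_field_derivative l' / 16) (at 0)"
    by (simp add: F_def[abs_def] g0 field_simps)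
  then have "deriv F 0 = l' / 16" by (rule DERIV_imp_deriv)
  \<comment> \<open>The constant 32 is 16 from the chain rule times 2 from Cauchy's inequality on
    radius \<open>1 / 2\<close>.\<close>
  then have "norm (l' / 16) \<le> 2 * S" using dF by metis
  then have l'le: "norm l' \<le> 32 * S" by (simp add: norm_divide)
  have "((\<lambda>z. 1 - exp (l z)) has_field_derivative - l') (at 0)"
    using l(2)[of 0] h0[of 0] by (auto intro!: derivative_eq_intros dl)
  moreover have "\<forall>\<^sub>F z in nhds 0. 1 - exp (l z) = h z"
    by (rule eventually_nhds_in_open[of "ball 0 1", THEN eventually_mono]) (use l(2) in auto)
  ultimately have "(h has_field_derivative - l') (at 0)"
    using DERIV_cong_ev[of 0 0 "\<lambda>z. 1 - exp (l z)" h "- l'" "- l'"] by simp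
  then show ?thesis using l'le by (simp add: DERIV_imp_deriv S_def)
qed

definition koebe_const :: real where
  "koebe_const = 1 / (32 * exp (pi * exp (pi * 15)))"

lemma koebe_const_pos: "koebe_const > 0"
  by (simp add: koebe_const_def)

text \<open>An affine change moves an omitted value \<open>a\<close> to 1; the preceding derivative
  bound then says that \<open>a\<close> is not too close to \<open>\<phi> d\<close>.\<close>

lemma weak_koebe:
  assumes hol: "\<phi> holomorphic_on ball d r" and r: "r > 0" and inj: "inj_on \<phi> (ball d r)"
  shows "ball (\<phi> d) (koebe_const * r * norm (deriv \<phi> d)) \<subseteq> \<phi> ` ball d r"
proof (rule subsetI, rule ccontr)
  fix a assume a: "a \<in> ball (\<phi> d) (koebe_const * r * norm (deriv \<phi> d))" "a \<notin> \<phi> ` ball d r"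
  have ane: "a - \<phi> d \<noteq> 0" using a(2) r by auto
  have inb: "d + of_real r * z \<in> ball d r" if "z \<in> ball 0 1" for z
    using that r by (simp add: dist_norm norm_mult)
  define h where "h z = (\<phi> (d + of_real r * z) - \<phi> d) / (a - \<phi> d)" for z
  have "(\<phi> \<circ> (\<lambda>z. d + of_real r * z)) holomorphic_on ball 0 1"
    by (rule holomorphic_on_compose_gen[OF _ hol]) (use inb in \<open>auto intro!: holomorphic_intros\<close>)
  then have holh: "h holomorphic_on ball 0 1"
    unfolding h_def using ane by (intro holomorphic_intros) (auto simp: o_def)
  have z0: "h z = 0 \<longleftrightarrow> z = 0" if "z \<in> ball 0 1" for z
    using inj_onD[OF inj, of "d + of_real r * z" d] inb[OF that] ane r by (auto simp: h_def)
  have z1: "h z \<noteq> 1" if "z \<in> ball 0 1" for z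
    using a(2) inb[OF that] ane by (auto simp: h_def)
  have d\<phi>: "(\<phi> has_field_derivative deriv \<phi> d) (at (d + of_real r * 0))"
    using holomorphic_derivI[OF hol, of d] r by simp
  have "((\<lambda>z. \<phi> (d + of_real r * z)) has_field_derivative deriv \<phi> d * of_real r) (at 0)"
    by (rule DERIV_chain2[of \<phi> _ "\<lambda>z. d + of_real r * z", OF d\<phi>]) (auto intro!: derivative_eq_intros)
  then have "(h has_field_derivative deriv \<phi> d * of_real r / (a - \<phi> d)) (at 0)"
    unfolding h_def using ane by (auto intro!: derivative_eq_intros)
  then have "norm (deriv \<phi> d * of_real r / (a - \<phi> d)) \<le> 1 / koebe_const"
    using deriv_zero_le_if_omits_one[OF holh z0 z1] by (simp add: DERIV_imp_deriv koebe_const_def)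
  then have "koebe_const * (norm (deriv \<phi> d) * r) \<le> norm (a - \<phi> d)"
    using ane r koebe_const_pos by (simp add: norm_divide norm_mult field_simps)
  then show False using a(1) by (simp add: dist_norm norm_minus_commute mult.commute mult.left_commute)
qed

section \<open>Partial fractions of the exponential map\<close>

text \<open>Differentiate Euler's formula
  \<open>Gamma z * Gamma (1 - z) = pi / sin (pi * z)\<close>.\<close>

lemma Digamma_reflection:
  assumes z: "(z :: complex) \<notin> \<int>"
  shows "Digamma (1 - z) - Digamma z = of_real pi * cot (of_real pi * z)"
proof -
  have s: "sin (of_real pi * z) \<noteq> 0"
    using z by (auto simp: sin_eq_0 Ints_def)
  have nz: "z \<notin> \<int>\<^sub>\<le>\<^sub>0" "1 - z \<notin> \<int>\<^sub>\<le>\<^sub>0"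
    using z nonpos_Ints_Int Ints_diff[OF Ints_1, of "1 - z"] by auto
  define P where "P = Gamma z * Gamma (1 - z)"
  have "((\<lambda>z. Gamma z * Gamma (1 - z)) has_field_derivative P * (Digamma z - Digamma (1 - z))) (at z)"
  proof -
    have "((\<lambda>z. Gamma (1 - z)) has_field_derivative Gamma (1 - z) * Digamma (1 - z) * (0 - 1)) (at z)"
      by (rule DERIV_chain2[OF has_field_derivative_Gamma[OF nz(2)] DERIV_diff[OF DERIV_const DERIV_ident]])
    from DERIV_mult[OF has_field_derivative_Gamma[OF nz(1)] this]
    show ?thesis by (simp add: P_def algebra_simps)
  qed
  moreover have "((\<lambda>z. of_real pi / sin (of_real pi * z)) has_field_derivative
      - (of_real pi / sin (of_real pi * z)) * (of_real pi * cot (of_real pi * z))) (at z)"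
  proof -
    have "((\<lambda>z. sin (of_real pi * z)) has_field_derivative cos (of_real pi * z) * (of_real pi * 1)) (at z)"
      by (rule DERIV_chain2[OF DERIV_sin DERIV_cmult[OF DERIV_ident]])
    from DERIV_divide[OF DERIV_const this s]
    show ?thesis using s by (simp add: cot_def mult_ac)
  qed
  then have "((\<lambda>z. Gamma z * Gamma (1 - z)) has_field_derivative
      - P * (of_real pi * cot (of_real pi * z))) (at z)"
    by (simp add: Gamma_reflection_complex P_def)
  ultimately have "P * (Digamma z - Digamma (1 - z)) = - P * (of_real pi * cot (of_real pi * z))"
    by (rule DERIV_unique)
  moreover have "P \<noteq> 0" using s by (simp add: P_def Gamma_reflection_complex)
  moreover have "P * (Digamma z - Digamma (1 - z) + of_real pi * cot (of_real pi * z)) =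
      P * (Digamma z - Digamma (1 - z)) + P * (of_real pi * cot (of_real pi * z))"
    by (rule distrib_left)
  ultimately have "Digamma z - Digamma (1 - z) + of_real pi * cot (of_real pi * z) = 0"
    by simp
  then have "of_real pi * cot (of_real pi * z) = - (Digamma z - Digamma (1 - z))"
    by (simp only: add_eq_0_iff)
  then show ?thesis by simp
qed

text \<open>The half-open interval splits into \<open>k = n\<close> and
  \<open>k = - (n + 1)\<close>, exactly the sums in the limit formulas for \<open>Digamma z\<close>
  and \<open>Digamma (1 - z)\<close>; the limit is half the hyperbolic cotangent of
  \<open>w / 2\<close>.\<close>

lemma symmetric_sum_inverse_tendsto:
  assumes w: "exp (w :: complex) \<noteq> 1"
  shows "(\<lambda>m. \<Sum>k = - int m..<int m. 1 / (w + 2 * of_real pi * \<i> * of_int k)) \<longlonglongrightarrow> 1 / 2 + 1 / (exp w - 1)"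
proof -
  define c where "c = 2 * of_real pi * \<i>"
  have c: "c \<noteq> 0" by (simp add: c_def)
  define z where "z = w / c"
  have wz: "w = c * z" using c by (simp add: z_def)
  have z: "z \<notin> \<int>"
  proof
    assume "z \<in> \<int>"
    then obtain n where "z = of_int n" by (auto elim: Ints_cases)
    then have "exp w = 1" unfolding wz c_def exp_eq_1 by (auto intro!: exI[of _ n])
    then show False using w by simp
  qed
  have z0: "z \<noteq> 0" "1 - z \<noteq> 0" using z by auto
  have sums: "(\<Sum>k = - int m..<int m. 1 / (z + of_int k)) =
      (\<Sum>n<m. inverse (z + of_nat n)) - (\<Sum>n<m. inverse (1 - z + of_nat n))" for m
  proof (induction m)
    case (Suc m)
    have "{- int (Suc m)..<int (Suc m)} = insert (- int (Suc m)) (insert (int m) {- int m..<int m})" by auto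
    moreover have "inverse (1 - z + of_nat m) = - (1 / (z + of_int (- int (Suc m))))"
      by (simp add: divide_inverse flip: inverse_minus_eq)
    ultimately show ?case using Suc by (simp add: divide_inverse)
  qed simp
  have "(\<lambda>m. (of_real (ln (real m)) - (\<Sum>n<m. inverse (1 - z + of_nat n))) -
             (of_real (ln (real m)) - (\<Sum>n<m. inverse (z + of_nat n)))) \<longlonglongrightarrow> Digamma (1 - z) - Digamma z"
    by (intro tendsto_diff Digamma_LIMSEQ z0)
  then have "(\<lambda>m. \<Sum>k = - int m..<int m. 1 / (z + of_int k)) \<longlonglongrightarrow> of_real pi * cot (of_real pi * z)"
    unfolding sums Digamma_reflection[OF z] by (simp add: algebra_simps)
  then have "(\<lambda>m. (1 / c) * (\<Sum>k = - int m..<int m. 1 / (z + of_int k)))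
      \<longlonglongrightarrow> (1 / c) * (of_real pi * cot (of_real pi * z))"
    by (intro tendsto_intros)
  moreover have "(1 / c) * (\<Sum>k = - int m..<int m. 1 / (z + of_int k)) =
      (\<Sum>k = - int m..<int m. 1 / (w + c * of_int k))" for m
    unfolding sum_distrib_left wz by (intro sum.cong) (auto simp: distrib_left[symmetric])
  moreover have "(1 / c) * (of_real pi * cot (of_real pi * z)) = 1 / 2 + 1 / (exp w - 1)"
  proof -
    define e where "e = exp (w / 2)"
    have ee: "exp w = e * e" by (simp add: e_def exp_add[symmetric])
    have e0: "e \<noteq> 0" by (simp add: e_def)
    have t: "\<i> * (of_real pi * z) = w / 2" by (simp add: wz c_def)
    have em: "exp (- (w / 2)) = 1 / e" by (simp add: e_def exp_minus inverse_eq_divide)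
    have s: "sin (of_real pi * z) = (e - 1 / e) / (2 * \<i>)"
      unfolding sin_exp_eq t em by (simp only: e_def)
    have co: "cos (of_real pi * z) = (e + 1 / e) / 2"
      unfolding cos_exp_eq t em by (simp only: e_def)
    have ne: "e * e - 1 \<noteq> 0" using w ee by simp
    have "cot (of_real pi * z) = \<i> * ((e + 1 / e) / (e - 1 / e))"
    proof -
      have "(A / 2) / (B / (2 * \<i>)) = \<i> * (A / B)" for A B :: complex
        by (cases "B = 0") (auto simp: field_simps)
      then show ?thesis by (simp only: cot_def s co)
    qed
    also have "(e + 1 / e) / (e - 1 / e) = (e * e + 1) / (e * e - 1)"
    proof -
      have "e + 1 / e = (e * e + 1) / e" "e - 1 / e = (e * e - 1) / e" using e0 by (simp_all add: field_simps)
      then show ?thesis using e0 by simp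
    qed
    finally have "(1 / c) * (of_real pi * cot (of_real pi * z)) = (1 / 2) * ((e * e + 1) / (e * e - 1))"
      by (simp add: c_def)
    also have "\<dots> = 1 / 2 + 1 / (e * e - 1)" using ne by (simp add: field_simps)
    finally show ?thesis by (simp add: ee)
  qed
  ultimately show ?thesis by (simp add: c_def)
qed

text \<open>An unconditional sum may be evaluated along these intervals; each simple fraction then
  contributes a constant \<open>1 / 2\<close>, and \<open>\<alpha> + \<beta> = 1\<close> cancels the
  constants.\<close>

lemma infsum_partial_fractions_translates:
  fixes x z a b \<alpha> \<beta> :: complex
  defines "F \<equiv> \<lambda>k::int. 1 / (x - z + 2 * of_real pi * \<i> * of_int k) - \<alpha> / (x - a + 2 * of_real pi * \<i> * of_int k)
     - \<beta> / (x - b + 2 * of_real pi * \<i> * of_int k)"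
  assumes s: "F summable_on UNIV" and ab: "\<alpha> + \<beta> = 1"
    and ne: "exp x \<noteq> exp z" "exp x \<noteq> exp a" "exp x \<noteq> exp b"
  shows "infsum F UNIV = 1 / (exp (x - z) - 1) - \<alpha> / (exp (x - a) - 1) - \<beta> / (exp (x - b) - 1)"
proof -
  have "filterlim (\<lambda>m. {- int m..<int m}) (finite_subsets_at_top UNIV) sequentially"
    unfolding filterlim_finite_subsets_at_top
  proof (intro allI impI)
    fix X :: "int set" assume X: "finite X \<and> X \<subseteq> UNIV"
    define N where "N = Max (insert 0 (abs ` X))"
    have N: "\<bar>k\<bar> \<le> N" if "k \<in> X" for k
      unfolding N_def using X that by (intro Max_ge) auto
    show "\<forall>\<^sub>F m in sequentially. finite {- int m..<int m} \<and> X \<subseteq> {- int m..<int m} \<and> {- int m..<int m} \<subseteq> UNIV"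
      using eventually_ge_at_top[of "nat (N + 1)"]
    proof eventually_elim
      case (elim m)
      then have m: "N < int m" by linarith
      have "X \<subseteq> {- int m..<int m}"
      proof
        fix k assume "k \<in> X"
        then show "k \<in> {- int m..<int m}" using N[of k] m by auto
      qed
      then show ?case by simp
    qed
  qed
  then have l1: "(\<lambda>m. \<Sum>k = - int m..<int m. F k) \<longlonglongrightarrow> infsum F UNIV"
    using infsum_tendsto[OF s] filterlim_compose by blast
  have e1: "exp (x - y) \<noteq> 1" if "exp x \<noteq> exp y" for y
    using that by (auto simp: exp_diff)
  have "(\<lambda>m. (\<Sum>k = - int m..<int m. 1 / (x - z + 2 * of_real pi * \<i> * of_int k))
     - \<alpha> * (\<Sum>k = - int m..<int m. 1 / (x - a + 2 * of_real pi * \<i> * of_int k))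
     - \<beta> * (\<Sum>k = - int m..<int m. 1 / (x - b + 2 * of_real pi * \<i> * of_int k)))
    \<longlonglongrightarrow> (1 / 2 + 1 / (exp (x - z) - 1)) - \<alpha> * (1 / 2 + 1 / (exp (x - a) - 1)) - \<beta> * (1 / 2 + 1 / (exp (x - b) - 1))"
    by (intro tendsto_intros symmetric_sum_inverse_tendsto e1 ne)
  then have l2: "(\<lambda>m. \<Sum>k = - int m..<int m. F k) \<longlonglongrightarrow>
    (1 / 2 + 1 / (exp (x - z) - 1)) - \<alpha> * (1 / 2 + 1 / (exp (x - a) - 1)) - \<beta> * (1 / 2 + 1 / (exp (x - b) - 1))"
    by (simp add: F_def sum_subtractf sum_distrib_left)
  have "infsum F UNIV = (1 / 2 + 1 / (exp (x - z) - 1)) - \<alpha> * (1 / 2 + 1 / (exp (x - a) - 1)) - \<beta> * (1 / 2 + 1 / (exp (x - b) - 1))"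
    by (rule LIMSEQ_unique[OF l1 l2])
  also have "\<dots> = 1 / (exp (x - z) - 1) - \<alpha> / (exp (x - a) - 1) - \<beta> / (exp (x - b) - 1) + (1 - (\<alpha> + \<beta>)) / 2"
    by (simp add: distrib_left diff_divide_distrib add_divide_distrib)
  finally show ?thesis using ab by simp
qed

section \<open>Maximum principle on unbounded domains\<close>

text \<open>Division by \<open>(z - u) ^ Suc k\<close>, with \<open>u\<close> off the closure of
  \<open>V\<close>, makes the function tend to 0 at infinity; the maximum principle on
  \<open>V \<inter> ball u R\<close> then bounds it by every \<open>e > 0\<close>.\<close>

lemma holomorphic_eq_0_if_frontier_eq_0:
  assumes V: "open V" and hol: "F holomorphic_on V" and cont: "continuous_on (closure V) F"
    and fr: "\<And>z. z \<in> frontier V \<Longrightarrow> F z = 0" and growth: "\<And>z. z \<in> V \<Longrightarrow> norm (F z) \<le> C * (1 + norm z) ^ k"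
    and u: "s > 0" "ball u s \<inter> V = {}" and z: "z \<in> V"
  shows "F z = 0"
proof -
  have C: "C \<ge> 0"
  proof (rule ccontr)
    assume "\<not> C \<ge> 0"
    then have "C * (1 + norm z) ^ k < 0" by (intro mult_neg_pos zero_less_power) (auto simp: add_pos_nonneg)
    then show False using growth[OF z] norm_ge_zero[of "F z"] by linarith
  qed
  define H where "H z = F z / (z - u) ^ Suc k" for z
  have "ball u s \<inter> closure V = {}" using u(2) by (simp add: open_Int_closure_eq_empty)
  then have far: "s \<le> dist u y" if "y \<in> closure V" for y using that by (auto simp: disjoint_iff not_less)
  then have ne: "y \<noteq> u" if "y \<in> closure V" for y using that u(1) by force
  have holH: "H holomorphic_on V"
    unfolding H_def using ne closure_subset by (intro holomorphic_intros hol) auto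
  have contH: "continuous_on (closure V) H"
    unfolding H_def using ne by (intro continuous_intros cont) auto
  define A where "A = 2 + norm u"
  have A: "A \<ge> 2" by (simp add: A_def)
  have bigH: "norm (H y) \<le> C * A ^ k / R" if y: "y \<in> V" and R: "R \<ge> 1" and ge: "dist u y \<ge> R" for y R
  proof -
    define t where "t = norm (y - u)"
    have t: "t \<ge> R" using ge by (simp add: t_def dist_norm norm_minus_commute)
    have "1 + norm y \<le> 1 + norm u + t"
      using norm_triangle_ineq[of u "y - u"] by (simp add: t_def)
    also have "\<dots> \<le> A * t"
      using t R mult_left_mono[of 1 t "1 + norm u"] by (simp add: A_def algebra_simps)
    finally have "(1 + norm y) ^ k \<le> (A * t) ^ k" by (intro power_mono) auto
    then have "norm (F y) \<le> C * (A * t) ^ k"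
      using growth[OF y] C mult_left_mono by (meson order_trans)
    then have "norm (H y) \<le> C * (A * t) ^ k / t ^ Suc k"
      unfolding H_def norm_divide norm_power t_def[symmetric] using t R by (intro divide_right_mono) auto
    also have "\<dots> = C * A ^ k / t" using t R by (simp add: power_mult_distrib)
    also have "\<dots> \<le> C * A ^ k / R" using t R C A by (intro divide_left_mono) auto
    finally show ?thesis .
  qed
  have le: "norm (H z) \<le> e" if e: "e > 0" for e
  proof -
    define R where "R = max (max 1 (C * A ^ k / e)) (dist u z + 1)"
    have R: "R \<ge> 1" "C * A ^ k / R \<le> e"  "z \<in> ball u R"
    proof -
      show "R \<ge> 1" by (simp add: R_def)
      have "C * A ^ k / e \<le> R" by (simp add: R_def)
      then show "C * A ^ k / R \<le> e" using e \<open>R \<ge> 1\<close> by (simp add: field_simps)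
      show "z \<in> ball u R" by (auto simp: R_def)
    qed
    define W where "W = V \<inter> ball u R"
    have clW: "closure W \<subseteq> closure V \<inter> cball u R"
      unfolding W_def by (intro closure_minimal) (use closure_subset in \<open>auto simp: less_imp_le\<close>)
    show ?thesis
    proof (rule maximum_modulus_frontier[of H W])
      show "H holomorphic_on interior W" using holH by (rule holomorphic_on_subset) (use interior_subset W_def in auto)
      show "continuous_on (closure W) H" by (rule continuous_on_subset[OF contH]) (use clW in auto)
      show "bounded W" by (simp add: W_def bounded_Int)
      show "z \<in> W" using z R by (simp add: W_def)
      fix y assume y: "y \<in> frontier W"
      then have ycl: "y \<in> closure V" "y \<in> cball u R" and yW: "y \<notin> W"
        using clW V by (auto simp: frontier_def W_def interior_open)
      show "norm (H y) \<le> e"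
      proof (cases "y \<in> V")
        case True
        then have "dist u y \<ge> R" using yW by (auto simp: W_def)
        then show ?thesis using bigH[OF True R(1)] R(2) by linarith
      next
        case False
        then have "y \<in> frontier V" using ycl V by (simp add: frontier_def interior_open)
        then show ?thesis using fr e by (simp add: H_def)
      qed
    qed
  qed
  have "norm (H z) \<le> 0" using le by (meson dense_ge)
  then have "H z = 0" by simp
  then show ?thesis using ne[of z] z closure_subset[of V] by (auto simp: H_def)
qed

text \<open>The cross product of the rows works unless they are parallel.\<close>

lemma exists_nontrivial_solution_2x3:
  fixes u1 u2 u3 w1 w2 w3 :: complex
  obtains a1 a2 a3 where "a1 \<noteq> 0 \<or> a2 \<noteq> 0 \<or> a3 \<noteq> 0"
    "a1 * u1 + a2 * u2 + a3 * u3 = 0" "a1 * w1 + a2 * w2 + a3 * w3 = 0"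
proof (cases "u2 * w3 - u3 * w2 \<noteq> 0 \<or> u3 * w1 - u1 * w3 \<noteq> 0 \<or> u1 * w2 - u2 * w1 \<noteq> 0")
  case True
  then show ?thesis by (intro that[of "u2 * w3 - u3 * w2" "u3 * w1 - u1 * w3" "u1 * w2 - u2 * w1"])
      (auto simp: algebra_simps)
next
  case False
  then have par: "u2 * w3 = u3 * w2" "u3 * w1 = u1 * w3" "u1 * w2 = u2 * w1" by auto
  consider "u1 \<noteq> 0" | "u1 = 0" "w1 \<noteq> 0" | "u1 = 0" "w1 = 0" by blast
  then show ?thesis
  proof cases
    case 1
    then show ?thesis using par by (intro that[of "- u2" u1 0]) (auto simp: algebra_simps)
  next
    case 2
    then show ?thesis using par by (intro that[of "- w2" w1 0]) (auto simp: algebra_simps)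
  next
    case 3
    then show ?thesis by (intro that[of 1 0 0]) auto
  qed
qed

section \<open>Sums over the centres of disjoint discs\<close>

text \<open>
  The Cauchy kernel \<open>1 / (x - z)\<close>, corrected by an affine function of \<open>z\<close> so that it vanishes for
  \<open>z = \<kappa>\<close> and \<open>z = b\<close> and decays like \<open>1 / x^3\<close>.
\<close>

definition kernel :: "complex \<Rightarrow> complex \<Rightarrow> complex \<Rightarrow> complex \<Rightarrow> complex" where
  "kernel \<kappa> b z x = (z - \<kappa>) * (z - b) / ((x - z) * (x - \<kappa>) * (x - b))"

lemma sum_eq_if_disjoint_union:
  "finite F \<Longrightarrow> F = A \<union> B \<Longrightarrow> A \<inter> B = {} \<Longrightarrow> sum g F = sum g A + sum g B"
  by (simp add: sum.union_disjoint)

text \<open>\<open>\<omega> x\<close> is a mass at the centre \<open>x\<close>; its bound by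
  \<open>(\<rho> x)\<^sup>2\<close> lets the areas of disjoint discs control all sums.
  \<open>\<kappa>\<close> and \<open>b\<close> are the zeros of the kernel.\<close>

locale disc_packing =
  fixes G :: "complex set" and \<rho> :: "complex \<Rightarrow> real" and \<omega> :: "complex \<Rightarrow> complex"
    and \<kappa> b :: complex and s C :: real
  assumes \<rho>_pos: "\<And>x. x \<in> G \<Longrightarrow> 0 < \<rho> x"
    and disj: "\<And>x y. x \<in> G \<Longrightarrow> y \<in> G \<Longrightarrow> x \<noteq> y \<Longrightarrow> ball x (\<rho> x) \<inter> ball y (\<rho> y) = {}"
    and s_pos: "0 < s" and \<kappa>_far: "\<And>x. x \<in> G \<Longrightarrow> s \<le> dist x \<kappa>" and b_far: "\<And>x. x \<in> G \<Longrightarrow> s \<le> dist x b"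
    and \<kappa>_outside: "\<And>x. x \<in> G \<Longrightarrow> \<rho> x \<le> dist x \<kappa>"
    and \<omega>_le: "\<And>x. x \<in> G \<Longrightarrow> norm (\<omega> x) \<le> C * (\<rho> x)\<^sup>2" and C_nonneg: "0 \<le> C"
begin

abbreviation "wk z x \<equiv> \<omega> x * kernel \<kappa> b z x"

definition outside_discs :: "complex set" where
  "outside_discs = {z. \<forall>x\<in>G. \<rho> x \<le> dist x z}"

text \<open>A disc that omits \<open>z\<close> but has its centre within \<open>\<eta>\<close> of it
  has radius below \<open>\<eta>\<close>, so these disjoint discs fit into
  \<open>ball z (2 * \<eta>)\<close>; compare areas.\<close>

lemma sum_radii_squared_le:
  assumes F: "finite F" "F \<subseteq> G" and z: "z \<in> outside_discs"
    and near: "\<And>x. x \<in> F \<Longrightarrow> dist x z < \<eta>" and \<eta>: "0 < \<eta>"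
  shows "(\<Sum>x\<in>F. (\<rho> x)\<^sup>2) \<le> 4 * \<eta>\<^sup>2"
proof -
  define m where "m = measure lborel (ball (0::complex) 1)"
  have m: "m > 0" unfolding m_def by (rule content_ball_pos) simp
  have mb: "measure lborel (ball c r) = r\<^sup>2 * m" if "r \<ge> 0" for c :: complex and r
    using content_ball_conv_unit_ball[OF that, of c] by (simp add: m_def)
  have "(\<Sum>x\<in>F. measure lborel (ball x (\<rho> x))) = measure lborel (\<Union>x\<in>F. ball x (\<rho> x))"
  proof (rule measure_finite_Union[symmetric])
    show "disjoint_family_on (\<lambda>x. ball x (\<rho> x)) F"
      using F disj by (auto simp: disjoint_family_on_def)
    show "emeasure lborel (ball x (\<rho> x)) \<noteq> \<infinity>" for x
      using emeasure_lborel_ball_finite[of x "\<rho> x"] by simp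
  qed (use F in auto)
  also have "\<dots> \<le> measure lborel (ball z (2 * \<eta>))"
  proof (rule measure_mono_fmeasurable)
    show "(\<Union>x\<in>F. ball x (\<rho> x)) \<subseteq> ball z (2 * \<eta>)"
    proof
      fix y assume "y \<in> (\<Union>x\<in>F. ball x (\<rho> x))"
      then obtain x where x: "x \<in> F" "dist x y < \<rho> x" by auto
      have "\<rho> x \<le> dist x z" using z x(1) F by (auto simp: outside_discs_def)
      then show "y \<in> ball z (2 * \<eta>)"
        using near[OF x(1)] x(2) dist_triangle[of z y x] by (simp add: dist_commute)
    qed
    show "ball z (2 * \<eta>) \<in> fmeasurable lborel"
      using emeasure_lborel_ball_finite[of z "2 * \<eta>"] by (simp add: fmeasurable_def)
  qed (auto intro!: borel_open open_UN)
  finally have "(\<Sum>x\<in>F. (\<rho> x)\<^sup>2) * m \<le> (4 * \<eta>\<^sup>2) * m"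
    using F \<rho>_pos \<eta> by (simp add: mb less_imp_le subset_iff sum_distrib_right power_mult_distrib)
  then show ?thesis using m by simp
qed

text \<open>Dyadic annuli around \<open>z\<close>: the outermost contributes at most
  \<open>4 * \<eta>\<^sup>2 * (2 / \<eta>) = 8 * \<eta>\<close>, and the bounds halve
  inwards.\<close>

lemma sum_near_le:
  assumes F: "finite F" "F \<subseteq> G" and z: "z \<in> outside_discs"
    and near: "\<And>x. x \<in> F \<Longrightarrow> dist x z < \<eta>" and \<eta>: "0 < \<eta>"
  shows "(\<Sum>x\<in>F. (\<rho> x)\<^sup>2 / dist x z) \<le> 16 * \<eta>"
proof -
  have dyadic: "(\<Sum>x\<in>F. (\<rho> x)\<^sup>2 / dist x z) \<le> 16 * \<eta>"
    if "finite F" "F \<subseteq> G" "\<And>x. x \<in> F \<Longrightarrow> dist x z < \<eta>" "\<And>x. x \<in> F \<Longrightarrow> \<eta> / 2 ^ J \<le> dist x z" "0 < \<eta>"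
    for J F \<eta> using that
  proof (induction J arbitrary: F \<eta>)
    case 0
    then have "F = {}" by force
    then show ?case using 0 by simp
  next
    case (Suc J)
    define A where "A = {x \<in> F. \<eta> / 2 \<le> dist x z}"
    define B where "B = {x \<in> F. dist x z < \<eta> / 2}"
    have "(\<Sum>x\<in>B. (\<rho> x)\<^sup>2 / dist x z) \<le> 16 * (\<eta> / 2)"
      by (rule Suc.IH) (use Suc.prems in \<open>auto simp: B_def\<close>)
    moreover have "(\<Sum>x\<in>A. (\<rho> x)\<^sup>2 / dist x z) \<le> (\<Sum>x\<in>A. (\<rho> x)\<^sup>2 * (2 / \<eta>))"
    proof (rule sum_mono)
      fix x assume "x \<in> A"
      then have "1 / dist x z \<le> 1 / (\<eta> / 2)"
        using Suc.prems(5) by (intro divide_left_mono) (auto simp: A_def intro!: mult_pos_pos)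
      then have "1 / dist x z \<le> 2 / \<eta>" by simp
      then show "(\<rho> x)\<^sup>2 / dist x z \<le> (\<rho> x)\<^sup>2 * (2 / \<eta>)"
        using mult_left_mono[of "1 / dist x z" "2 / \<eta>" "(\<rho> x)\<^sup>2"] by simp
    qed
    moreover have "(\<Sum>x\<in>A. (\<rho> x)\<^sup>2 * (2 / \<eta>)) \<le> 4 * \<eta>\<^sup>2 * (2 / \<eta>)"
      unfolding sum_distrib_right[symmetric]
      by (intro mult_right_mono sum_radii_squared_le[OF _ _ z]) (use Suc.prems in \<open>auto simp: A_def\<close>)
    moreover have "4 * \<eta>\<^sup>2 * (2 / \<eta>) = 8 * \<eta>" using Suc.prems(5) by (simp add: power2_eq_square)
    moreover have "F = A \<union> B" "A \<inter> B = {}" by (auto simp: A_def B_def)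
    then have "(\<Sum>x\<in>F. (\<rho> x)\<^sup>2 / dist x z) = (\<Sum>x\<in>A. (\<rho> x)\<^sup>2 / dist x z) + (\<Sum>x\<in>B. (\<rho> x)\<^sup>2 / dist x z)"
      by (rule sum_eq_if_disjoint_union[OF Suc.prems(1)])
    ultimately show ?case by linarith
  qed
  have pos: "dist x z > 0" if "x \<in> F" for x
    using that F z \<rho>_pos[of x] by (force simp: outside_discs_def)
  have "\<exists>J. \<forall>x\<in>F. \<eta> / 2 ^ J \<le> dist x z"
    using F(1) pos
  proof (induction F rule: finite_induct)
    case (insert y F)
    then obtain J where J: "\<And>x. x \<in> F \<Longrightarrow> \<eta> / 2 ^ J \<le> dist x z" by auto
    have "\<eta> / dist y z > 0" using insert.prems[of y] \<eta> by simp
    obtain K where K: "\<eta> / dist y z < 2 ^ K" using real_arch_pow[of 2 "\<eta> / dist y z"] by auto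
    have mono: "\<eta> / 2 ^ (J + K) \<le> \<eta> / 2 ^ J" "\<eta> / 2 ^ (J + K) \<le> \<eta> / 2 ^ K"
      using \<eta> by (auto intro!: divide_left_mono power_increasing)
    have "\<eta> / 2 ^ K \<le> dist y z" using K insert.prems[of y] by (simp add: field_simps)
    then show ?case using J mono by (intro exI[of _ "J + K"]) (auto intro: order_trans)
  qed auto
  then obtain J where "\<forall>x\<in>F. \<eta> / 2 ^ J \<le> dist x z" by blast
  then show ?thesis using dyadic[OF F near _ \<eta>] by blast
qed

text \<open>Dominates the summand away from \<open>z\<close> up to a factor: mass times the cubic
  decay of the kernel.\<close>

definition \<sigma> :: "complex \<Rightarrow> real" where "\<sigma> x = (\<rho> x)\<^sup>2 / dist x \<kappa> ^ 3"

lemma \<kappa>_outside_discs: "\<kappa> \<in> outside_discs"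
  using \<kappa>_outside by (simp add: outside_discs_def)

lemma \<sigma>_nonneg: "\<sigma> x \<ge> 0"
  by (simp add: \<sigma>_def)

text \<open>Dyadic annuli outwards from \<open>\<kappa>\<close>: the one between \<open>R\<close>
  and \<open>2 * R\<close> contributes at most \<open>16 / R\<close>.\<close>

lemma sum_\<sigma>_le:
  assumes F: "finite F" "F \<subseteq> G"
  shows "sum \<sigma> F \<le> 32 / s"
proof -
  have dyadic: "sum \<sigma> F \<le> 32 / R"
    if "finite F" "F \<subseteq> G" "\<And>x. x \<in> F \<Longrightarrow> R \<le> dist x \<kappa>" "\<And>x. x \<in> F \<Longrightarrow> dist x \<kappa> < R * 2 ^ J" "0 < R"
    for J F R using that
  proof (induction J arbitrary: F R)
    case 0
    then have "F = {}" by force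
    then show ?case using 0 by simp
  next
    case (Suc J)
    define A where "A = {x \<in> F. dist x \<kappa> < 2 * R}"
    define B where "B = {x \<in> F. 2 * R \<le> dist x \<kappa>}"
    have "sum \<sigma> B \<le> 32 / (2 * R)"
      by (rule Suc.IH) (use Suc.prems in \<open>auto simp: B_def mult.assoc mult.left_commute\<close>)
    moreover have "sum \<sigma> A \<le> (\<Sum>x\<in>A. (\<rho> x)\<^sup>2 * (1 / R ^ 3))"
    proof (rule sum_mono)
      fix x assume "x \<in> A"
      then have "R ^ 3 \<le> dist x \<kappa> ^ 3" using Suc.prems by (intro power_mono) (auto simp: A_def)
      then show "\<sigma> x \<le> (\<rho> x)\<^sup>2 * (1 / R ^ 3)"
        using Suc.prems(5) by (simp add: \<sigma>_def frac_le)
    qed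
    moreover have "(\<Sum>x\<in>A. (\<rho> x)\<^sup>2 * (1 / R ^ 3)) \<le> 4 * (2 * R)\<^sup>2 * (1 / R ^ 3)"
      unfolding sum_distrib_right[symmetric]
      by (intro mult_right_mono sum_radii_squared_le[OF _ _ \<kappa>_outside_discs]) (use Suc.prems in \<open>auto simp: A_def\<close>)
    moreover have "4 * (2 * R)\<^sup>2 * (1 / R ^ 3) = 16 / R"
      using Suc.prems(5) by (simp add: power2_eq_square power3_eq_cube)
    moreover have "F = A \<union> B" "A \<inter> B = {}" by (auto simp: A_def B_def)
    then have "sum \<sigma> F = sum \<sigma> A + sum \<sigma> B"
      by (rule sum_eq_if_disjoint_union[OF Suc.prems(1)])
    moreover have "32 / (2 * R) = 16 / R" "16 / R + 16 / R = 32 / R" by simp_all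
    ultimately show ?case by linarith
  qed
  have "\<exists>J. \<forall>x\<in>F. dist x \<kappa> < s * 2 ^ J"
    using F(1)
  proof (induction F rule: finite_induct)
    case (insert y F)
    then obtain J where J: "\<And>x. x \<in> F \<Longrightarrow> dist x \<kappa> < s * 2 ^ J" by auto
    obtain K where K: "dist y \<kappa> / s < 2 ^ K" using real_arch_pow[of 2 "dist y \<kappa> / s"] by auto
    have mono: "s * 2 ^ J \<le> s * 2 ^ (J + K)" "s * 2 ^ K \<le> s * 2 ^ (J + K)"
      using s_pos by (auto intro!: mult_left_mono power_increasing)
    have "dist y \<kappa> < s * 2 ^ K" using K s_pos by (simp add: field_simps)
    then show ?case using J mono by (intro exI[of _ "J + K"]) (auto intro: less_le_trans)
  qed auto
  then obtain J where "\<forall>x\<in>F. dist x \<kappa> < s * 2 ^ J" by blast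
  then show ?thesis using dyadic[OF F _ _ s_pos] F \<kappa>_far by blast
qed

lemma \<sigma>_summable: "\<sigma> summable_on G"
  by (rule nonneg_bdd_above_summable_on)
     (use \<sigma>_nonneg sum_\<sigma>_le in \<open>auto intro!: bdd_aboveI[of _ "32 / s"]\<close>)

definition b_const :: real where "b_const = 1 + dist b \<kappa> / s"

lemma b_const_pos: "b_const > 0"
  using s_pos by (simp add: b_const_def add_pos_nonneg)

lemma norm_kernel_near:
  assumes "x \<in> G"
  shows "norm (kernel \<kappa> b z x) \<le> (dist z \<kappa> * dist z b / s\<^sup>2) / dist x z"
proof -
  have "norm (kernel \<kappa> b z x) = (dist z \<kappa> * dist z b) / (dist x z * (dist x \<kappa> * dist x b))"
    by (simp add: kernel_def norm_divide norm_mult dist_norm mult.assoc)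
  also have "\<dots> = (dist z \<kappa> * dist z b) / (dist x \<kappa> * dist x b) / dist x z" by (simp add: mult.commute)
  also have "\<dots> \<le> (dist z \<kappa> * dist z b) / (s * s) / dist x z"
    using \<kappa>_far[OF assms] b_far[OF assms] s_pos
    by (intro divide_right_mono divide_left_mono mult_mono mult_pos_pos mult_nonneg_nonneg) auto
  finally show ?thesis by (simp add: power2_eq_square)
qed

lemma norm_kernel_far:
  assumes x: "x \<in> G" and \<eta>: "0 < \<eta>" "\<eta> \<le> dist x z"
  shows "norm (kernel \<kappa> b z x) \<le> (dist z \<kappa> * dist z b) * ((1 + dist z \<kappa> / \<eta>) * b_const) / dist x \<kappa> ^ 3"
proof -
  define X Y Z where "X = dist x \<kappa>" and "Y = dist x b" and "Z = dist x z"
  have X: "X \<ge> s" "X > 0" and Y: "Y \<ge> s" "Y > 0" and Z: "Z \<ge> \<eta>" "Z > 0"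
    using \<kappa>_far[OF x] b_far[OF x] s_pos \<eta> by (auto simp: X_def Y_def Z_def)
  have "X \<le> Z + dist z \<kappa>" unfolding X_def Z_def by (rule dist_triangle)
  also have "\<dots> \<le> Z + Z * (dist z \<kappa> / \<eta>)"
    using Z \<eta> mult_right_mono[of \<eta> Z "dist z \<kappa> / \<eta>"] by simp
  finally have XZ: "X \<le> Z * (1 + dist z \<kappa> / \<eta>)" by (simp add: algebra_simps)
  have "X \<le> Y + dist b \<kappa>" unfolding X_def Y_def by (rule dist_triangle)
  also have "\<dots> \<le> Y + Y * (dist b \<kappa> / s)"
    using Y s_pos mult_right_mono[of s Y "dist b \<kappa> / s"] by simp
  finally have XY: "X \<le> Y * b_const" by (simp add: algebra_simps b_const_def)
  have "X * X \<le> (Z * (1 + dist z \<kappa> / \<eta>)) * (Y * b_const)"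
    using XZ XY X by (intro mult_mono) auto
  define W where "W = (1 + dist z \<kappa> / \<eta>) * b_const"
  have "X * X \<le> (Z * Y) * W"
    using \<open>X * X \<le> (Z * (1 + dist z \<kappa> / \<eta>)) * (Y * b_const)\<close> by (simp add: W_def mult_ac)
  then have "(X * X) / ((Z * Y) * X ^ 3) \<le> ((Z * Y) * W) / ((Z * Y) * X ^ 3)"
    using X Y Z by (intro divide_right_mono) auto
  moreover have "(X * X) / ((Z * Y) * X ^ 3) = 1 / (Z * X * Y)"
    using X Y Z by (simp add: power3_eq_cube)
  moreover have "((Z * Y) * W) / ((Z * Y) * X ^ 3) = W / X ^ 3" using Y Z by simp
  ultimately have "1 / (Z * X * Y) \<le> ((1 + dist z \<kappa> / \<eta>) * b_const) / X ^ 3" by (simp add: W_def)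
  then have "(dist z \<kappa> * dist z b) * (1 / (Z * X * Y)) \<le> (dist z \<kappa> * dist z b) * (((1 + dist z \<kappa> / \<eta>) * b_const) / X ^ 3)"
    by (intro mult_left_mono) auto
  moreover have "norm (kernel \<kappa> b z x) = (dist z \<kappa> * dist z b) * (1 / (Z * X * Y))"
    by (simp add: kernel_def norm_divide norm_mult dist_norm X_def Y_def Z_def)
  ultimately show ?thesis by (simp add: X_def)
qed

text \<open>The cut \<open>\<eta>\<close> is left free: \<open>\<eta> = 1\<close> gives absolute
  convergence, and for uniform convergence it is made small before the sum of
  \<open>\<sigma>\<close> is.\<close>

lemma sum_kernel_le:
  assumes F: "finite F" "F \<subseteq> G" and z: "z \<in> outside_discs" and \<eta>: "0 < \<eta>"
  shows "(\<Sum>x\<in>F. norm (wk z x)) \<le>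
    C * (dist z \<kappa> * dist z b) * (16 * \<eta> / s\<^sup>2 + (1 + dist z \<kappa> / \<eta>) * b_const * sum \<sigma> F)"
proof -
  define P where "P = dist z \<kappa> * dist z b"
  have P: "P \<ge> 0" by (simp add: P_def)
  define A where "A = {x \<in> F. dist x z < \<eta>}"
  define B where "B = {x \<in> F. \<eta> \<le> dist x z}"
  have "(\<Sum>x\<in>A. norm (wk z x)) \<le> (\<Sum>x\<in>A. (C * P / s\<^sup>2) * ((\<rho> x)\<^sup>2 / dist x z))"
  proof (rule sum_mono)
    fix x assume "x \<in> A"
    then have x: "x \<in> G" using F by (auto simp: A_def)
    have "norm (wk z x) \<le> (C * (\<rho> x)\<^sup>2) * ((P / s\<^sup>2) / dist x z)"
      unfolding norm_mult P_def using \<omega>_le[OF x] norm_kernel_near[OF x] C_nonneg by (intro mult_mono) auto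
    then show "norm (wk z x) \<le> (C * P / s\<^sup>2) * ((\<rho> x)\<^sup>2 / dist x z)"
      by (simp add: mult_ac)
  qed
  also have "\<dots> \<le> (C * P / s\<^sup>2) * (16 * \<eta>)"
    unfolding sum_distrib_left[symmetric]
    by (intro mult_left_mono sum_near_le[OF _ _ z]) (use F \<eta> C_nonneg P in \<open>auto simp: A_def\<close>)
  finally have 1: "(\<Sum>x\<in>A. norm (wk z x)) \<le> C * P * (16 * \<eta> / s\<^sup>2)" by simp
  have "(\<Sum>x\<in>B. norm (wk z x)) \<le> (\<Sum>x\<in>B. (C * P * ((1 + dist z \<kappa> / \<eta>) * b_const)) * \<sigma> x)"
  proof (rule sum_mono)
    fix x assume "x \<in> B"
    then have x: "x \<in> G" "\<eta> \<le> dist x z" using F by (auto simp: B_def)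
    have "norm (wk z x) \<le> (C * (\<rho> x)\<^sup>2) * (P * ((1 + dist z \<kappa> / \<eta>) * b_const) / dist x \<kappa> ^ 3)"
      unfolding norm_mult P_def using \<omega>_le[OF x(1)] norm_kernel_far[OF x(1) \<eta> x(2)] C_nonneg
      by (intro mult_mono) auto
    then show "norm (wk z x) \<le> (C * P * ((1 + dist z \<kappa> / \<eta>) * b_const)) * \<sigma> x"
      by (simp add: \<sigma>_def mult_ac)
  qed
  also have "\<dots> \<le> (C * P * ((1 + dist z \<kappa> / \<eta>) * b_const)) * sum \<sigma> F"
    unfolding sum_distrib_left[symmetric]
    using F C_nonneg P b_const_pos \<eta> \<sigma>_nonneg
    by (intro mult_left_mono sum_mono2 mult_nonneg_nonneg add_nonneg_nonneg) (auto simp: B_def)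
  finally have 2: "(\<Sum>x\<in>B. norm (wk z x)) \<le> C * P * ((1 + dist z \<kappa> / \<eta>) * b_const * sum \<sigma> F)"
    by (simp add: mult_ac)
  have "F = A \<union> B" "A \<inter> B = {}" by (auto simp: A_def B_def)
  then have "(\<Sum>x\<in>F. norm (wk z x)) =
      (\<Sum>x\<in>A. norm (wk z x)) + (\<Sum>x\<in>B. norm (wk z x))"
    by (rule sum_eq_if_disjoint_union[OF F(1)])
  then show ?thesis using 1 2 unfolding P_def by (simp add: distrib_left)
qed

definition v :: "complex \<Rightarrow> complex" where
  "v z = (\<Sum>\<^sub>\<infinity>x\<in>G. wk z x)"

lemma abs_summable_kernel:
  assumes z: "z \<in> outside_discs"
  shows "(\<lambda>x. norm (wk z x)) summable_on G"
proof (rule nonneg_bdd_above_summable_on)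
  define M where "M = C * (dist z \<kappa> * dist z b) * (16 * 1 / s\<^sup>2 + (1 + dist z \<kappa> / 1) * b_const * (32 / s))"
  show "bdd_above (sum (\<lambda>x. norm (wk z x)) ` {F. F \<subseteq> G \<and> finite F})"
  proof (rule bdd_aboveI2)
    fix F assume "F \<in> {F. F \<subseteq> G \<and> finite F}"
    then have F: "finite F" "F \<subseteq> G" by auto
    have "(\<Sum>x\<in>F. norm (wk z x)) \<le>
      C * (dist z \<kappa> * dist z b) * (16 * 1 / s\<^sup>2 + (1 + dist z \<kappa> / 1) * b_const * sum \<sigma> F)"
      by (rule sum_kernel_le[OF F z]) simp
    also have "\<dots> \<le> M"
      unfolding M_def using sum_\<sigma>_le[OF F] C_nonneg b_const_pos
      by (intro mult_left_mono add_left_mono mult_nonneg_nonneg add_nonneg_nonneg) auto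
    finally show "(\<Sum>x\<in>F. norm (wk z x)) \<le> M" .
  qed
qed simp

lemma summable_kernel: "z \<in> outside_discs \<Longrightarrow> (\<lambda>x. wk z x) summable_on G"
  by (rule abs_summable_summable[OF abs_summable_kernel])

lemma norm_v_le:
  assumes z: "z \<in> outside_discs"
  shows "norm (v z) \<le> C * (dist z \<kappa> * dist z b) * (16 / s\<^sup>2 + (1 + dist z \<kappa>) * b_const * (32 / s))"
    (is "_ \<le> ?M")
proof -
  have "norm (v z) \<le> (\<Sum>\<^sub>\<infinity>x\<in>G. norm (wk z x))"
    unfolding v_def by (rule norm_infsum_bound[OF abs_summable_kernel[OF z]])
  also have "\<dots> \<le> ?M"
  proof (rule infsum_le_finite_sums[OF abs_summable_kernel[OF z]])
    fix F assume F: "finite F" "F \<subseteq> G"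
    have "(\<Sum>x\<in>F. norm (wk z x)) \<le>
      C * (dist z \<kappa> * dist z b) * (16 * 1 / s\<^sup>2 + (1 + dist z \<kappa> / 1) * b_const * sum \<sigma> F)"
      by (rule sum_kernel_le[OF F z]) simp
    also have "\<dots> \<le> C * (dist z \<kappa> * dist z b) * (16 * 1 / s\<^sup>2 + (1 + dist z \<kappa> / 1) * b_const * (32 / s))"
      using sum_\<sigma>_le[OF F] C_nonneg b_const_pos
      by (intro mult_left_mono add_left_mono mult_nonneg_nonneg add_nonneg_nonneg) auto
    finally show "(\<Sum>x\<in>F. norm (wk z x)) \<le> ?M" by simp
  qed
  finally show ?thesis .
qed

lemma v_growth: "\<exists>K. \<forall>z\<in>outside_discs. norm (v z) \<le> K * (1 + norm z) ^ 3"
proof -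
  define a where "a = 1 + norm \<kappa> + norm b"
  have a1: "a \<ge> 1" by (simp add: a_def)
  have d: "dist z \<kappa> \<le> a * (1 + norm z)" "dist z b \<le> a * (1 + norm z)" "1 + dist z \<kappa> \<le> a * (1 + norm z)" for z
  proof -
    have "a * (1 + norm z) \<ge> a + norm z" using mult_right_mono[OF a1, of "norm z"] by (simp add: algebra_simps)
    then show "dist z \<kappa> \<le> a * (1 + norm z)" "dist z b \<le> a * (1 + norm z)" "1 + dist z \<kappa> \<le> a * (1 + norm z)"
      using norm_triangle_ineq4[of z \<kappa>] norm_triangle_ineq4[of z b] norm_ge_zero[of b] norm_ge_zero[of \<kappa>]
      unfolding dist_norm a_def by linarith+
  qed
  define B where "B = 16 / s\<^sup>2 + b_const * (32 / s)"
  have B: "B \<ge> 0" using b_const_pos s_pos by (simp add: B_def)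
  have "norm (v z) \<le> (C * a ^ 3 * B) * (1 + norm z) ^ 3" if z: "z \<in> outside_discs" for z
  proof -
    define t where "t = a * (1 + norm z)"
    have t1: "t \<ge> 1" using a1 mult_mono[of 1 a 1 "1 + norm z"] by (simp add: t_def)
    have "16 / s\<^sup>2 \<le> t * (16 / s\<^sup>2)" using t1 s_pos mult_right_mono[of 1 t "16 / s\<^sup>2"] by simp
    moreover have "(1 + dist z \<kappa>) * b_const * (32 / s) \<le> t * b_const * (32 / s)"
      using d(3)[of z] b_const_pos s_pos by (intro mult_right_mono) (auto simp: t_def)
    ultimately have 1: "16 / s\<^sup>2 + (1 + dist z \<kappa>) * b_const * (32 / s) \<le> t * B"
      by (simp add: B_def distrib_left mult.assoc)
    have "norm (v z) \<le> C * (dist z \<kappa> * dist z b) * (16 / s\<^sup>2 + (1 + dist z \<kappa>) * b_const * (32 / s))"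
      by (rule norm_v_le[OF z])
    also have "\<dots> \<le> C * (t * t) * (t * B)"
      using d[of z] 1 C_nonneg b_const_pos s_pos t1 unfolding t_def[symmetric]
      by (intro mult_mono mult_nonneg_nonneg add_nonneg_nonneg) auto
    also have "\<dots> = (C * a ^ 3 * B) * (1 + norm z) ^ 3"
      unfolding t_def by (simp add: power3_eq_cube mult_ac)
    finally show ?thesis .
  qed
  then show ?thesis by blast
qed

lemma uniform_limit_v:
  assumes S: "S \<subseteq> outside_discs" "bounded S"
  shows "uniform_limit S (\<lambda>F z. \<Sum>x\<in>F. wk z x) v (finite_subsets_at_top G)"
proof (rule uniform_limitI)
  fix e :: real assume e: "e > 0"
  obtain M0 where M0: "\<And>z. z \<in> S \<Longrightarrow> norm z \<le> M0" using S(2) by (auto simp: bounded_iff)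
  define M where "M = 1 + \<bar>M0\<bar> + norm \<kappa> + norm b"
  have M: "M > 0" by (simp add: M_def add_pos_nonneg)
  have dM: "dist z \<kappa> \<le> M" "dist z b \<le> M" if "z \<in> S" for z
    using M0[OF that] norm_triangle_ineq4[of z \<kappa>] norm_triangle_ineq4[of z b] norm_ge_zero[of b] norm_ge_zero[of \<kappa>]
    unfolding dist_norm M_def by linarith+
  define c where "c = (C + 1) * (M * M)"
  have c: "c > 0" using C_nonneg M by (simp add: c_def)
  \<comment> \<open>\<open>\<eta>\<close>, and then \<open>\<epsilon>\<close>, let the near and the
    far part of a tail contribute at most \<open>e / 4\<close> each.\<close>
  define \<eta> where "\<eta> = e * s\<^sup>2 / (64 * c)"
  have \<eta>: "\<eta> > 0" using e s_pos c by (simp add: \<eta>_def)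
  have c\<eta>: "c * (16 * \<eta> / s\<^sup>2) = e / 4" using c s_pos by (simp add: \<eta>_def field_simps)
  define L where "L = (1 + M / \<eta>) * b_const"
  have L: "L > 0" using M \<eta> b_const_pos by (simp add: L_def add_pos_pos)
  define \<epsilon> where "\<epsilon> = e / (4 * c * L)"
  have \<epsilon>: "\<epsilon> > 0" using e c L by (simp add: \<epsilon>_def)
  have "(sum \<sigma> \<longlongrightarrow> infsum \<sigma> G) (finite_subsets_at_top G)" by (rule infsum_tendsto[OF \<sigma>_summable])
  then have "\<forall>\<^sub>F F in finite_subsets_at_top G. dist (sum \<sigma> F) (infsum \<sigma> G) < \<epsilon>"
    by (rule tendstoD[OF _ \<epsilon>])
  then obtain F0 where F0: "finite F0" "F0 \<subseteq> G"
    "\<And>F. finite F \<Longrightarrow> F0 \<subseteq> F \<Longrightarrow> F \<subseteq> G \<Longrightarrow> dist (sum \<sigma> F) (infsum \<sigma> G) < \<epsilon>"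
    unfolding eventually_finite_subsets_at_top by metis
  have tail: "sum \<sigma> F \<le> \<epsilon>" if F: "finite F" "F \<subseteq> G - F0" for F
  proof -
    have "sum \<sigma> F0 + sum \<sigma> F = sum \<sigma> (F0 \<union> F)" using F F0(1) by (intro sum.union_disjoint[symmetric]) auto
    also have "\<dots> \<le> infsum \<sigma> G"
      by (rule finite_sum_le_infsum[OF \<sigma>_summable]) (use F F0 \<sigma>_nonneg in auto)
    finally have "sum \<sigma> F \<le> infsum \<sigma> G - sum \<sigma> F0" by simp
    then show ?thesis using F0(3)[OF F0(1) subset_refl F0(2)] by (simp add: dist_real_def abs_if split: if_splits)
  qed
  have "norm ((\<Sum>x\<in>F. wk z x) - v z) \<le> e / 2"
    if F: "finite F" "F0 \<subseteq> F" "F \<subseteq> G" and z: "z \<in> S" for F z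
  proof -
    have zo: "z \<in> outside_discs" using z S by blast
    have "((\<lambda>F'. \<Sum>x\<in>F'. wk z x) \<longlongrightarrow> v z) (finite_subsets_at_top G)"
      unfolding v_def by (rule infsum_tendsto[OF summable_kernel[OF zo]])
    then have lim: "((\<lambda>F'. norm ((\<Sum>x\<in>F. wk z x) - (\<Sum>x\<in>F'. wk z x))) \<longlongrightarrow>
        norm ((\<Sum>x\<in>F. wk z x) - v z)) (finite_subsets_at_top G)"
      by (intro tendsto_intros)
    show ?thesis
    proof (rule tendsto_upperbound[OF lim])
      show "\<forall>\<^sub>F F' in finite_subsets_at_top G.
          norm ((\<Sum>x\<in>F. wk z x) - (\<Sum>x\<in>F'. wk z x)) \<le> e / 2"
        unfolding eventually_finite_subsets_at_top
      proof (intro exI[of _ F] conjI allI impI)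
        fix F' assume F': "finite F' \<and> F \<subseteq> F' \<and> F' \<subseteq> G"
        have fd: "finite (F' - F)" "F' - F \<subseteq> G" "F' - F \<subseteq> G - F0" using F F' by auto
        have "(\<Sum>x\<in>F'. wk z x) - (\<Sum>x\<in>F. wk z x) = (\<Sum>x\<in>F'-F. wk z x)"
          using F' F(1) by (simp add: sum_diff)
        then have "norm ((\<Sum>x\<in>F. wk z x) - (\<Sum>x\<in>F'. wk z x)) =
            norm (\<Sum>x\<in>F'-F. wk z x)" by (metis norm_minus_commute)
        also have "\<dots> \<le> (\<Sum>x\<in>F'-F. norm (wk z x))" by (rule norm_sum)
        also have "\<dots> \<le> C * (dist z \<kappa> * dist z b) * (16 * \<eta> / s\<^sup>2 + (1 + dist z \<kappa> / \<eta>) * b_const * sum \<sigma> (F' - F))"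
          by (rule sum_kernel_le[OF fd(1,2) zo \<eta>])
        also have "\<dots> \<le> c * (16 * \<eta> / s\<^sup>2 + L * \<epsilon>)"
        proof (rule mult_mono)
          show "C * (dist z \<kappa> * dist z b) \<le> c"
            unfolding c_def using dM[OF z] C_nonneg M by (intro mult_mono) auto
          have "(1 + dist z \<kappa> / \<eta>) * b_const \<le> L"
            unfolding L_def using dM[OF z] \<eta> b_const_pos
            by (intro mult_right_mono add_left_mono divide_right_mono) auto
          then have "(1 + dist z \<kappa> / \<eta>) * b_const * sum \<sigma> (F' - F) \<le> L * \<epsilon>"
            using tail[OF fd(1,3)] L \<sigma>_nonneg by (intro mult_mono) (auto intro: sum_nonneg)
          then show "16 * \<eta> / s\<^sup>2 + (1 + dist z \<kappa> / \<eta>) * b_const * sum \<sigma> (F' - F) \<le> 16 * \<eta> / s\<^sup>2 + L * \<epsilon>" by simp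
          show "0 \<le> c" using c by simp
          show "0 \<le> 16 * \<eta> / s\<^sup>2 + (1 + dist z \<kappa> / \<eta>) * b_const * sum \<sigma> (F' - F)"
            using \<eta> b_const_pos \<sigma>_nonneg by (intro add_nonneg_nonneg mult_nonneg_nonneg sum_nonneg) auto
        qed
        also have "\<dots> = e / 2"
          using c L unfolding distrib_left c\<eta> \<epsilon>_def by simp
        finally show "norm ((\<Sum>x\<in>F. wk z x) - (\<Sum>x\<in>F'. wk z x)) \<le> e / 2" .
      qed (use F in auto)
    qed simp
  qed
  then have bound: "\<forall>z\<in>S. dist (\<Sum>x\<in>F. wk z x) (v z) < e"
    if "finite F" "F0 \<subseteq> F" "F \<subseteq> G" for F
    using that e by (fastforce simp: dist_norm)
  show "\<forall>\<^sub>F F in finite_subsets_at_top G. \<forall>z\<in>S. dist (\<Sum>x\<in>F. wk z x) (v z) < e"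
    unfolding eventually_finite_subsets_at_top
  proof (intro exI[of _ F0] conjI allI impI F0(1,2))
    fix F assume "finite F \<and> F0 \<subseteq> F \<and> F \<subseteq> G"
    then show "\<forall>z\<in>S. dist (\<Sum>x\<in>F. wk z x) (v z) < e" by (intro bound) auto
  qed
qed

lemma centre_not_outside: "x \<in> G \<Longrightarrow> x \<notin> outside_discs"
  using \<rho>_pos by (force simp: outside_discs_def)

text \<open>\<open>outside_discs\<close> may contain accumulation points of the centres; uniform
  convergence on its bounded parts gives continuity there as well.\<close>

lemma continuous_on_v: "continuous_on outside_discs v"
proof -
  have *: "continuous_on (outside_discs \<inter> ball 0 r) v" for r
  proof (rule uniform_limit_theorem[OF _ uniform_limit_v])
    show "\<forall>\<^sub>F F in finite_subsets_at_top G.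
        continuous_on (outside_discs \<inter> ball 0 r) (\<lambda>z. \<Sum>x\<in>F. wk z x)"
    proof (rule eventually_finite_subsets_at_top_weakI)
      fix F assume F: "finite F" "F \<subseteq> G"
      have ne: "(x - z) * (x - \<kappa>) * (x - b) \<noteq> 0" if "x \<in> F" "z \<in> outside_discs" for x z
        using that F centre_not_outside[of x] \<kappa>_far[of x] b_far[of x] s_pos by auto
      show "continuous_on (outside_discs \<inter> ball 0 r) (\<lambda>z. \<Sum>x\<in>F. wk z x)"
        unfolding kernel_def by (intro continuous_intros) (use ne in auto)
    qed
  qed (auto simp: bounded_Int)
  show ?thesis
    unfolding continuous_on_eq_continuous_within
  proof
    fix z assume z: "z \<in> outside_discs"
    have "at z within (outside_discs \<inter> ball 0 (norm z + 1)) = at z within outside_discs"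
      by (rule at_within_nhd[of z "ball 0 (norm z + 1)"]) auto
    moreover have "continuous (at z within (outside_discs \<inter> ball 0 (norm z + 1))) v"
      using *[of "norm z + 1"] z by (auto simp: continuous_on_eq_continuous_within)
    ultimately show "continuous (at z within outside_discs) v" by (simp add: continuous_within)
  qed
qed

lemma holomorphic_on_v:
  assumes O: "open O'" "O' \<subseteq> outside_discs"
  shows "v holomorphic_on O'"
proof -
  have "v field_differentiable (at z)" if z: "z \<in> O'" for z
  proof -
    obtain r where r: "r > 0" "cball z r \<subseteq> O'" using O(1) z open_contains_cball by blast
    have "v holomorphic_on ball z r"
    proof (rule holomorphic_uniform_limit[OF _ uniform_limit_v])
      show "\<forall>\<^sub>F F in finite_subsets_at_top G. continuous_on (cball z r) (\<lambda>z. \<Sum>x\<in>F. wk z x) \<and>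
          (\<lambda>z. \<Sum>x\<in>F. wk z x) holomorphic_on ball z r"
      proof (rule eventually_finite_subsets_at_top_weakI)
        fix F assume F: "finite F" "F \<subseteq> G"
        have ne: "(x - y) * (x - \<kappa>) * (x - b) \<noteq> 0" if "x \<in> F" "y \<in> cball z r" for x y
        proof -
          have "x \<in> G" "y \<in> outside_discs" using that F r(2) O(2) by blast+
          then show ?thesis using centre_not_outside[of x] \<kappa>_far[of x] b_far[of x] s_pos by auto
        qed
        then have "(\<lambda>z. \<Sum>x\<in>F. wk z x) holomorphic_on cball z r"
          unfolding kernel_def by (intro holomorphic_intros) auto
        then show "continuous_on (cball z r) (\<lambda>z. \<Sum>x\<in>F. wk z x) \<and>
          (\<lambda>z. \<Sum>x\<in>F. wk z x) holomorphic_on ball z r"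
          using holomorphic_on_imp_continuous_on holomorphic_on_subset ball_subset_cball by blast
      qed
    qed (use r O in auto)
    then show ?thesis using r(1) by (simp add: holomorphic_on_imp_differentiable_at)
  qed
  then show ?thesis by (simp add: holomorphic_on_def field_differentiable_at_within)
qed

end

section \<open>Invariant vector fields built from grand orbits\<close>

text \<open>The kernel is the error of affine interpolation of \<open>1 / (x - z)\<close> in
  \<open>z\<close> at the nodes \<open>\<kappa>\<close> and \<open>b\<close>; the coefficients are
  the Lagrange weights, of sum 1.\<close>

lemma kernel_partial_fractions:
  assumes "x \<noteq> z" "x \<noteq> \<kappa>" "x \<noteq> b" "b \<noteq> \<kappa>"
  shows "kernel \<kappa> b z x = 1 / (x - z) - ((z - b) / (\<kappa> - b)) / (x - \<kappa>) - ((z - \<kappa>) / (b - \<kappa>)) / (x - b)"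
proof -
  define A B E F where "A = x - z" and "B = x - \<kappa>" and "E = x - b" and "F = b - \<kappa>"
  have ne: "A \<noteq> 0" "B \<noteq> 0" "E \<noteq> 0" "F \<noteq> 0" using assms by (auto simp: A_def B_def E_def F_def)
  have 1: "z - \<kappa> = B - A" "z - b = E - A" "\<kappa> - b = - F" "B = E + F"
    by (auto simp: A_def B_def E_def F_def)
  have e: "1 / A = B * E * F / (A * B * E * F)" "((E - A) / (- F)) / B = - ((E - A) * A * E / (A * B * E * F))"
    "((B - A) / F) / E = (B - A) * A * B / (A * B * E * F)"
    using ne by (simp_all add: divide_simps)
  have "1 / A - ((E - A) / (- F)) / B - ((B - A) / F) / E =
      (B * E * F + (E - A) * A * E - (B - A) * A * B) / (A * B * E * F)"
    unfolding e by (simp only: diff_minus_eq_add add_divide_distrib[symmetric] diff_divide_distrib[symmetric])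
  also have "B * E * F + (E - A) * A * E - (B - A) * A * B = ((B - A) * (E - A)) * F"
    unfolding 1(4) by (simp add: algebra_simps)
  also have "((B - A) * (E - A)) * F / (A * B * E * F) = (B - A) * (E - A) / (A * B * E)" using ne by simp
  finally have "(B - A) * (E - A) / (A * B * E) = 1 / A - ((E - A) / (- F)) / B - ((B - A) / F) / E" by simp
  then show ?thesis unfolding kernel_def using 1(1-3) by (simp add: A_def[symmetric] B_def[symmetric] E_def[symmetric] F_def[symmetric])
qed

text \<open>
  With \<open>W = y - \<kappa>\<close>, \<open>Z = exp z\<close>, \<open>K = exp \<kappa>\<close>, \<open>B = exp b\<close> and \<open>b' = b - \<kappa>\<close>, the left-hand side is the sum of
  \<open>kernel \<kappa> b z x / (y - \<kappa>)\<^sup>2\<close> over the fibre of \<open>y\<close>, and \<open>q (exp t)\<close> is the kernel at \<open>exp_map \<kappa> t\<close>.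
\<close>

lemma pushforward_kernel_identity:
  fixes W Z K B b' ca cb :: complex
  assumes "W \<noteq> 0" "Z \<noteq> 0" "K \<noteq> 0" "B \<noteq> 0" "W \<noteq> Z" "W \<noteq> K" "W \<noteq> B" "W \<noteq> b'" and ab: "ca + cb = 1"
  defines "q \<equiv> \<lambda>Y. Y * (Y - b') / ((W - Y) * W * (W - b'))"
  shows "(Z / (W - Z) - ca * (K / (W - K)) - cb * (B / (W - B))) / W\<^sup>2 = q Z / Z - ca * (q K / K) - cb * (q B / B)"
proof -
  define h where "h Y = 1 / (W * (W - Y))" for Y
  have 1: "Y / (W - Y) / W\<^sup>2 = h Y - 1 / W\<^sup>2" if "W \<noteq> Y" for Y
  proof -
    have "W - Y \<noteq> 0" using that by simp
    then show ?thesis using assms(1) unfolding h_def power2_eq_square by (simp add: field_simps)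
  qed
  have 2: "q Y / Y = h Y - h b'" if "W \<noteq> Y" "Y \<noteq> 0" for Y
  proof -
    define S T where "S = W - Y" and "T = W - b'"
    have ST: "S \<noteq> 0" "T \<noteq> 0" "Y - b' = T - S" using that assms(8) by (simp_all add: S_def T_def)
    have "(T - S) / (S * W * T) = 1 / (W * S) - 1 / (W * T)"
      unfolding diff_divide_distrib using ST(1,2) assms(1) by simp
    then have "(Y - b') / ((W - Y) * W * (W - b')) = h Y - h b'"
      unfolding h_def S_def[symmetric] T_def[symmetric] ST(3) .
    then show ?thesis using that(2) by (simp add: q_def)
  qed
  have "(Z / (W - Z) - ca * (K / (W - K)) - cb * (B / (W - B))) / W\<^sup>2 =
      Z / (W - Z) / W\<^sup>2 - ca * (K / (W - K) / W\<^sup>2) - cb * (B / (W - B) / W\<^sup>2)"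
    by (simp add: diff_divide_distrib)
  also have "\<dots> = h Z - ca * h K - cb * h B - (1 - (ca + cb)) / W\<^sup>2"
    unfolding 1[OF assms(5)] 1[OF assms(6)] 1[OF assms(7)] by (simp add: algebra_simps diff_divide_distrib add_divide_distrib)
  also have "\<dots> = h Z - ca * h K - cb * h B - (1 - (ca + cb)) * h b'" using ab by simp
  also have "\<dots> = q Z / Z - ca * (q K / K) - cb * (q B / B)"
    unfolding 2[OF assms(5,2)] 2[OF assms(6,3)] 2[OF assms(7,4)] by (simp add: algebra_simps)
  finally show ?thesis .
qed

lemma kernel_mult_diff:
  "z \<noteq> d \<Longrightarrow> kernel \<kappa> b z d * (z - d) = - ((z - \<kappa>) * (z - b) / ((d - \<kappa>) * (d - b)))"
proof -
  assume "z \<noteq> d"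
  have "N / (e * P * Q) * (- e) = - (N / (P * Q))" if "e \<noteq> 0" for N e P Q :: complex
    using that by simp
  from this[of "d - z"] \<open>z \<noteq> d\<close> show ?thesis by (simp add: kernel_def)
qed

context wandering_exp
begin

lemma \<kappa>_in_V: "\<kappa> \<in> V" using D_subset_V \<kappa>_in_D by blast

section \<open>Derivatives along grand orbits\<close>

definition grand_orbit :: "complex \<Rightarrow> complex set" where
  "grand_orbit d = {x. \<exists>m n. (f ^^ m) x = (f ^^ n) d}"

text \<open>
  The quotient does not depend on the choice of \<open>m\<close> and \<open>n\<close>, see \<open>deriv_ratio_unique\<close>.
\<close>

definition \<tau> :: "complex \<Rightarrow> complex \<Rightarrow> complex" where
  "\<tau> d x = (SOME t. \<exists>m n. (f ^^ m) x = (f ^^ n) d \<and> t = deriv (f ^^ n) d / deriv (f ^^ m) x)"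

lemma deriv_ratio_shift:
  assumes e: "(f ^^ m) x = (f ^^ n) d"
  shows "deriv (f ^^ (k + n)) d / deriv (f ^^ (k + m)) x = deriv (f ^^ n) d / deriv (f ^^ m) x"
  unfolding deriv_exp_map_funpow_add e using deriv_exp_map_funpow_nonzero by simp

lemma grand_orbit_levels:
  assumes d: "d \<in> V" "d' \<in> V" and e: "(f ^^ m) x = (f ^^ n) d" "(f ^^ m') x = (f ^^ n') d'" and le: "m \<le> m'"
  shows "d = d'" "n' = (m' - m) + n"
proof -
  have "(f ^^ ((m' - m) + n)) d = (f ^^ (m' - m)) ((f ^^ m) x)" by (simp add: funpow_add e)
  also have "\<dots> = (f ^^ m') x" using le by (metis comp_apply funpow_add le_add_diff_inverse2)
  finally have "(f ^^ ((m' - m) + n)) d = (f ^^ n') d'" using e by simp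
  then show "d = d'" "n' = (m' - m) + n" using V_grand_orbit_unique[OF d] by auto
qed

lemma deriv_ratio_unique:
  assumes d: "d \<in> V" and e: "(f ^^ m) x = (f ^^ n) d" "(f ^^ m') x = (f ^^ n') d"
  shows "deriv (f ^^ n) d / deriv (f ^^ m) x = deriv (f ^^ n') d / deriv (f ^^ m') x"
proof -
  have *: "deriv (f ^^ n) d / deriv (f ^^ m) x = deriv (f ^^ n') d / deriv (f ^^ m') x"
    if "m \<le> m'" "(f ^^ m) x = (f ^^ n) d" "(f ^^ m') x = (f ^^ n') d" for m m' n n'
    using deriv_ratio_shift[OF that(2), of "m' - m"] grand_orbit_levels(2)[OF d d that(2,3,1)] that(1) by simp
  show ?thesis using *[OF _ e] *[OF _ e(2,1)] by (metis linear)
qed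

lemma \<tau>_eq:
  assumes "d \<in> V" and e: "(f ^^ m) x = (f ^^ n) d"
  shows "\<tau> d x = deriv (f ^^ n) d / deriv (f ^^ m) x"
proof -
  have "\<exists>t m n. (f ^^ m) x = (f ^^ n) d \<and> t = deriv (f ^^ n) d / deriv (f ^^ m) x" using e by blast
  then have "\<exists>m n. (f ^^ m) x = (f ^^ n) d \<and> \<tau> d x = deriv (f ^^ n) d / deriv (f ^^ m) x"
    unfolding \<tau>_def by (rule someI_ex)
  then show ?thesis using deriv_ratio_unique[OF assms(1) e] by metis
qed

lemma f_in_grand_orbit_iff: "f x \<in> grand_orbit d \<longleftrightarrow> x \<in> grand_orbit d"
proof
  assume "f x \<in> grand_orbit d"
  then obtain m n where "(f ^^ m) (f x) = (f ^^ n) d" by (auto simp: grand_orbit_def)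
  then have "(f ^^ Suc m) x = (f ^^ n) d" by (simp add: funpow_swap1)
  then show "x \<in> grand_orbit d" unfolding grand_orbit_def by blast
next
  assume "x \<in> grand_orbit d"
  then obtain m n where "(f ^^ m) x = (f ^^ n) d" by (auto simp: grand_orbit_def)
  then have "(f ^^ m) (f x) = (f ^^ Suc n) d" by (simp add: funpow_swap1[symmetric])
  then show "f x \<in> grand_orbit d" unfolding grand_orbit_def by blast
qed

text \<open>The chain rule. It expresses invariance of the measure: as
  \<open>exp x = f x - \<kappa>\<close>, the mass at \<open>x\<close> is that at \<open>f x\<close>
  divided by \<open>(f x - \<kappa>)\<^sup>2\<close>.\<close>

lemma \<tau>_f:
  assumes d: "d \<in> V" and x: "x \<in> grand_orbit d"
  shows "\<tau> d (f x) = \<tau> d x * exp x"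
proof -
  obtain m n where e: "(f ^^ m) (f x) = (f ^^ n) d"
    using x f_in_grand_orbit_iff[of x d] by (auto simp: grand_orbit_def)
  then have e': "(f ^^ (m + 1)) x = (f ^^ n) d" by (simp add: funpow_swap1)
  have "deriv (f ^^ (m + 1)) x = deriv (f ^^ m) (f x) * exp x"
    using deriv_exp_map_funpow_add[of m 1 \<kappa> x] by (simp add: deriv_exp_map)
  then show ?thesis using \<tau>_eq[OF d e] \<tau>_eq[OF d e'] by simp
qed

lemma \<tau>_self: "d \<in> V \<Longrightarrow> \<tau> d d = 1"
  using \<tau>_eq[of d 0 d 0] by simp

lemma self_in_grand_orbit: "d \<in> grand_orbit d"
  unfolding grand_orbit_def by (auto intro: exI[of _ 0])

section \<open>Disjoint discs around the points of a grand orbit\<close>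

text \<open>Since the disc omits \<open>\<kappa>\<close>, no orbit starting in it meets the orbit of
  \<open>\<kappa>\<close>, so the branch carrying \<open>d\<close> to \<open>x\<close> extends to
  the whole disc. It is injective with derivative \<open>\<tau> d x\<close> at \<open>d\<close>, and
  \<open>weak_koebe\<close> applies.\<close>

lemma exists_discs_in_branches:
  assumes sub: "ball d r \<subseteq> D - {\<kappa>}" and r: "r > 0"
  obtains M N g where
    "\<And>x y. x \<in> grand_orbit d \<Longrightarrow> y \<in> ball d r \<Longrightarrow> (f ^^ M x) (g x y) = (f ^^ N x) y"
    "\<And>x. x \<in> grand_orbit d \<Longrightarrow> g x d = x" "\<And>x. x \<in> grand_orbit d \<Longrightarrow> continuous_on (ball d r) (g x)"
    "\<And>x. x \<in> grand_orbit d \<Longrightarrow> ball x (koebe_const * r * norm (\<tau> d x)) \<subseteq> g x ` ball d r"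
proof -
  have dV: "y \<in> V" if "y \<in> ball d r" for y using that sub D_subset_V by blast
  have d0: "d \<in> ball d r" using r by simp
  have "\<exists>m n g. g holomorphic_on ball d r \<and> (\<forall>y\<in>ball d r. (f ^^ m) (g y) = (f ^^ n) y) \<and> g d = x"
    if x: "x \<in> grand_orbit d" for x
  proof -
    obtain m n where e: "(f ^^ m) x = (f ^^ n) d" using x by (auto simp: grand_orbit_def)
    have "(f ^^ n) y \<noteq> (f ^^ i) \<kappa>" if "y \<in> ball d r" for y i
      using V_grand_orbit_unique[OF dV[OF that] \<kappa>_in_V] sub that by blast
    then obtain g where "g holomorphic_on ball d r" "\<And>y. y \<in> ball d r \<Longrightarrow> (f ^^ m) (g y) = (f ^^ n) y" "g d = x"
      using exp_map_funpow_lift[of "ball d r" "f ^^ n" m \<kappa> d x] e d0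
      by (metis convex_ball holomorphic_exp_map_funpow open_ball)
    then show ?thesis by blast
  qed
  then obtain M N g where g: "\<And>x. x \<in> grand_orbit d \<Longrightarrow> g x holomorphic_on ball d r"
    "\<And>x y. x \<in> grand_orbit d \<Longrightarrow> y \<in> ball d r \<Longrightarrow> (f ^^ M x) (g x y) = (f ^^ N x) y"
    "\<And>x. x \<in> grand_orbit d \<Longrightarrow> g x d = x" by metis
  show ?thesis
  proof (rule that[OF g(2,3)])
    fix x assume x: "x \<in> grand_orbit d"
    show "continuous_on (ball d r) (g x)" using g(1)[OF x] by (rule holomorphic_on_imp_continuous_on)
    have inj: "inj_on (g x) (ball d r)"
    proof (rule inj_onI)
      fix y y' assume y: "y \<in> ball d r" "y' \<in> ball d r" "g x y = g x y'"
      then have "(f ^^ N x) y = (f ^^ N x) y'" using g(2)[OF x] by metis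
      then show "y = y'" using V_grand_orbit_unique[OF dV[OF y(1)] dV[OF y(2)]] by blast
    qed
    have "(f ^^ M x) x = (f ^^ N x) d" using g(2)[OF x d0] g(3)[OF x] by simp
    then have \<tau>: "\<tau> d x = deriv (f ^^ N x) d / deriv (f ^^ M x) x" using \<tau>_eq[OF dV[OF d0]] by blast
    have dg: "(g x has_field_derivative deriv (g x) d) (at d)"
      using holomorphic_derivI[OF g(1)[OF x]] d0 by blast
    have df: "((f ^^ M x) has_field_derivative deriv (f ^^ M x) x) (at (g x d))"
      using exp_map_funpow_differentiable[of "M x" \<kappa> x] g(3)[OF x] by (simp add: DERIV_deriv_iff_field_differentiable)
    have "((\<lambda>y. (f ^^ M x) (g x y)) has_field_derivative deriv (f ^^ M x) x * deriv (g x) d) (at d)"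
      by (rule DERIV_chain2[OF df dg])
    then have "((f ^^ N x) has_field_derivative deriv (f ^^ M x) x * deriv (g x) d) (at d)"
      by (rule has_field_derivative_transform_within_open[of _ _ _ "ball d r"]) (use g(2)[OF x] d0 in auto)
    then have "deriv (f ^^ N x) d = deriv (f ^^ M x) x * deriv (g x) d" by (rule DERIV_imp_deriv)
    then have "\<tau> d x = deriv (g x) d" using \<tau> deriv_exp_map_funpow_nonzero[of "M x" \<kappa> x] by simp
    then show "ball x (koebe_const * r * norm (\<tau> d x)) \<subseteq> g x ` ball d r"
      using weak_koebe[OF g(1)[OF x] r inj] g(3)[OF x] by simp
  qed
qed

text \<open>
  Among the points of the grand orbit only \<open>d\<close> itself lies in \<open>V\<close>. Its term, the only one with a pole
  in \<open>V\<close>, is split off.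
\<close>

definition rest :: "complex \<Rightarrow> complex \<Rightarrow> complex \<Rightarrow> complex" where
  "rest b d z = (\<Sum>\<^sub>\<infinity>x\<in>grand_orbit d - {d}. (\<tau> d x)\<^sup>2 * kernel \<kappa> b z x)"

lemma exists_disc_packing:
  assumes sub: "ball d r \<subseteq> D - {\<kappa>}" and r: "r > 0" and b: "b \<in> U"
  obtains \<rho> s C where "disc_packing (grand_orbit d - {d}) \<rho> (\<lambda>x. (\<tau> d x)\<^sup>2) \<kappa> b s C"
    "V \<union> closure Ut \<union> {f \<kappa>} \<subseteq> disc_packing.outside_discs (grand_orbit d - {d}) \<rho>"
    "grand_orbit d \<inter> (Ut \<union> {\<kappa>}) = {}"
proof -
  obtain M N g where g: 
    "\<And>x y. x \<in> grand_orbit d \<Longrightarrow> y \<in> ball d r \<Longrightarrow> (f ^^ M x) (g x y) = (f ^^ N x) y"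
    "\<And>x. x \<in> grand_orbit d \<Longrightarrow> g x d = x" "\<And>x. x \<in> grand_orbit d \<Longrightarrow> continuous_on (ball d r) (g x)"
    "\<And>x. x \<in> grand_orbit d \<Longrightarrow> ball x (koebe_const * r * norm (\<tau> d x)) \<subseteq> g x ` ball d r"
    using exists_discs_in_branches[OF sub r] by metis
  have dV: "y \<in> V" if "y \<in> ball d r" for y using that sub D_subset_V by blast
  have d0: "d \<in> ball d r" using r by simp
  have cb: "connected (ball d r)" by simp
  define \<rho> where "\<rho> x = koebe_const * r * norm (\<tau> d x)" for x
  define K where "K = koebe_const * r"
  have K: "K > 0" using koebe_const_pos r by (simp add: K_def)
  have \<tau>0: "\<tau> d x \<noteq> 0" if x: "x \<in> grand_orbit d" for x
  proof -
    obtain m n where "(f ^^ m) x = (f ^^ n) d" using x by (auto simp: grand_orbit_def)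
    from \<tau>_eq[OF dV[OF d0] this] show ?thesis using deriv_exp_map_funpow_nonzero by simp
  qed
  have \<rho>_pos: "\<rho> x > 0" if "x \<in> grand_orbit d" for x
    using \<tau>0[OF that] K by (simp add: \<rho>_def K_def)
  have disc: "\<exists>y\<in>ball d r. z = g x y" if "x \<in> grand_orbit d" "z \<in> ball x (\<rho> x)" for x z
    using g(4)[OF that(1)] that(2) by (auto simp: \<rho>_def)
  \<comment> \<open>A common value of two branches comes from the same point of the disc at matching
    levels; by uniqueness of lifts the branches, and so their centres, coincide.\<close>
  have eq_if_meet: "x = x'" if x: "x \<in> grand_orbit d" "x' \<in> grand_orbit d" and y: "y \<in> ball d r" "y' \<in> ball d r"
    and e: "g x y = g x' y'" for x x' y y'
  proof -
    have *: "x = x'" if le: "M x \<le> M x'" and x: "x \<in> grand_orbit d" "x' \<in> grand_orbit d"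
        and y: "y \<in> ball d r" "y' \<in> ball d r" and e: "g x y = g x' y'" for x x' y y'
    proof -
      have e1: "(f ^^ M x) (g x y) = (f ^^ N x) y" "(f ^^ M x') (g x y) = (f ^^ N x') y'"
        using g(1)[OF x(1) y(1)] g(1)[OF x(2) y(2)] e by auto
      have yy: "y = y'" and N: "N x' = (M x' - M x) + N x"
        using grand_orbit_levels[OF dV[OF y(1)] dV[OF y(2)] e1 le] by auto
      have "g x t = g x' t" if t: "t \<in> ball d r" for t
      proof (rule exp_map_funpow_section_unique[OF cb g(3)[OF x(1)] g(3)[OF x(2)] _ y(1) _ t])
        fix t assume t: "t \<in> ball d r"
        have "(f ^^ M x') (g x t) = (f ^^ (M x' - M x)) ((f ^^ M x) (g x t))"
          using le by (metis comp_apply funpow_add le_add_diff_inverse2)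
        also have "\<dots> = (f ^^ N x') t" by (simp add: g(1)[OF x(1) t] N funpow_add)
        also have "\<dots> = (f ^^ M x') (g x' t)" by (simp add: g(1)[OF x(2) t])
        finally show "(f ^^ M x') (g x t) = (f ^^ M x') (g x' t)" .
      qed (use e yy in simp)
      then have "g x d = g x' d" using d0 by blast
      then show "x = x'" using g(2) x by metis
    qed
    show ?thesis using *[OF _ x y e] *[OF _ x(2,1) y(2,1) e[symmetric]] by (metis linear)
  qed
  have in_Ut: False if "x \<in> grand_orbit d" "y \<in> ball d r" "g x y \<in> Ut" for x y
  proof -
    have "(f ^^ N x) y \<in> Ut" using that(3) g(1)[OF that(1,2)] f_funpow_in_Ut_iff[of "M x" "g x y"] by simp
    then have "y \<in> Ut" by (simp add: f_funpow_in_Ut_iff)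
    then show False using dV[OF that(2)] V_Int_closure_Ut closure_subset[of Ut] by blast
  qed
  have not_\<kappa>: False if "x \<in> grand_orbit d" "y \<in> ball d r" "g x y = (f ^^ i) \<kappa>" for x y i
  proof -
    have "(f ^^ N x) y = (f ^^ (M x + i)) \<kappa>" using g(1)[OF that(1,2)] that(3) by (simp add: funpow_add)
    then have "y = \<kappa>" using V_grand_orbit_unique[OF dV[OF that(2)] \<kappa>_in_V] by blast
    then show False using sub that(2) by blast
  qed
  have in_V: "x = d" if x: "x \<in> grand_orbit d" and y: "y \<in> ball d r" and v: "g x y \<in> V" for x y
  proof -
    have MN: "M x = N x" "g x y = y" using V_grand_orbit_unique[OF v dV[OF y] g(1)[OF x y]] by auto
    have "g x d = d"
      by (rule exp_map_funpow_section_unique[OF cb g(3)[OF x] continuous_on_id, of "M x" \<kappa> y])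
         (use g(1)[OF x] MN y d0 in auto)
    then show ?thesis using g(2)[OF x] by simp
  qed
  have clU: "z \<notin> ball x (\<rho> x)" if x: "x \<in> grand_orbit d" and z: "z \<in> closure Ut" for x z
  proof -
    have "ball x (\<rho> x) \<inter> Ut = {}" using disc[OF x] in_Ut[OF x] by blast
    then have "ball x (\<rho> x) \<inter> closure Ut = {}" by (simp add: open_Int_closure_eq_empty)
    then show ?thesis using z by blast
  qed
  have cen: "x \<in> ball x (\<rho> x)" if "x \<in> grand_orbit d" for x using \<rho>_pos[OF that] by simp
  have xV: "x \<notin> V" if "x \<in> grand_orbit d" "x \<noteq> d" for x
    using in_V[OF that(1) d0] g(2)[OF that(1)] that by auto
  obtain sb where sb: "sb > 0" "ball b sb \<subseteq> U" using b open_U open_contains_ball by blast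
  define s where "s = min \<delta> sb"
  have dp: "disc_packing (grand_orbit d - {d}) \<rho> (\<lambda>x. (\<tau> d x)\<^sup>2) \<kappa> b s (1 / K\<^sup>2)"
  proof
    fix x assume x: "x \<in> grand_orbit d - {d}"
    then have xG: "x \<in> grand_orbit d" "x \<noteq> d" by auto
    show "0 < \<rho> x" by (rule \<rho>_pos[OF xG(1)])
    show "s \<le> dist x \<kappa>"
      using xV[OF xG] D_subset_V by (force simp: s_def dist_commute)
    have "x \<notin> U" using in_Ut[OF xG(1) d0] g(2)[OF xG(1)] U_subset_Ut by auto
    then show "s \<le> dist x b" using sb by (force simp: s_def dist_commute)
    have "\<kappa> \<notin> ball x (\<rho> x)"
    proof
      assume "\<kappa> \<in> ball x (\<rho> x)"
      then obtain y where "y \<in> ball d r" "g x y = \<kappa>" using disc[OF xG(1)] by metis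
      then show False using not_\<kappa>[OF xG(1), of y 0] by simp
    qed
    then show "\<rho> x \<le> dist x \<kappa>" by simp
    show "norm ((\<tau> d x)\<^sup>2) \<le> 1 / K\<^sup>2 * (\<rho> x)\<^sup>2"
      using koebe_const_pos r by (simp add: norm_power \<rho>_def power_mult_distrib K_def)
  next
    fix x y assume xy: "x \<in> grand_orbit d - {d}" "y \<in> grand_orbit d - {d}" "x \<noteq> y"
    show "ball x (\<rho> x) \<inter> ball y (\<rho> y) = {}"
    proof (rule ccontr)
      assume "ball x (\<rho> x) \<inter> ball y (\<rho> y) \<noteq> {}"
      then obtain t where t: "t \<in> ball x (\<rho> x)" "t \<in> ball y (\<rho> y)" by blast
      have xyG: "x \<in> grand_orbit d" "y \<in> grand_orbit d" using xy by auto
      obtain u u' where u: "u \<in> ball d r" "t = g x u" "u' \<in> ball d r" "t = g y u'"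
        using disc[OF xyG(1) t(1)] disc[OF xyG(2) t(2)] by blast
      then have "x = y" by (intro eq_if_meet[OF xyG u(1,3)]) simp
      then show False using xy(3) by simp
    qed
  qed (use \<delta>_pos sb K in \<open>auto simp: s_def\<close>)
  show ?thesis
  proof (rule that[OF dp])
    show "V \<union> closure Ut \<union> {f \<kappa>} \<subseteq> disc_packing.outside_discs (grand_orbit d - {d}) \<rho>"
      unfolding disc_packing.outside_discs_def[OF dp]
    proof (intro subsetI CollectI ballI)
      fix z x assume z: "z \<in> V \<union> closure Ut \<union> {f \<kappa>}" and x: "x \<in> grand_orbit d - {d}"
      have "z \<notin> ball x (\<rho> x)"
      proof
        assume zb: "z \<in> ball x (\<rho> x)"
        then obtain y where y: "y \<in> ball d r" "g x y = z" using disc[of x z] x by (metis DiffD1)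
        show False using z y in_V[of x y] clU[of x z] zb not_\<kappa>[of x y 1] x by auto
      qed
      then show "\<rho> x \<le> dist x z" by simp
    qed
    show "grand_orbit d \<inter> (Ut \<union> {\<kappa>}) = {}"
      using in_Ut[OF _ d0] not_\<kappa>[OF _ d0, of _ 0] g(2) by auto
  qed
qed

definition vfield :: "complex \<Rightarrow> complex \<Rightarrow> complex \<Rightarrow> complex" where
  "vfield b d z = kernel \<kappa> b z d + rest b d z"

section \<open>The functional equation\<close>

text \<open>The fibre is a sequence of translates by \<open>2 * pi * \<i>\<close>; partial fractions
  with weights of sum 1 evaluate the sum, and \<open>pushforward_kernel_identity\<close> rewrites it
  by kernels at image points.\<close>

lemma fibre_sum:
  assumes y: "y \<noteq> \<kappa>" and b: "b \<noteq> \<kappa>" and z: "z \<noteq> \<kappa>" and summ: "(\<lambda>x. c * kernel \<kappa> b z x / (y - \<kappa>)\<^sup>2) summable_on {x. f x = y}"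
    and c: "c \<noteq> 0"
    and ne: "y \<noteq> f z" "y \<noteq> f \<kappa>" "y \<noteq> f b" "y \<noteq> b" "b \<noteq> z"
  shows "(\<Sum>\<^sub>\<infinity>x\<in>{x. f x = y}. c * kernel \<kappa> b z x / (y - \<kappa>)\<^sup>2) =
    c * (kernel \<kappa> b (f z) y / exp z - ((z - b) / (\<kappa> - b)) * (kernel \<kappa> b (f \<kappa>) y / exp \<kappa>)
      - ((z - \<kappa>) / (b - \<kappa>)) * (kernel \<kappa> b (f b) y / exp b))"
proof -
  define ca cb where "ca = (z - b) / (\<kappa> - b)" and "cb = (z - \<kappa>) / (b - \<kappa>)"
  have ab: "ca + cb = 1"
  proof -
    have "(z - b) / (\<kappa> - b) = - ((z - b) / (b - \<kappa>))" by (metis divide_minus_right minus_diff_eq)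
    then have "ca + cb = ((z - \<kappa>) - (z - b)) / (b - \<kappa>)"
      unfolding ca_def cb_def by (simp only: diff_divide_distrib) simp
    then show ?thesis using b by simp
  qed
  define x0 where "x0 = Ln (y - \<kappa>)"
  have ex0: "exp x0 = y - \<kappa>" using y by (simp add: x0_def)
  define X where "X k = x0 + 2 * of_real pi * \<i> * of_int k" for k :: int
  have bij: "bij_betw X UNIV {x. f x = y}"
  proof (rule bij_betwI')
    show "X j = X k \<longleftrightarrow> j = k" for j k by (simp add: X_def)
    show "X k \<in> {x. f x = y}" for k
    proof -
      have "exp (X k) = exp x0" unfolding X_def exp_eq by (intro exI[of _ k]) (simp add: algebra_simps)
      then show ?thesis using ex0 by (simp add: f_eq)
    qed
    fix x assume "x \<in> {x. f x = y}"
    then have "exp x = exp x0" using ex0 by (metis (mono_tags) add_diff_cancel f_eq mem_Collect_eq)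
    then obtain n where "x = x0 + of_real (of_int (2 * n) * pi) * \<i>" unfolding exp_eq by auto
    then show "\<exists>k\<in>UNIV. x = X k" by (intro bexI[of _ n]) (simp_all add: X_def algebra_simps)
  qed
  have eX: "exp (X k) = y - \<kappa>" for k using bij by (auto simp: bij_betw_def f_eq algebra_simps)
  define F where "F k = 1 / (x0 - z + 2 * of_real pi * \<i> * of_int k) - ca / (x0 - \<kappa> + 2 * of_real pi * \<i> * of_int k)
     - cb / (x0 - b + 2 * of_real pi * \<i> * of_int k)" for k :: int
  have kF: "kernel \<kappa> b z (X k) = F k" for k
  proof -
    have "X k \<noteq> z" "X k \<noteq> \<kappa>" "X k \<noteq> b" using eX[of k] ne by (auto simp: f_eq algebra_simps)
    from kernel_partial_fractions[OF this b]
    show ?thesis by (simp add: F_def X_def ca_def cb_def algebra_simps)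
  qed
  define a where "a = c / (y - \<kappa>)\<^sup>2"
  have a: "a \<noteq> 0" using c y by (simp add: a_def)
  have "(\<lambda>k. a * F k) summable_on UNIV"
    using summable_on_reindex_bij_betw[OF bij, of "\<lambda>x. c * kernel \<kappa> b z x / (y - \<kappa>)\<^sup>2"] summ
    by (simp add: kF a_def)
  then have sF: "F summable_on UNIV" using a by (simp add: summable_on_cmult_right')
  have "(\<Sum>\<^sub>\<infinity>x\<in>{x. f x = y}. c * kernel \<kappa> b z x / (y - \<kappa>)\<^sup>2) = (\<Sum>\<^sub>\<infinity>k. c * kernel \<kappa> b z (X k) / (y - \<kappa>)\<^sup>2)"
    by (rule infsum_reindex_bij_betw[OF bij, symmetric])
  also have "\<dots> = (\<Sum>\<^sub>\<infinity>k. a * F k)" by (simp add: kF a_def)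
  also have "\<dots> = a * infsum F UNIV" by (rule infsum_cmult_right')
  also have "infsum F UNIV = 1 / (exp (x0 - z) - 1) - ca / (exp (x0 - \<kappa>) - 1) - cb / (exp (x0 - b) - 1)"
    unfolding F_def
    by (rule infsum_partial_fractions_translates)
       (use sF ab ne ex0 in \<open>auto simp: F_def[abs_def] f_eq algebra_simps\<close>)
  finally have 1: "(\<Sum>\<^sub>\<infinity>x\<in>{x. f x = y}. c * kernel \<kappa> b z x / (y - \<kappa>)\<^sup>2) =
      a * (1 / (exp (x0 - z) - 1) - ca / (exp (x0 - \<kappa>) - 1) - cb / (exp (x0 - b) - 1))" .
  define W where "W = y - \<kappa>"
  have ediff: "1 / (exp (x0 - t) - 1) = exp t / (W - exp t)" for t
    unfolding exp_diff ex0 W_def[symmetric] by (simp add: field_simps)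
  have Wne: "W \<noteq> 0" "W \<noteq> exp z" "W \<noteq> exp \<kappa>" "W \<noteq> exp b" "W \<noteq> b - \<kappa>"
    using y ne by (auto simp: W_def f_eq algebra_simps)
  have kq: "kernel \<kappa> b (f t) y = exp t * (exp t - (b - \<kappa>)) / ((W - exp t) * W * (W - (b - \<kappa>)))" for t
    by (simp add: kernel_def f_eq W_def algebra_simps)
  have key: "(exp z / (W - exp z) - ca * (exp \<kappa> / (W - exp \<kappa>)) - cb * (exp b / (W - exp b))) / W\<^sup>2 =
     kernel \<kappa> b (f z) y / exp z - ca * (kernel \<kappa> b (f \<kappa>) y / exp \<kappa>) - cb * (kernel \<kappa> b (f b) y / exp b)"
    unfolding kq by (rule pushforward_kernel_identity) (use Wne ab in auto)
  have e: "t / (exp (x0 - u) - 1) = t * (exp u / (W - exp u))" for t u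
    using ediff[of u] by (metis mult.right_neutral times_divide_eq_right)
  show ?thesis
    unfolding 1 unfolding ediff[of z] e[of ca] e[of cb] a_def W_def[symmetric] ca_def[symmetric] cb_def[symmetric] key[symmetric]
    by simp
qed

lemma rest_facts:
  assumes sub: "ball d r \<subseteq> D - {\<kappa>}" and r: "r > 0" and b: "b \<in> U"
  shows "continuous_on (V \<union> closure Ut) (rest b d)" "rest b d holomorphic_on V" "rest b d holomorphic_on U"
    "\<exists>K. \<forall>z\<in>V. norm (rest b d z) \<le> K * (1 + norm z) ^ 3"
    "\<And>z. z \<in> Ut \<union> {f \<kappa>} \<Longrightarrow> (\<lambda>x. (\<tau> d x)\<^sup>2 * kernel \<kappa> b z x) summable_on grand_orbit d"
    "\<And>z. z \<in> Ut \<union> {f \<kappa>} \<Longrightarrow> vfield b d z = (\<Sum>\<^sub>\<infinity>x\<in>grand_orbit d. (\<tau> d x)\<^sup>2 * kernel \<kappa> b z x)"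
    "grand_orbit d \<inter> (Ut \<union> {\<kappa>}) = {}"
proof -
  obtain \<rho> s C where dp: "disc_packing (grand_orbit d - {d}) \<rho> (\<lambda>x. (\<tau> d x)\<^sup>2) \<kappa> b s C"
    and out: "V \<union> closure Ut \<union> {f \<kappa>} \<subseteq> disc_packing.outside_discs (grand_orbit d - {d}) \<rho>"
    and GO: "grand_orbit d \<inter> (Ut \<union> {\<kappa>}) = {}"
    using exists_disc_packing[OF assms] by metis
  interpret P: disc_packing "grand_orbit d - {d}" \<rho> "\<lambda>x. (\<tau> d x)\<^sup>2" \<kappa> b s C by (rule dp)
  have v: "P.v = rest b d" by (rule ext) (simp add: P.v_def rest_def)
  have d0: "d \<in> V" using sub D_subset_V r centre_in_ball[of d r] by blast
  show "continuous_on (V \<union> closure Ut) (rest b d)"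
    using continuous_on_subset[OF P.continuous_on_v[unfolded v], of "V \<union> closure Ut"] out by blast
  show "rest b d holomorphic_on V" using P.holomorphic_on_v[OF open_V] out unfolding v by blast
  have "U \<subseteq> P.outside_discs" using out U_subset_Ut closure_subset[of Ut] by blast
  then show "rest b d holomorphic_on U" using P.holomorphic_on_v[OF open_U] unfolding v by blast
  show "\<exists>K. \<forall>z\<in>V. norm (rest b d z) \<le> K * (1 + norm z) ^ 3"
    using P.v_growth out unfolding v by blast
  fix z assume z: "z \<in> Ut \<union> {f \<kappa>}"
  have s: "(\<lambda>x. (\<tau> d x)\<^sup>2 * kernel \<kappa> b z x) summable_on (grand_orbit d - {d})"
    using P.summable_kernel[of z] z out closure_subset[of Ut] by blast
  have G: "grand_orbit d = insert d (grand_orbit d - {d})" using self_in_grand_orbit by blast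
  show "(\<lambda>x. (\<tau> d x)\<^sup>2 * kernel \<kappa> b z x) summable_on grand_orbit d"
    by (subst G, subst summable_on_insert_iff) (rule s)
  have "(\<Sum>\<^sub>\<infinity>x\<in>insert d (grand_orbit d - {d}). (\<tau> d x)\<^sup>2 * kernel \<kappa> b z x) =
      (\<tau> d d)\<^sup>2 * kernel \<kappa> b z d + rest b d z"
    unfolding rest_def by (rule infsum_insert[OF s]) simp
  then show "vfield b d z = (\<Sum>\<^sub>\<infinity>x\<in>grand_orbit d. (\<tau> d x)\<^sup>2 * kernel \<kappa> b z x)"
    using G \<tau>_self[OF d0] by (simp add: vfield_def)
qed (rule exists_disc_packing[OF assms], assumption)

text \<open>Regroup the sum over the grand orbit by fibres of \<open>f\<close>. The terms at
  \<open>f \<kappa>\<close> and \<open>f b\<close> stem from the zeros of the kernel at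
  \<open>\<kappa>\<close> and \<open>b\<close>; making them vanish gives the two linear
  conditions.\<close>

lemma vfield_functional_equation:
  assumes sub: "ball d r \<subseteq> D - {\<kappa>}" and r: "r > 0" and b: "b \<in> U" and z: "z \<in> Ut" and zb: "z \<noteq> b"
  shows "vfield b d z = vfield b d (f z) / exp z - ((z - b) / (\<kappa> - b)) * (vfield b d (f \<kappa>) / exp \<kappa>)
      - ((z - \<kappa>) / (b - \<kappa>)) * (vfield b d (f b) / exp b)"
proof -
  note R = rest_facts[OF sub r b]
  let ?G = "grand_orbit d"
  have d0: "d \<in> V" using sub D_subset_V r centre_in_ball[of d r] by blast
  have bUt: "b \<in> Ut" using b U_subset_Ut by blast
  have \<kappa>Ut: "\<kappa> \<notin> Ut" using \<kappa>_in_D D_Int_closure_Ut closure_subset[of Ut] by blast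
  have fU: "f z \<in> Ut" "f b \<in> Ut" using z bUt f_in_Ut_iff by auto
  define F where "F x = (\<tau> d x)\<^sup>2 * kernel \<kappa> b z x" for x
  define S where "S = Sigma ?G (\<lambda>y. {x. f x = y})"
  have bij: "bij_betw snd S ?G"
    unfolding bij_betw_def S_def inj_on_def using f_in_grand_orbit_iff by (auto simp: image_iff)
  have sF: "F summable_on ?G" unfolding F_def using R(5)[of z] z by blast
  then have sS: "(\<lambda>(y, x). F x) summable_on S"
    using summable_on_reindex_bij_betw[OF bij, of F] by (simp add: case_prod_beta')
  have "vfield b d z = infsum F ?G" unfolding F_def using R(6)[of z] z by blast
  also have "\<dots> = (\<Sum>\<^sub>\<infinity>(y, x)\<in>S. F x)"
    using infsum_reindex_bij_betw[OF bij, of F] by (simp add: case_prod_beta')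
  also have "\<dots> = (\<Sum>\<^sub>\<infinity>y\<in>?G. \<Sum>\<^sub>\<infinity>x\<in>{x. f x = y}. F x)"
    unfolding S_def by (rule infsum_Sigma'_banach[symmetric]) (use sS S_def in simp)
  also have "\<dots> = (\<Sum>\<^sub>\<infinity>y\<in>?G. (\<tau> d y)\<^sup>2 * (kernel \<kappa> b (f z) y / exp z - ((z - b) / (\<kappa> - b)) * (kernel \<kappa> b (f \<kappa>) y / exp \<kappa>)
      - ((z - \<kappa>) / (b - \<kappa>)) * (kernel \<kappa> b (f b) y / exp b)))"
  proof (rule infsum_cong)
    fix y assume y: "y \<in> ?G"
    have y\<kappa>: "y \<noteq> \<kappa>" using y R(7) by blast
    have Fx: "F x = (\<tau> d y)\<^sup>2 * kernel \<kappa> b z x / (y - \<kappa>)\<^sup>2" if x: "x \<in> {x. f x = y}" for x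
    proof -
      have xG: "x \<in> ?G" using x y f_in_grand_orbit_iff[of x d] by simp
      have "y - \<kappa> = exp x" using x by (auto simp: f_eq)
      moreover have "\<tau> d y = \<tau> d x * exp x" using \<tau>_f[OF d0 xG] x by simp
      ultimately show ?thesis by (simp add: F_def power_mult_distrib)
    qed
    have fin: "F summable_on {x. f x = y}"
      by (rule summable_on_subset_banach[OF sF]) (use y f_in_grand_orbit_iff in auto)
    have \<tau>0: "(\<tau> d y)\<^sup>2 \<noteq> 0"
    proof -
      obtain m n where "(f ^^ m) y = (f ^^ n) d" using y by (auto simp: grand_orbit_def)
      from \<tau>_eq[OF d0 this] show ?thesis using deriv_exp_map_funpow_nonzero by simp
    qed
    have "\<kappa> \<notin> ?G" using R(7) by blast
    then have "f \<kappa> \<notin> ?G" by (simp add: f_in_grand_orbit_iff)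
    then have ne: "y \<noteq> f z" "y \<noteq> f \<kappa>" "y \<noteq> f b" "y \<noteq> b" "b \<noteq> z" "b \<noteq> \<kappa>" "z \<noteq> \<kappa>"
      using y fU bUt R(7) zb \<kappa>Ut z by auto
    have "(\<Sum>\<^sub>\<infinity>x\<in>{x. f x = y}. F x) = (\<Sum>\<^sub>\<infinity>x\<in>{x. f x = y}. (\<tau> d y)\<^sup>2 * kernel \<kappa> b z x / (y - \<kappa>)\<^sup>2)"
      by (rule infsum_cong) (rule Fx)
    also have "\<dots> = (\<tau> d y)\<^sup>2 * (kernel \<kappa> b (f z) y / exp z - ((z - b) / (\<kappa> - b)) * (kernel \<kappa> b (f \<kappa>) y / exp \<kappa>)
      - ((z - \<kappa>) / (b - \<kappa>)) * (kernel \<kappa> b (f b) y / exp b))"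
    proof (rule fibre_sum[OF y\<kappa> ne(6,7) _ \<tau>0 ne(1-5)])
      show "(\<lambda>x. (\<tau> d y)\<^sup>2 * kernel \<kappa> b z x / (y - \<kappa>)\<^sup>2) summable_on {x. f x = y}"
        by (rule summable_on_cong[THEN iffD1, OF Fx fin])
    qed
    finally show "(\<Sum>\<^sub>\<infinity>x\<in>{x. f x = y}. F x) = (\<tau> d y)\<^sup>2 * (kernel \<kappa> b (f z) y / exp z - ((z - b) / (\<kappa> - b)) * (kernel \<kappa> b (f \<kappa>) y / exp \<kappa>)
      - ((z - \<kappa>) / (b - \<kappa>)) * (kernel \<kappa> b (f b) y / exp b))" .
  qed
  also have "\<dots> = vfield b d (f z) / exp z - ((z - b) / (\<kappa> - b)) * (vfield b d (f \<kappa>) / exp \<kappa>)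
      - ((z - \<kappa>) / (b - \<kappa>)) * (vfield b d (f b) / exp b)"
  proof -
    have hs: "((\<lambda>y. c * ((\<tau> d y)\<^sup>2 * kernel \<kappa> b t y)) has_sum c * vfield b d t) ?G" if "t \<in> Ut \<union> {f \<kappa>}" for t c
      using R(5)[OF that] R(6)[OF that] has_sum_infsum by (intro has_sum_cmult_right) simp
    define ca cb where "ca = (z - b) / (\<kappa> - b)" and "cb = (z - \<kappa>) / (b - \<kappa>)"
    have "((\<lambda>y. (1 / exp z) * ((\<tau> d y)\<^sup>2 * kernel \<kappa> b (f z) y) + (- ca / exp \<kappa>) * ((\<tau> d y)\<^sup>2 * kernel \<kappa> b (f \<kappa>) y)
        + (- cb / exp b) * ((\<tau> d y)\<^sup>2 * kernel \<kappa> b (f b) y)) has_sum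
        (1 / exp z) * vfield b d (f z) + (- ca / exp \<kappa>) * vfield b d (f \<kappa>) + (- cb / exp b) * vfield b d (f b)) ?G"
      by (intro has_sum_add hs) (use fU in auto)
    moreover have "(1 / exp z) * ((\<tau> d y)\<^sup>2 * kernel \<kappa> b (f z) y) + (- ca / exp \<kappa>) * ((\<tau> d y)\<^sup>2 * kernel \<kappa> b (f \<kappa>) y)
        + (- cb / exp b) * ((\<tau> d y)\<^sup>2 * kernel \<kappa> b (f b) y) =
        (\<tau> d y)\<^sup>2 * (kernel \<kappa> b (f z) y / exp z - ca * (kernel \<kappa> b (f \<kappa>) y / exp \<kappa>) - cb * (kernel \<kappa> b (f b) y / exp b))" for y
      by (simp add: right_diff_distrib mult_ac)
    ultimately show ?thesis unfolding ca_def[symmetric] cb_def[symmetric] by (simp add: infsumI)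
  qed
  finally show ?thesis .
qed

section \<open>A vanishing combination and the contradiction\<close>

text \<open>Irrationality of \<open>\<alpha>\<close> makes the orbit of the point with
  \<open>\<phi> b = 1 / 2\<close> infinite; it supplies the limit point for the identity
  theorem.\<close>

lemma infinite_orbit_in_compact:
  obtains b where "b \<in> U" "\<exists>K. compact K \<and> K \<subseteq> U \<and> range (\<lambda>n. (f ^^ (p * n)) b) \<subseteq> K"
    "infinite (range (\<lambda>n. (f ^^ (p * n)) b))"
proof -
  define b where "b = \<psi> (1 / 2)"
  have half: "(1 / 2 :: complex) \<in> ball 0 1" by (simp add: norm_divide)
  have b: "b \<in> U" "\<phi> b = 1 / 2" using \<psi>_in_U[OF half] \<phi>_\<psi>[OF half] by (simp_all add: b_def)
  have in_cb: "rot ^ n * \<phi> b \<in> cball 0 (1 / 2)" for n by (simp add: b(2) norm_mult norm_power norm_divide)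
  have sub: "cball 0 (1 / 2) \<subseteq> ball (0::complex) 1" by auto
  show ?thesis
  proof (rule that[OF b(1)])
    show "\<exists>K. compact K \<and> K \<subseteq> U \<and> range (\<lambda>n. (f ^^ (p * n)) b) \<subseteq> K"
    proof (intro exI[of _ "\<psi> ` cball 0 (1 / 2)"] conjI)
      show "compact (\<psi> ` cball 0 (1 / 2))"
        by (intro compact_continuous_image continuous_on_subset[OF continuous_on_\<psi> sub]) simp
      show "\<psi> ` cball 0 (1 / 2) \<subseteq> U" using \<psi>_in_U sub by blast
      show "range (\<lambda>n. (f ^^ (p * n)) b) \<subseteq> \<psi> ` cball 0 (1 / 2)"
        unfolding f_pn_eq[OF b(1)] using in_cb by blast
    qed
    have "inj (\<lambda>n. (f ^^ (p * n)) b)"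
    proof (rule linorder_injI)
      fix m n :: nat assume mn: "m < n"
      show "(f ^^ (p * m)) b \<noteq> (f ^^ (p * n)) b"
      proof
        assume "(f ^^ (p * m)) b = (f ^^ (p * n)) b"
        then have "rot ^ m * \<phi> b = rot ^ n * \<phi> b" using f_pn_in_U[OF b(1)] by metis
        then have "rot ^ m = rot ^ n" by (simp add: b(2))
        moreover have "rot ^ n = rot ^ (n - m) * rot ^ m" using mn by (simp add: power_add[symmetric])
        ultimately have "rot ^ (n - m) = 1" by simp
        then have "exp (of_nat (n - m) * (2 * of_real pi * \<i> * of_real \<alpha>)) = 1"
          by (simp add: exp_of_nat_mult)
        then obtain k :: int where k: "real (n - m) * (2 * pi * \<alpha>) = of_int (2 * k) * pi"
          unfolding exp_eq_1 by (auto simp: mult_ac)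
        then have "real (n - m) * \<alpha> = of_int k" by (simp add: field_simps)
        then have "\<alpha> = of_int k / of_nat (n - m)" using mn by (simp add: field_simps)
        moreover have "of_int k / of_nat (n - m) \<in> (\<rat> :: real set)" by (intro Rats_divide Rats_of_int Rats_of_nat)
        ultimately show False using irrational by simp
      qed
    qed
    then show "infinite (range (\<lambda>n. (f ^^ (p * n)) b))" by (simp add: range_inj_infinite)
  qed
qed

definition poly_bounded :: "(complex \<Rightarrow> complex) \<Rightarrow> bool" where
  "poly_bounded g \<longleftrightarrow> (\<exists>K k. 0 \<le> K \<and> (\<forall>z\<in>V. norm (g z) \<le> K * (1 + norm z) ^ k))"

lemma poly_bounded_mult:
  assumes "poly_bounded g" "poly_bounded h"
  shows "poly_bounded (\<lambda>z. g z * h z)"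
proof -
  obtain K k L l where gh: "0 \<le> K" "0 \<le> L" "\<And>z. z \<in> V \<Longrightarrow> norm (g z) \<le> K * (1 + norm z) ^ k"
      "\<And>z. z \<in> V \<Longrightarrow> norm (h z) \<le> L * (1 + norm z) ^ l"
    using assms unfolding poly_bounded_def by blast
  have "norm (g z * h z) \<le> (K * L) * (1 + norm z) ^ (k + l)" if z: "z \<in> V" for z
  proof -
    have "norm (g z * h z) \<le> (K * (1 + norm z) ^ k) * (L * (1 + norm z) ^ l)"
      unfolding norm_mult using gh z by (intro mult_mono) auto
    then show ?thesis by (simp add: power_add mult_ac)
  qed
  then show ?thesis unfolding poly_bounded_def using gh by (meson mult_nonneg_nonneg)
qed

lemma poly_bounded_add:
  assumes "poly_bounded g" "poly_bounded h"
  shows "poly_bounded (\<lambda>z. g z + h z)"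
proof -
  obtain K k L l where gh: "0 \<le> K" "0 \<le> L" "\<And>z. z \<in> V \<Longrightarrow> norm (g z) \<le> K * (1 + norm z) ^ k"
      "\<And>z. z \<in> V \<Longrightarrow> norm (h z) \<le> L * (1 + norm z) ^ l"
    using assms unfolding poly_bounded_def by blast
  have "norm (g z + h z) \<le> (K + L) * (1 + norm z) ^ (k + l)" if z: "z \<in> V" for z
  proof -
    have p: "(1 + norm z) ^ k \<le> (1 + norm z) ^ (k + l)" "(1 + norm z) ^ l \<le> (1 + norm z) ^ (k + l)"
      by (intro power_increasing; simp)+
    have "norm (g z + h z) \<le> K * (1 + norm z) ^ k + L * (1 + norm z) ^ l"
      using norm_triangle_mono[OF gh(3)[OF z] gh(4)[OF z]] .
    also have "\<dots> \<le> K * (1 + norm z) ^ (k + l) + L * (1 + norm z) ^ (k + l)"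
      using gh p by (intro add_mono mult_left_mono) auto
    finally show ?thesis by (simp add: distrib_right)
  qed
  then show ?thesis unfolding poly_bounded_def using gh by (meson add_nonneg_nonneg)
qed

lemma poly_bounded_const: "poly_bounded (\<lambda>z. c)"
  unfolding poly_bounded_def by (intro exI[of _ "norm c"] exI[of _ 0]) simp

lemma poly_bounded_ident: "poly_bounded (\<lambda>z. z)"
  unfolding poly_bounded_def by (intro exI[of _ 1] exI[of _ 1]) simp

lemma poly_bounded_diff_const: "poly_bounded (\<lambda>z. z - c)"
  using poly_bounded_add[OF poly_bounded_ident poly_bounded_const[of "- c"]] by simp

lemma vanishing_combination:
  assumes b: "b \<in> U" and K: "compact K" "K \<subseteq> U" "range (\<lambda>n. (f ^^ (p * n)) b) \<subseteq> K"
    and inf: "infinite (range (\<lambda>n. (f ^^ (p * n)) b))"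
    and dr: "\<And>i. i \<in> I \<Longrightarrow> ball (d i) r \<subseteq> D - {\<kappa>}" and r: "r > 0" and I: "finite (I :: nat set)"
    and zero: "(\<Sum>i\<in>I. a i * vfield b (d i) (f \<kappa>)) = 0" "(\<Sum>i\<in>I. a i * vfield b (d i) (f b)) = 0"
    and z: "z \<in> closure Ut"
  shows "(\<Sum>i\<in>I. a i * vfield b (d i) z) = 0"
proof -
  define v where "v z = (\<Sum>i\<in>I. a i * vfield b (d i) z)" for z
  have dV: "d i \<in> V" if "i \<in> I" for i using dr[OF that] D_subset_V r centre_in_ball[of "d i" r] by blast
  have dcl: "d i \<notin> closure Ut" "d i \<noteq> \<kappa>" if "i \<in> I" for i
    using dV[OF that] V_Int_closure_Ut dr[OF that] r centre_in_ball[of "d i" r] by blast+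
  have UU: "U \<subseteq> closure Ut" using U_subset_Ut closure_subset[of Ut] by blast
  have bcl: "d i \<noteq> b" if "i \<in> I" for i using dcl[OF that] b UU by blast
  have v\<kappa>b: "vfield b (d i) b = 0" for i by (simp add: vfield_def rest_def kernel_def)
  have fe: "v (f z) = exp z * v z" if z: "z \<in> Ut" for z
  proof (cases "z = b")
    case True
    then show ?thesis using zero(2) v\<kappa>b by (simp add: v_def)
  next
    case False
    define ca cb where "ca = (z - b) / (\<kappa> - b)" and "cb = (z - \<kappa>) / (b - \<kappa>)"
    have "a i * vfield b (d i) z = (1 / exp z) * (a i * vfield b (d i) (f z)) - (ca / exp \<kappa>) * (a i * vfield b (d i) (f \<kappa>))
        - (cb / exp b) * (a i * vfield b (d i) (f b))" if i: "i \<in> I" for i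
      unfolding vfield_functional_equation[OF dr[OF i] r b z False, folded ca_def cb_def]
      by (simp add: right_diff_distrib mult_ac)
    then have "v z = (\<Sum>i\<in>I. (1 / exp z) * (a i * vfield b (d i) (f z)) - (ca / exp \<kappa>) * (a i * vfield b (d i) (f \<kappa>))
        - (cb / exp b) * (a i * vfield b (d i) (f b)))"
      unfolding v_def by (intro sum.cong) auto
    also have "\<dots> = (1 / exp z) * v (f z) - (ca / exp \<kappa>) * v (f \<kappa>) - (cb / exp b) * v (f b)"
      by (simp only: sum_subtractf sum_distrib_left v_def)
    also have "\<dots> = v (f z) / exp z" using zero by (simp add: v_def)
    finally show ?thesis by simp
  qed
  have cont: "continuous_on (closure Ut) v"
    unfolding v_def vfield_def kernel_def
  proof (intro continuous_on_sum continuous_on_mult continuous_on_add continuous_on_divide continuous_intros)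
    fix i assume i: "i \<in> I"
    show "continuous_on (closure Ut) (rest b (d i))"
      using continuous_on_subset[OF rest_facts(1)[OF dr[OF i] r b]] by blast
    show "\<forall>z\<in>closure Ut. (d i - z) * (d i - \<kappa>) * (d i - b) \<noteq> 0"
      using dcl[OF i] bcl[OF i] by auto
  qed
  have hol: "v holomorphic_on U"
    unfolding v_def vfield_def kernel_def
  proof (intro holomorphic_on_sum holomorphic_on_mult holomorphic_on_add holomorphic_on_divide holomorphic_intros)
    fix i assume i: "i \<in> I"
    show "rest b (d i) holomorphic_on U" by (rule rest_facts(3)[OF dr[OF i] r b])
    show "(d i - z) * (d i - \<kappa>) * (d i - b) \<noteq> 0" if "z \<in> U" for z
      using dcl[OF i] bcl[OF i] that UU by auto
  qed
  have bUt: "b \<in> Ut" using b U_subset_Ut by blast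
  have orb: "v ((f ^^ n) b) = 0" for n
  proof (induction n)
    case 0
    then show ?case by (simp add: v_def v\<kappa>b)
  next
    case (Suc n)
    then show ?case using fe[of "(f ^^ n) b"] f_funpow_in_Ut_iff[of n b] bUt by simp
  qed
  obtain \<xi> where \<xi>: "\<xi> \<in> K" "\<xi> islimpt range (\<lambda>n. (f ^^ (p * n)) b)"
    using K(1,3) inf unfolding compact_eq_Bolzano_Weierstrass by blast
  have vU: "v z = 0" if "z \<in> U" for z
    by (rule analytic_continuation[OF hol open_U connected_U _ _ \<xi>(2) _ that])
       (use K \<xi> orb in auto)
  have vUt: "v z = 0" if "(f ^^ n) z \<in> U" for n z
    using that
  proof (induction n arbitrary: z)
    case 0
    then show ?case using vU by simp
  next
    case (Suc n)
    have "(f ^^ n) (f z) \<in> U" using Suc.prems by (simp add: funpow_swap1)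
    then have "v (f z) = 0" by (rule Suc.IH)
    moreover have "z \<in> Ut" using Suc.prems unfolding Ut_def by blast
    ultimately show ?case using fe[of z] by simp
  qed
  have "v z = 0"
    by (rule continuous_constant_on_closure[OF cont _ z]) (use vUt in \<open>auto simp: Ut_def\<close>)
  then show ?thesis by (simp add: v_def)
qed

lemma False_if_wandering: False
proof -
  obtain b K where b: "b \<in> U" and K: "compact K" "K \<subseteq> U" "range (\<lambda>n. (f ^^ (p * n)) b) \<subseteq> K"
    and inf: "infinite (range (\<lambda>n. (f ^^ (p * n)) b))"
    using infinite_orbit_in_compact by metis
  define r where "r = \<delta> / 8"
  \<comment> \<open>For \<open>i = 1, 2, 3\<close> the discs of radius \<open>\<delta> / 8\<close>
    about these points stay in \<open>D\<close> and off \<open>\<kappa>\<close>.\<close>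
  define d where "d i = \<kappa> + of_real (\<delta> / 4 * real i)" for i :: nat
  have r: "r > 0" using \<delta>_pos by (simp add: r_def)
  have dist_d: "dist (d i) \<kappa> = \<delta> / 4 * real i" for i
    using \<delta>_pos by (simp add: d_def dist_norm norm_mult)
  have dr: "ball (d i) r \<subseteq> D - {\<kappa>}" if i: "1 \<le> i" "i \<le> 3" for i
  proof
    fix z assume z: "z \<in> ball (d i) r"
    have 1: "\<delta> / 4 * 1 \<le> \<delta> / 4 * real i" "\<delta> / 4 * real i \<le> \<delta> / 4 * 3"
      using i \<delta>_pos by (intro mult_left_mono; simp)+
    have "dist \<kappa> z \<le> dist (d i) \<kappa> + dist (d i) z" using dist_triangle3[of \<kappa> z "d i"] by (simp add: dist_commute)
    moreover have "dist (d i) \<kappa> \<le> dist (d i) z + dist z \<kappa>" by (rule dist_triangle)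
    ultimately have lt: "dist \<kappa> z < \<delta>"
      using z 1 \<delta>_pos unfolding dist_d r_def mem_ball by linarith
    have "z \<noteq> \<kappa>"
    proof
      assume "z = \<kappa>"
      then have "dist (d i) \<kappa> < \<delta> / 8" using z by (simp add: r_def)
      then show False using dist_d[of i] 1 \<delta>_pos by linarith
    qed
    with lt show "z \<in> D - {\<kappa>}" by simp
  qed
  have dV: "d i \<in> V" if "1 \<le> i" "i \<le> 3" for i using dr[OF that] D_subset_V r centre_in_ball[of "d i" r] by blast
  have inj: "d i = d j \<longleftrightarrow> i = j" for i j using \<delta>_pos by (simp add: d_def)
  obtain a1 a2 a3 where a: "a1 \<noteq> 0 \<or> a2 \<noteq> 0 \<or> a3 \<noteq> 0"
    "a1 * vfield b (d 1) (f \<kappa>) + a2 * vfield b (d 2) (f \<kappa>) + a3 * vfield b (d 3) (f \<kappa>) = 0"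
    "a1 * vfield b (d 1) (f b) + a2 * vfield b (d 2) (f b) + a3 * vfield b (d 3) (f b) = 0"
    by (rule exists_nontrivial_solution_2x3)
  define a where "a i = (if i = 1 then a1 else if i = 2 then a2 else a3)" for i :: nat
  have sum3: "(\<Sum>i\<in>{1, 2, 3}. a i * g i) = a1 * g 1 + a2 * g 2 + a3 * g 3" for g :: "nat \<Rightarrow> complex"
    by (simp add: a_def)
  have dr3: "ball (d i) r \<subseteq> D - {\<kappa>}" if "i \<in> {1, 2, 3}" for i
    by (rule dr) (use that in auto)
  have van: "a1 * vfield b (d 1) z + a2 * vfield b (d 2) z + a3 * vfield b (d 3) z = 0" if z: "z \<in> closure Ut" for z
  proof -
    have "(\<Sum>i\<in>{1, 2, 3}. a i * vfield b (d i) z) = 0"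
    proof (rule vanishing_combination[OF b K inf dr3 r _ _ _ z])
      show "(\<Sum>i\<in>{1, 2, 3}. a i * vfield b (d i) (f \<kappa>)) = 0" unfolding sum3 by (rule a(2))
      show "(\<Sum>i\<in>{1, 2, 3}. a i * vfield b (d i) (f b)) = 0" unfolding sum3 by (rule a(3))
    qed auto
    then show ?thesis unfolding sum3 .
  qed
  \<comment> \<open>\<open>k e\<close> is the kernel with pole \<open>e\<close> times
    \<open>z - e\<close>; \<open>F\<close> is the combination of the three fields times the product
    of all \<open>z - d i\<close>, with the poles removed.\<close>
  define k where "k e z = - ((z - \<kappa>) * (z - b) / ((e - \<kappa>) * (e - b)))" for e z
  define F where "F z =
      a1 * ((k (d 1) z + rest b (d 1) z * (z - d 1)) * ((z - d 2) * (z - d 3)))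
    + a2 * ((k (d 2) z + rest b (d 2) z * (z - d 2)) * ((z - d 1) * (z - d 3)))
    + a3 * ((k (d 3) z + rest b (d 3) z * (z - d 3)) * ((z - d 1) * (z - d 2)))" for z
  have dne: "d i - \<kappa> \<noteq> 0" "d i - b \<noteq> 0" if i: "1 \<le> i" "i \<le> 3" for i
  proof -
    have "d i \<in> ball (d i) r" using r by simp
    then have "d i \<in> D - {\<kappa>}" using dr[OF i] by blast
    then show "d i - \<kappa> \<noteq> 0" by simp
    have "b \<in> closure Ut" using b U_subset_Ut closure_subset[of Ut] by blast
    then show "d i - b \<noteq> 0" using dV[OF i] V_Int_closure_Ut by auto
  qed
  have k_hol: "k (d i) holomorphic_on S" if "1 \<le> i" "i \<le> 3" for i S
    unfolding k_def using dne[OF that] by (intro holomorphic_intros) auto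
  have R: "continuous_on (V \<union> closure Ut) (rest b (d i))" "rest b (d i) holomorphic_on V"
    "poly_bounded (rest b (d i))" if i: "1 \<le> i" "i \<le> 3" for i
  proof -
    note rf = rest_facts[OF dr[OF i] r b]
    show "continuous_on (V \<union> closure Ut) (rest b (d i))" "rest b (d i) holomorphic_on V" by (rule rf(1) rf(2))+
    obtain C where C: "\<And>z. z \<in> V \<Longrightarrow> norm (rest b (d i) z) \<le> C * (1 + norm z) ^ 3" using rf(4) by blast
    have "norm (rest b (d i) z) \<le> \<bar>C\<bar> * (1 + norm z) ^ 3" if "z \<in> V" for z
    proof -
      have "C * (1 + norm z) ^ 3 \<le> \<bar>C\<bar> * (1 + norm z) ^ 3" by (intro mult_right_mono) auto
      then show ?thesis using C[OF that] by linarith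
    qed
    then show "poly_bounded (rest b (d i))" unfolding poly_bounded_def by (intro exI[of _ "\<bar>C\<bar>"] exI[of _ 3]) auto
  qed
  have kb: "poly_bounded (k e)" for e
  proof -
    have "poly_bounded (\<lambda>z. (- 1 / ((e - \<kappa>) * (e - b))) * ((z - \<kappa>) * (z - b)))"
      by (intro poly_bounded_mult poly_bounded_const poly_bounded_diff_const)
    then show ?thesis by (simp add: k_def[abs_def])
  qed
  have holF: "F holomorphic_on V" unfolding F_def
    by (intro holomorphic_intros k_hol R(2)) auto
  have clV: "closure V \<subseteq> V \<union> closure Ut"
    using frontier_V open_V by (auto simp: frontier_def interior_open)
  have contF: "continuous_on (closure V) F"
  proof -
    have "continuous_on (V \<union> closure Ut) F" unfolding F_def
      by (intro continuous_intros R(1) holomorphic_on_imp_continuous_on k_hol) auto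
    then show ?thesis using clV by (rule continuous_on_subset)
  qed
  have "poly_bounded F" unfolding F_def[abs_def]
    by (intro poly_bounded_add poly_bounded_mult poly_bounded_const poly_bounded_diff_const kb R(3)) auto
  then obtain C m where growth: "\<And>z. z \<in> V \<Longrightarrow> norm (F z) \<le> C * (1 + norm z) ^ m"
    unfolding poly_bounded_def by blast
  have frF: "F z = 0" if z: "z \<in> frontier V" for z
  proof -
    have zcl: "z \<in> closure Ut" using z frontier_V by blast
    have zV: "z \<notin> V" using z open_V by (simp add: frontier_def interior_open)
    then have zd: "z \<noteq> d 1" "z \<noteq> d 2" "z \<noteq> d 3" using dV by auto
    have kk: "k (d i) z + rest b (d i) z * (z - d i) = vfield b (d i) z * (z - d i)" if "z \<noteq> d i" for i
      unfolding vfield_def distrib_right kernel_mult_diff[OF that] k_def ..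
    have "F z = (a1 * vfield b (d 1) z + a2 * vfield b (d 2) z + a3 * vfield b (d 3) z) * ((z - d 1) * (z - d 2) * (z - d 3))"
      unfolding F_def kk[OF zd(1)] kk[OF zd(2)] kk[OF zd(3)] distrib_right by (simp only: mult_ac)
    then show ?thesis using van[OF zcl] by simp
  qed
  obtain s where s: "s > 0" "ball b s \<subseteq> U" using b open_U open_contains_ball by blast
  have "ball b s \<inter> V = {}" using s(2) V_Int_closure_Ut U_subset_Ut closure_subset[of Ut] by blast
  then have F0: "F z = 0" if "z \<in> V" for z
    using holomorphic_eq_0_if_frontier_eq_0[OF open_V holF contF frF growth s(1) _ that] by blast
  have kd: "k (d i) (d i) = - 1" if "1 \<le> i" "i \<le> 3" for i using dne[OF that] by (simp add: k_def)
  \<comment> \<open>At each \<open>d i\<close> only the cleared pole of its own field survives, so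
    the vanishing of \<open>F\<close> kills every coefficient.\<close>
  have "F (d 1) = - a1 * ((d 1 - d 2) * (d 1 - d 3))" "F (d 2) = - a2 * ((d 2 - d 1) * (d 2 - d 3))"
    "F (d 3) = - a3 * ((d 3 - d 1) * (d 3 - d 2))"
    unfolding F_def by (simp_all add: kd)
  then have "a1 = 0 \<and> a2 = 0 \<and> a3 = 0" using F0 dV inj by simp
  then show False using a(1) by blast
qed

end

theorem mainTheorem1:
  fixes \<kappa> :: complex and U :: "complex set" and p :: nat
  assumes "siegel_disk (exp_map \<kappa>) p U"
    and "\<not> bounded U"
  shows "\<exists>j::nat. \<kappa> \<in> frontier ((exp_map \<kappa> ^^ j) ` U)"
proof (rule ccontr)
  assume none: "\<not> ?thesis"
  let ?f = "exp_map \<kappa>"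
  from assms(1) obtain \<phi> \<alpha> where S: "U \<in> components (fatou_set ?f)" "1 \<le> p" "(?f ^^ p) ` U \<subseteq> U"
    "\<alpha> \<notin> \<rat>" "conformal_isomorphism \<phi> U (ball 0 1)"
    "\<And>z. z \<in> U \<Longrightarrow> \<phi> ((?f ^^ p) z) = exp (2 * of_real pi * \<i> * of_real \<alpha>) * \<phi> z"
    unfolding siegel_disk_def by blast
  have bij: "bij_betw \<phi> U (ball 0 1)" using S(5) by (simp add: conformal_isomorphism_def)
  \<comment> \<open>The rotation makes the \<open>p\<close>-th iterate surjective on
    \<open>U\<close>, while it omits \<open>\<kappa>\<close>.\<close>
  have "\<kappa> \<notin> U"
  proof
    assume \<kappa>U: "\<kappa> \<in> U"
    define rot where "rot = exp (2 * of_real pi * \<i> * of_real \<alpha> :: complex)"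
    have nrot: "norm rot = 1" "rot \<noteq> 0" by (simp_all add: rot_def norm_exp_eq_Re)
    have "\<phi> \<kappa> \<in> ball 0 1" using bij \<kappa>U by (auto simp: bij_betw_def)
    then have "\<phi> \<kappa> / rot \<in> \<phi> ` U" using bij nrot by (simp add: bij_betw_def norm_divide)
    then obtain y where y: "y \<in> U" "\<phi> y = \<phi> \<kappa> / rot" by (metis imageE)
    then have "\<phi> ((?f ^^ p) y) = \<phi> \<kappa>" using S(6)[OF y(1)] nrot by (simp add: rot_def[symmetric])
    then have "(?f ^^ p) y = \<kappa>" using bij y(1) S(3) \<kappa>U by (auto simp: bij_betw_def inj_on_def)
    then show False using exp_map_funpow_neq[OF S(2)] by blast
  qed
  then have notin: "\<kappa> \<notin> (?f ^^ j) ` U" for j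
  proof (cases "j = 0")
    case False
    then show ?thesis using exp_map_funpow_neq[of j \<kappa>] by (metis One_nat_def Suc_leI image_iff not_gr_zero)
  qed simp
  have cl: "\<kappa> \<notin> closure ((?f ^^ j) ` U)" for j
    using notin[of j] none interior_subset by (auto simp: frontier_def)
  \<comment> \<open>Every image of \<open>U\<close> lies in one of the first \<open>p\<close>, so
    finitely many closures suffice to free a disc around \<open>\<kappa>\<close>.\<close>
  define A where "A = (\<Union>j<p. closure ((?f ^^ j) ` U))"
  have "closed A" "\<kappa> \<notin> A" unfolding A_def using cl by (auto intro!: closed_UN)
  then obtain e where e: "e > 0" "ball \<kappa> e \<subseteq> - A" by (metis ComplI open_Compl open_contains_ball)
  \<comment> \<open>\<open>exp (Re \<kappa> - 2)\<close> and \<open>\<delta> \<le> 1\<close> give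
    \<open>ln \<delta> \<le> Re \<kappa> - 2 < Re \<kappa> - \<delta>\<close>.\<close>
  define \<delta> where "\<delta> = min (min e 1) (exp (Re \<kappa> - 2))"
  have \<delta>: "\<delta> > 0" "\<delta> \<le> e" "\<delta> \<le> 1" "\<delta> \<le> exp (Re \<kappa> - 2)" using e by (auto simp: \<delta>_def)
  have "ln \<delta> \<le> Re \<kappa> - 2" using \<delta> by (metis exp_ln exp_le_cancel_iff)
  then have small: "ln \<delta> < Re \<kappa> - \<delta>" using \<delta>(3) by linarith
  have pn: "(?f ^^ (p * n)) z \<in> U" if "z \<in> U" for n z
    using that S(3) by (induction n) (auto simp: funpow_add)
  have av: "(?f ^^ j) ` U \<inter> ball \<kappa> \<delta> = {}" for j
  proof -
    have "(?f ^^ j) z \<in> A" if z: "z \<in> U" for z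
    proof -
      have "(?f ^^ j) z = (?f ^^ (j mod p)) ((?f ^^ (p * (j div p))) z)"
        by (metis comp_apply funpow_add mod_mult_div_eq)
      then have "(?f ^^ j) z \<in> (?f ^^ (j mod p)) ` U" using pn[OF z] by blast
      then have "(?f ^^ j) z \<in> closure ((?f ^^ (j mod p)) ` U)" by (rule closure_subset[THEN subsetD])
      moreover have "j mod p < p" using S(2) by simp
      ultimately show ?thesis unfolding A_def by blast
    qed
    moreover have "ball \<kappa> \<delta> \<subseteq> - A" using e(2) subset_ball[OF \<delta>(2), of \<kappa>] by blast
    ultimately show ?thesis by blast
  qed
  have loc: "siegel_exp \<kappa> U p \<phi> \<alpha> \<delta>"
    by unfold_locales (use S \<delta>(1) small av in auto)
  show False
  proof (cases "\<exists>n z. 1 \<le> n \<and> z \<in> ball \<kappa> \<delta> \<and> (?f ^^ n) z \<in> ball \<kappa> \<delta>")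
    case True
    then show False using siegel_exp.bounded_U_if_D_returns[OF loc] assms(2) by blast
  next
    case False
    have "wandering_exp \<kappa> U p \<phi> \<alpha> \<delta>"
      by (intro wandering_exp.intro loc wandering_exp_axioms.intro) (use False in blast)
    then show False by (rule wandering_exp.False_if_wandering)
  qed
qed

end
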